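(* Let $\varphi\in C^\infty(\mathbb{R})$ be a fixed non-negative function with $\mathrm{supp}(\varphi)=[-2,2]$ and $\varphi\equiv1$ on $[-1,1]$, and put $\varphi_{T,H}(t):=\frac1H\varphi\big(\frac{t-T}{H}\big)$. There exists $T_0=T_0(\Gamma)>0$ such that for all $T\ge T_0$, all $\eta>0$, all $H$ with $T^{\eta}\le H\le T$, all $b\in\mathcal{A}$, all $\mathbf{a},\mathbf{b}\in\mathcal{W}^\circ$ with $\mathbf{a}\to b$ and $\mathbf{b}\to b$, all measurable $f\colon D\to\mathbb{C}$, and all $\epsilon>0$, the following holds with $h:=\frac1T$: $$\left|\int_{\Omega_b(h)}\widehat{\varphi_{T,H}}\big(\Phi_{\mathbf{a},\mathbf{b}}(z)\big)f(z)\,\mathrm{dvol}(z)\right|\ll_{\epsilon,\eta,\Gamma}\begin{cases}h^{-\delta+2}\,\|f\|_{\infty,\Omega_b(h)}&\text{if }\mathbf{a}=\mathbf{b},\\[0.3em] h^{-\delta+2}\,\mathcal{D}_{\mathbf{a},\mathbf{b}}^{-\delta}\,H^{-\delta+\epsilon}\,\|f\|_{\infty,\Omega_b(h)}&\text{if }\mathbf{a}\ne\mathbf{b},\end{cases}$$ where $\|f\|_{\infty,\Omega_b(h)}:=\sup_{z\in\Omega_b(h)}|f(z)|$.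
   Context: Schottky data. Let $m\ge2$, $\mathcal{A}=\{1,\dots,2m\}$, and $\overline a=a+m$ if $a\le m$, $\overline a=a-m$ if $a>m$. Let $D_1,\dots,D_{2m}\subset\mathbb{C}$ be open disks centered on the real axis with pairwise disjoint closures, and let $\gamma_1,\dots,\gamma_{2m}\in\mathrm{SL}_2(\mathbb{R})$ (acting by Möbius transformations on $\mathbb{C}\cup\{\infty\}$) satisfy $\gamma_{\overline a}=\gamma_a^{-1}$ and $\gamma_a\big((\mathbb{C}\cup\{\infty\})\setminus\mathrm{cl}(D_{\overline a})\big)=D_a$, where $\mathrm{cl}$ is closure. $\Gamma$ is the (free, non-elementary Schottky) group generated by the $\gamma_a$, $\Lambda\subset\mathbb{R}$ its limit set, $\delta\in(0,1)$ the Hausdorff dimension of $\Lambda$. Put $D=\bigsqcup_{a}D_a$, $I_a=D_a\cap\mathbb{R}$. "Depending only on $\Gamma$" means depending only on the Schottky data (and on the fixed auxiliary choices such as $o_a$ and $\varphi$). Words. A reduced word is $\mathbf{a}=a_1\cdots a_n$ with $a_j\in\mathcal{A}$, $a_j\ne\overline{a_{j+1}}$. $\mathcal{W}$ is the set of reduced words including the empty word $\emptyset$; $\mathcal{W}^\circ=\mathcal{W}\setminus\{\emptyset\}$. $\gamma_{\mathbf{a}}=\gamma_{a_1}\cdots\gamma_{a_n}$, $\gamma_\emptyset=\mathrm{id}$. $\mathbf{a}\to\mathbf{b}$ means one of the words is empty or the last letter $a_n$ of $\mathbf{a}$ satisfies $a_n\ne\overline{b_1}$ with $b_1$ the first letter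 of $\mathbf{b}$; letters are words of length one. $\overline{\mathbf{a}}=\overline{a_n}\cdots\overline{a_1}$. $\mathsf{red}(\mathbf{a})$ is the reduced word obtained by repeatedly deleting $a\overline a$. For each $a\in\mathcal{A}$ fix $o_a\in I_a$; for $\mathbf{a}\in\mathcal{W}^\circ$ let $o_{\mathbf{a}}=o_b$ for some fixed choice of $b\in\mathcal{A}$ with $\mathbf{a}\to b$, and let $o_\emptyset\in D$ be any point. $\Upsilon_{\mathbf{a}}:=\gamma_{\mathbf{a}}'(o_{\mathbf{a}})$, so $\Upsilon_\emptyset=1$. Define $$\mathcal{D}_{\mathbf{a},\mathbf{b}}:=\left(\frac{\Upsilon_{\mathbf{a}}\Upsilon_{\mathbf{b}}}{\Upsilon_{\mathsf{red}(\mathbf{a}\overline{\mathbf{b}})}}\right)^{1/2}.$$ Phase. $\mathbb{L}(w)=\log|w|+i\arg(w)$ with principal argument $\arg\colon\mathbb{C}\setminus(-\infty,0]\to(-\pi,\pi)$. For $z\in D_b$ with $\mathbf{a},\mathbf{b}\to b$, $\Phi_{\mathbf{a},\mathbf{b}}(z):=\overline{\mathbb{L}(\gamma_{\mathbf{b}}'(z))}-\mathbb{L}(\gamma_{\mathbf{a}}'(z))$ (overline is complex conjugation here). Refined domain. For $h>0$ let $\Lambda(h)=\Lambda+(-h,h)\subset\mathbb{R}$, with connected components (intervals) $I_1(h),\dots,I_{N(h)}(h)$. Let $D_l(h)\subset\mathbb{C}$ be the open disk centered on $\mathbb{R}$ with $D_l(h)\cap\mathbb{R}=I_l(h)$. $\Omega(h)=\bigsqcup_l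 D_l(h)$ and $\Omega_b(h)=\Omega(h)\cap D_b$. The Fourier transform is $\widehat{\psi}(\xi)=\int_{-\infty}^\infty\psi(t)e^{-it\xi}\,dt$, defined for all $\xi\in\mathbb{C}$ when $\psi\in C_c^\infty(\mathbb{R})$. $\mathrm{dvol}$ is Lebesgue measure on $\mathbb{C}$. $A\ll_{\epsilon,\eta,\Gamma}B$ means $|A|\le CB$ with $C$ depending only on $\epsilon,\eta,\Gamma$ (and the fixed $\varphi$). The bound is understood as vacuous if $\|f\|_{\infty,\Omega_b(h)}=\infty$. *)

theory Defs
  imports "HOL-Analysis.Analysis"
begin

section \<open>Moebius action of real matrices\<close>

text \<open>The matrix with rows \<open>(a, b)\<close> and \<open>(c, d)\<close> acts by \<open>z \<mapsto> (a z + b) / (c z + d)\<close>; on the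
  Riemann sphere, modelled as \<^typ>\<open>complex option\<close>, \<^const>\<open>None\<close> is the point at infinity.\<close>

definition moeb :: "real^2^2 \<Rightarrow> complex \<Rightarrow> complex" where
  "moeb A = moebius (of_real (A$1$1)) (of_real (A$1$2)) (of_real (A$2$1)) (of_real (A$2$2))"

fun moeb_sphere :: "real^2^2 \<Rightarrow> complex option \<Rightarrow> complex option" where
  "moeb_sphere A None = (if A$2$1 = 0 then None else Some (of_real (A$1$1 / A$2$1)))"
| "moeb_sphere A (Some z) =
     (if of_real (A$2$1) * z + of_real (A$2$2) = 0 then None else Some (moeb A z))"

section \<open>Schottky data\<close>

definition letters :: "nat \<Rightarrow> nat set" where
  "letters m = {1..2*m}"

definition bar :: "nat \<Rightarrow> nat \<Rightarrow> nat" where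
  "bar m a = (if a \<le> m then a + m else a - m)"

definition schottky_data :: "nat \<Rightarrow> (nat \<Rightarrow> complex set) \<Rightarrow> (nat \<Rightarrow> real^2^2) \<Rightarrow> bool" where
  "schottky_data m D \<gamma> \<longleftrightarrow>
     2 \<le> m \<and>
     (\<forall>a\<in>letters m. \<exists>c::real. \<exists>r>0. D a = ball (of_real c) r) \<and>
     disjoint_family_on (\<lambda>a. closure (D a)) (letters m) \<and>
     (\<forall>a\<in>letters m. det (\<gamma> a) = 1) \<and>
     (\<forall>a\<in>letters m. \<gamma> (bar m a) = matrix_inv (\<gamma> a)) \<and>
     (\<forall>a\<in>letters m. moeb_sphere (\<gamma> a) ` (- (Some ` closure (D (bar m a)))) = Some ` D a)"

definition schottky_group :: "nat \<Rightarrow> (nat \<Rightarrow> real^2^2) \<Rightarrow> (real^2^2) set" where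
  "schottky_group m \<gamma> =
     (\<lambda>G. mat 1 \<in> G \<and> (\<forall>A\<in>G. \<forall>B\<in>G. A ** B \<in> G) \<and> (\<forall>A\<in>G. matrix_inv A \<in> G))
       hull (\<gamma> ` letters m)"

text \<open>The limit set: the accumulation points of orbits of points of the upper half-plane.
  For Schottky data it lies in the union of the disks \<open>D a\<close>, so infinity is never a limit point
  and it suffices to collect the finite, real ones.\<close>

definition limit_set :: "nat \<Rightarrow> (nat \<Rightarrow> real^2^2) \<Rightarrow> real set" where
  "limit_set m \<gamma> =
     {x. \<exists>z. Im z > 0 \<and> complex_of_real x islimpt ((\<lambda>A. moeb A z) ` schottky_group m \<gamma>)}"

section \<open>Hausdorff dimension\<close>

text \<open>The library's \<^const>\<open>diameter\<close> is \<open>0\<close> on unbounded sets, hence the boundedness requirement.\<close>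

definition hausdorff_content :: "real \<Rightarrow> real \<Rightarrow> real set \<Rightarrow> ennreal" where
  "hausdorff_content s e A =
     Inf {(\<Sum>i. ennreal (diameter (U i) powr s)) |U :: nat \<Rightarrow> real set.
            A \<subseteq> (\<Union>i. U i) \<and> (\<forall>i. bounded (U i) \<and> diameter (U i) \<le> e)}"

definition hausdorff_measure :: "real \<Rightarrow> real set \<Rightarrow> ennreal" where
  "hausdorff_measure s A = (SUP e\<in>{0<..}. hausdorff_content s e A)"

text \<open>The exponent \<open>s = 0\<close> is left out, which does not affect the infimum, because
  \<open>0 powr 0 = 0\<close> would give the wrong zero-dimensional measure. Every subset of the line has
  measure zero for \<open>s > 1\<close>, so the infimum is over a nonempty set.\<close>

definition hausdorff_dim :: "real set \<Rightarrow> real" where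
  "hausdorff_dim A = Inf {s. 0 < s \<and> hausdorff_measure s A = 0}"

section \<open>Words\<close>

definition words :: "nat \<Rightarrow> nat list set" where
  "words m = {w. set w \<subseteq> letters m \<and> successively (\<lambda>a b. a \<noteq> bar m b) w}"

definition words_ne :: "nat \<Rightarrow> nat list set" where
  "words_ne m = words m - {[]}"

definition follows :: "nat \<Rightarrow> nat list \<Rightarrow> nat list \<Rightarrow> bool" where
  "follows m v w \<longleftrightarrow> v = [] \<or> w = [] \<or> last v \<noteq> bar m (hd w)"

definition bar_word :: "nat \<Rightarrow> nat list \<Rightarrow> nat list" where
  "bar_word m w = rev (map (bar m) w)"

fun red :: "nat \<Rightarrow> nat list \<Rightarrow> nat list" where
  "red m [] = []"
| "red m (a # w) =
     (case red m w of [] \<Rightarrow> [a] | b # v \<Rightarrow> if b = bar m a then v else a # b # v)"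

text \<open>\<^const>\<open>red\<close> is indeed the reduced word reached by deleting factors \<open>a (bar a)\<close>.\<close>

inductive cancel :: "nat \<Rightarrow> nat list \<Rightarrow> nat list \<Rightarrow> bool" for m where
  "cancel m (u @ a # bar m a # v) (u @ v)"

lemma cancel_Cons: "cancel m v w \<Longrightarrow> cancel m (a # v) (a # w)"
  by (metis append_Cons cancel.simps)

lemma cancel_red: "(cancel m)\<^sup>*\<^sup>* w (red m w)"
proof (induction w)
  case (Cons a w)
  have 1: "(cancel m)\<^sup>*\<^sup>* (a # w) (a # red m w)"
    using Cons.IH by induction (auto intro: cancel_Cons rtranclp.rtrancl_into_rtrancl)
  have "cancel m (a # bar m a # v) v" for v
    using cancel.intros[of m "[]" a v] by simp
  with 1 show ?case
    by (auto split: list.splits intro: rtranclp.rtrancl_into_rtrancl)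
qed simp

lemma red_in_words:
  assumes "set w \<subseteq> letters m"
  shows "red m w \<in> words m"
  using assms
proof (induction w)
  case (Cons a w)
  then have a: "a \<in> letters m" and IH: "red m w \<in> words m"
    by auto
  have "b = bar m a" if "a = bar m b" "b \<in> letters m" for b
    using a that by (auto simp: letters_def bar_def split: if_splits)
  then show ?case
    using a IH by (fastforce simp: words_def successively_Cons split: list.splits)
qed (simp add: words_def)

definition word_mat :: "(nat \<Rightarrow> real^2^2) \<Rightarrow> nat list \<Rightarrow> real^2^2" where
  "word_mat \<gamma> w = foldr (\<lambda>a A. \<gamma> a ** A) w (mat 1)"

definition deriv_word :: "(nat \<Rightarrow> real^2^2) \<Rightarrow> nat list \<Rightarrow> complex \<Rightarrow> complex" where
  "deriv_word \<gamma> w = deriv (moeb (word_mat \<gamma> w))"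

section \<open>Base points and distortion\<close>

text \<open>\<open>p a\<close> is the base point in \<open>D a \<inter> \<real>\<close>, \<open>nx w\<close> is the letter \<open>b\<close> chosen for the nonempty
  reduced word \<open>w\<close>, and \<open>pe\<close> is the base point of the empty word.\<close>

definition base_choices ::
    "nat \<Rightarrow> (nat \<Rightarrow> complex set) \<Rightarrow> (nat \<Rightarrow> real) \<Rightarrow> (nat list \<Rightarrow> nat) \<Rightarrow> complex \<Rightarrow> bool" where
  "base_choices m D p nx pe \<longleftrightarrow>
     (\<forall>a\<in>letters m. complex_of_real (p a) \<in> D a) \<and>
     (\<forall>w\<in>words_ne m. nx w \<in> letters m \<and> follows m w [nx w]) \<and>
     pe \<in> (\<Union>a\<in>letters m. D a)"

definition base_pt :: "(nat \<Rightarrow> real) \<Rightarrow> (nat list \<Rightarrow> nat) \<Rightarrow> complex \<Rightarrow> nat list \<Rightarrow> complex" where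
  "base_pt p nx pe w = (if w = [] then pe else of_real (p (nx w)))"

text \<open>The derivative below is real (and positive): the matrix and the base point are real for
  nonempty words, and the map is the identity for the empty word. So \<^const>\<open>Re\<close> only
  changes the type.\<close>

definition Upsilon ::
    "(nat \<Rightarrow> real^2^2) \<Rightarrow> (nat \<Rightarrow> real) \<Rightarrow> (nat list \<Rightarrow> nat) \<Rightarrow> complex \<Rightarrow> nat list \<Rightarrow> real" where
  "Upsilon \<gamma> p nx pe w = Re (deriv_word \<gamma> w (base_pt p nx pe w))"

definition word_dist ::
    "nat \<Rightarrow> (nat \<Rightarrow> real^2^2) \<Rightarrow> (nat \<Rightarrow> real) \<Rightarrow> (nat list \<Rightarrow> nat) \<Rightarrow> complex
      \<Rightarrow> nat list \<Rightarrow> nat list \<Rightarrow> real" where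
  "word_dist m \<gamma> p nx pe v w =
     sqrt (Upsilon \<gamma> p nx pe v * Upsilon \<gamma> p nx pe w
             / Upsilon \<gamma> p nx pe (red m (v @ bar_word m w)))"

section \<open>Phase, refined domain, Fourier transform\<close>

text \<open>\<^const>\<open>Ln\<close> is \<open>log \<bar>w\<bar> + i arg w\<close> with the principal argument off the half-line
  \<open>(-\<infinity>, 0]\<close>; the derivatives avoid that half-line on the disks where the phase is used.\<close>

definition phase :: "(nat \<Rightarrow> real^2^2) \<Rightarrow> nat list \<Rightarrow> nat list \<Rightarrow> complex \<Rightarrow> complex" where
  "phase \<gamma> v w z = cnj (Ln (deriv_word \<gamma> w z)) - Ln (deriv_word \<gamma> v z)"

definition limit_nbhd :: "nat \<Rightarrow> (nat \<Rightarrow> real^2^2) \<Rightarrow> real \<Rightarrow> real set" where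
  "limit_nbhd m \<gamma> h = {x + t |x t. x \<in> limit_set m \<gamma> \<and> t \<in> {-h<..<h}}"

definition Omega :: "nat \<Rightarrow> (nat \<Rightarrow> real^2^2) \<Rightarrow> real \<Rightarrow> complex set" where
  "Omega m \<gamma> h =
     \<Union>{ball (complex_of_real c) r |c r.
          {x. complex_of_real x \<in> ball (complex_of_real c) r} \<in> components (limit_nbhd m \<gamma> h)}"

definition Omega_at ::
    "nat \<Rightarrow> (nat \<Rightarrow> complex set) \<Rightarrow> (nat \<Rightarrow> real^2^2) \<Rightarrow> nat \<Rightarrow> real \<Rightarrow> complex set" where
  "Omega_at m D \<gamma> b h = Omega m \<gamma> h \<inter> D b"

definition fourier :: "(real \<Rightarrow> real) \<Rightarrow> complex \<Rightarrow> complex" where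
  "fourier \<psi> \<xi> = (\<integral>t. of_real (\<psi> t) * exp (- (\<i> * of_real t * \<xi>)) \<partial>lborel)"

definition smooth :: "(real \<Rightarrow> real) \<Rightarrow> bool" where
  "smooth \<psi> \<longleftrightarrow> (\<forall>n x. ((deriv ^^ n) \<psi>) field_differentiable (at x))"

definition cutoff :: "(real \<Rightarrow> real) \<Rightarrow> real \<Rightarrow> real \<Rightarrow> real \<Rightarrow> real" where
  "cutoff \<phi> T H t = 1 / H * \<phi> ((t - T) / H)"

end

theory Submission
  imports Defs
begin

text \<open>
  \<^bold>\<open>Phase.\<close> For a nonempty reduced word \<open>w\<close> the map \<open>\<gamma>\<^sub>w\<close> has derivative \<open>1 / (c (z - p))\<^sup>2\<close>, where \<open>c\<close>
  is the lower left entry of the matrix and \<open>p\<close> is the pole of \<open>\<gamma>\<^sub>w\<close>. The pole lies in the disk of the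
  letter \<open>bar\<close> of the last letter of \<open>w\<close>, hence at a distance bounded above and below from every disk
  \<open>D b\<close> with \<open>w \<rightarrow> b\<close>. So on \<open>D b\<close> the imaginary part of the phase is \<open>O(\<bar>Im z\<bar>)\<close>, and its real part is
  \<open>2 log \<bar>z - p\<^sub>v\<bar> - 2 log \<bar>z - p\<^sub>w\<bar>\<close> plus a constant. Along the real axis the derivative of the latter has
  constant sign and size comparable to \<open>\<bar>p\<^sub>v - p\<^sub>w\<bar>\<close>. As the lower left entry of \<open>\<gamma>\<^sub>v \<gamma>\<^sub>w\<^sup>-\<^sup>1\<close> is
  \<open>c\<^sub>v c\<^sub>w (p\<^sub>v - p\<^sub>w)\<close>, the distance \<open>word_dist\<close> of \<open>v\<close> and \<open>w\<close> is comparable to \<open>\<bar>p\<^sub>v - p\<^sub>w\<bar>\<close> too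
  (\<open>phase_separates\<close>, \<open>word_dist_poles\<close>).

  \<^bold>\<open>Integral.\<close> Points of \<open>\<Omega>(h)\<close> have imaginary part \<open>O(h)\<close> (\<open>component_of_nbhd\<close>). With \<open>h = 1 / T\<close> this
  bounds the factor \<open>exp (T Im \<Phi>)\<close> of the Fourier transform, so that three integrations by parts give
  decay like \<open>(1 + H \<bar>Re \<Phi>\<bar>)\<^sup>-\<^sup>3\<close> (\<open>fourier_phase_bound\<close>). The set where \<open>H \<bar>Re \<Phi>\<bar> \<le> 2\<^sup>j\<close> projects to a
  real set of diameter \<open>O(2\<^sup>j / (H word_dist))\<close>, and a piece of \<open>\<Omega>(h)\<close> over a real set of diameter \<open>\<rho> \<ge> h\<close>
  has area \<open>O(h\<^sup>2 (\<rho> / h)\<^sup>\<delta>)\<close> (\<open>area_bound\<close>). Since \<open>\<delta> \<le> 2 < 3\<close>, the sum over \<open>j\<close> converges to a multiple of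
  its first term, which is the claim for \<open>v \<noteq> w\<close>. For \<open>v = w\<close> a bounded integrand and the area of
  \<open>\<Omega>\<^sub>b(h)\<close> suffice.

  \<^bold>\<open>Area.\<close> The area bound is a packing bound: \<open>h\<close>-separated points in a piece of the limit set of
  diameter \<open>\<rho>\<close> number \<open>O((\<rho> / h)\<^sup>\<delta>)\<close>, with \<open>\<delta>\<close> the Hausdorff dimension. It holds for every compact
  set whose small pieces can be blown up into the set and into whose small balls the set can be
  shrunk (locale \<open>quasi_self_similar\<close>). Blowing up the members of an efficient cover bounds the packing
  numbers by a multiple of \<open>t powr - s\<close> for each \<open>s > \<delta>\<close>, and shrinking shows that packing numbers are
  supermultiplicative, which makes the multiple independent of \<open>s\<close>. For the limit set both
  properties express that \<open>\<gamma>\<^sub>w\<close> is, up to bounded factors, a similarity of ratio \<open>c\<^sup>-\<^sup>2\<close> on the disks that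
  may follow \<open>w\<close> (\<open>bilipschitz\<close>).
\<close>

section \<open>Separated sets and Hausdorff dimension\<close>

definition sep :: "real \<Rightarrow> real set \<Rightarrow> bool" where
  "sep t A \<longleftrightarrow> finite A \<and> (\<forall>x\<in>A. \<forall>y\<in>A. x \<noteq> y \<longrightarrow> t \<le> \<bar>x - y\<bar>)"

lemma sep_finite: "sep t A \<Longrightarrow> finite A"
  by (simp add: sep_def)

lemma sep_subset: "sep t A \<Longrightarrow> B \<subseteq> A \<Longrightarrow> sep t B"
  unfolding sep_def using finite_subset by blast

text \<open>Lower Lipschitz maps carry packing numbers of one set to another at a rescaled distance; the two
  hypotheses on self-similarity below are therefore stated as lower Lipschitz bounds.\<close>
lemma sep_image:
  assumes "sep t A" "0 < t" "0 < l" "\<And>y z. y \<in> A \<Longrightarrow> z \<in> A \<Longrightarrow> l * \<bar>y - z\<bar> \<le> \<bar>g y - g z\<bar>"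
  shows "sep (l * t) (g ` A)" "card (g ` A) = card A"
proof -
  have *: "l * t \<le> \<bar>g y - g z\<bar>" if "y \<in> A" "z \<in> A" "y \<noteq> z" for y z
  proof -
    have "t \<le> \<bar>y - z\<bar>" using assms(1) that by (auto simp: sep_def)
    then have "l * t \<le> l * \<bar>y - z\<bar>" using assms(3) by simp
    then show ?thesis using assms(4)[OF that(1,2)] by linarith
  qed
  have "0 < l * t" using assms by simp
  then have "inj_on g A" using * by (force intro: inj_onI)
  then show "card (g ` A) = card A" by (rule card_image)
  show "sep (l * t) (g ` A)" using assms(1) * by (auto simp: sep_def)
qed

text \<open>The cells of length \<open>t\<close>, counted from the smallest point, contain at most one point each.\<close>
lemma sep_card_le:
  assumes "sep t A" "0 < t" "0 \<le> d" "\<And>y z. y \<in> A \<Longrightarrow> z \<in> A \<Longrightarrow> \<bar>y - z\<bar> \<le> d"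
  shows "real (card A) \<le> 1 + d / t"
proof (cases "A = {}")
  case False
  define u where "u = Min A"
  have fin: "finite A" using assms(1) by (simp add: sep_def)
  have u: "u \<in> A" "\<And>x. x \<in> A \<Longrightarrow> u \<le> x" using fin False by (auto simp: u_def)
  define f where "f x = \<lfloor>(x - u) / t\<rfloor>" for x
  have "inj_on f A"
  proof (rule inj_onI, rule ccontr)
    fix x y assume xy: "x \<in> A" "y \<in> A" "f x = f y" "x \<noteq> y"
    then have "\<bar>(x - u) / t - (y - u) / t\<bar> < 1" unfolding f_def by linarith
    moreover have "(x - u) / t - (y - u) / t = (x - y) / t" by (simp add: diff_divide_distrib)
    ultimately have "\<bar>x - y\<bar> < t" using assms(2) by (simp add: abs_if divide_simps split: if_splits)
    moreover have "t \<le> \<bar>x - y\<bar>" using assms(1) xy(1,2,4) by (simp add: sep_def)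
    ultimately show False by simp
  qed
  moreover have "f ` A \<subseteq> {0..\<lfloor>d / t\<rfloor>}"
  proof
    fix k assume "k \<in> f ` A"
    then obtain x where x: "x \<in> A" "k = f x" by auto
    have "0 \<le> x - u" "x - u \<le> d" using u x assms(4)[of x u] by auto
    then have "0 \<le> (x - u) / t" "(x - u) / t \<le> d / t" using assms(2) by (auto simp: divide_right_mono)
    then show "k \<in> {0..\<lfloor>d / t\<rfloor>}" using x(2) by (auto simp: f_def floor_mono)
  qed
  ultimately have "card A \<le> card {0..\<lfloor>d / t\<rfloor>}"
    by (metis card_inj_on_le finite_atLeastAtMost_int)
  also have "card {0..\<lfloor>d / t\<rfloor>} = nat (\<lfloor>d / t\<rfloor> + 1)" by simp
  finally have "real (card A) \<le> real (nat (\<lfloor>d / t\<rfloor> + 1))" by (rule of_nat_mono)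
  also have "\<dots> \<le> 1 + d / t" using assms(2,3)
    by (simp add: of_nat_nat)
  finally show ?thesis .
qed (use assms in auto)

lemma le_of_power_le:
  fixes x y A :: real
  assumes "0 < x" "\<And>n::nat. y ^ n \<le> A * x ^ n"
  shows "y \<le> x"
proof (rule ccontr)
  assume "\<not> y \<le> x"
  then have "1 < y / x" using assms(1) by simp
  then obtain n where "A < (y / x) ^ n" using real_arch_pow by blast
  then have "A * x ^ n < y ^ n" using assms(1) by (simp add: power_divide divide_simps)
  then show False using assms(2)[of n] by simp
qed

text \<open>Each member of a countable cover is slightly enlarged to an open set; compactness then leaves
  finitely many of them.\<close>
lemma hausdorff_null_finite_cover:
  assumes E: "compact E" and null: "hausdorff_measure s E = 0" and s: "0 < s" and e: "0 < e"
  obtains I :: "nat set" and S r where "finite I" "E \<subseteq> (\<Union>i\<in>I. S i)"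
    "\<And>i. i \<in> I \<Longrightarrow> 0 < r i" "\<And>i y z. i \<in> I \<Longrightarrow> y \<in> S i \<Longrightarrow> z \<in> S i \<Longrightarrow> \<bar>y - z\<bar> \<le> r i"
    "(\<Sum>i\<in>I. r i powr s) \<le> e"
proof -
  have "hausdorff_content s 1 E = 0"
  proof -
    have "hausdorff_content s 1 E \<le> hausdorff_measure s E"
      unfolding hausdorff_measure_def by (rule SUP_upper) simp
    then show ?thesis using null by simp
  qed
  then have "Inf {(\<Sum>i. ennreal (diameter (U i) powr s)) |U :: nat \<Rightarrow> real set.
            E \<subseteq> (\<Union>i. U i) \<and> (\<forall>i. bounded (U i) \<and> diameter (U i) \<le> 1)} < ennreal (e / 2)"
    using e by (simp add: hausdorff_content_def)
  then obtain U :: "nat \<Rightarrow> real set" where U: "E \<subseteq> (\<Union>i. U i)" "\<And>i. bounded (U i)"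
      and sumU: "(\<Sum>i. ennreal (diameter (U i) powr s)) < ennreal (e / 2)"
    unfolding Inf_less_iff by blast
  \<comment> \<open>The sizes \<open>r i\<close> exceed the diameters so little that the \<open>s\<close>-th powers grow by at most \<open>e / 2\<close> in total.\<close>
  define q where "q i = diameter (U i) powr s + e / 2 * (1/2) ^ Suc i" for i
  define r where "r i = q i powr (1 / s)" for i
  define S where "S i = (\<Union>u\<in>U i. ball u ((r i - diameter (U i)) / 2))" for i
  have d0: "0 \<le> diameter (U i)" for i using U(2) by (rule diameter_ge_0)
  have q: "diameter (U i) powr s < q i" "0 < q i" for i
    using e by (auto simp: q_def intro: add_nonneg_pos)
  have rs: "r i powr s = q i" for i
  proof -
    have "r i powr s = q i powr (1 / s * s)" by (simp only: r_def powr_powr)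
    then show ?thesis using s q(2)[of i] by simp
  qed
  have r: "diameter (U i) < r i" for i
  proof (rule ccontr)
    assume "\<not> diameter (U i) < r i"
    then have "r i powr s \<le> diameter (U i) powr s" using s by (intro powr_mono2) (auto simp: r_def)
    then show False using q(1)[of i] rs by simp
  qed
  have "U i \<subseteq> S i" for i
  proof
    fix u assume "u \<in> U i"
    then show "u \<in> S i" unfolding S_def by (rule UN_I) (use r[of i] in simp)
  qed
  then have "E \<subseteq> (\<Union>i\<in>UNIV. S i)" using U(1) UN_mono[of UNIV UNIV U S] by (meson order_trans order_refl)
  moreover have "open (S i)" for i unfolding S_def by (intro open_UN ballI open_ball)
  ultimately obtain I where I: "finite I" "E \<subseteq> (\<Union>i\<in>I. S i)"
    using compactE_image[OF E, of UNIV S] by metis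
  have diam: "\<bar>y - z\<bar> \<le> r i" if yz: "y \<in> S i" "z \<in> S i" for i y z
  proof -
    obtain u v where uv: "u \<in> U i" "v \<in> U i" "\<bar>u - y\<bar> < (r i - diameter (U i)) / 2"
        "\<bar>v - z\<bar> < (r i - diameter (U i)) / 2"
      using yz unfolding S_def UN_iff mem_ball dist_real_def by blast
    have "\<bar>u - v\<bar> \<le> diameter (U i)"
      using diameter_bounded_bound[OF U(2) uv(1,2)] by (simp add: dist_real_def)
    moreover have "\<bar>y - z\<bar> \<le> \<bar>u - v\<bar> + \<bar>u - y\<bar> + \<bar>v - z\<bar>" by linarith
    ultimately show ?thesis using uv(3,4) by argo
  qed
  have "(\<Sum>i\<in>I. ennreal (diameter (U i) powr s)) \<le> (\<Sum>i. ennreal (diameter (U i) powr s))"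
    by (rule sum_le_suminf) (use I in auto)
  also note sumU
  finally have "ennreal (\<Sum>i\<in>I. diameter (U i) powr s) < ennreal (e / 2)"
    by (simp add: sum_ennreal)
  then have 1: "(\<Sum>i\<in>I. diameter (U i) powr s) \<le> e / 2"
    by (subst (asm) ennreal_less_iff) (auto intro: sum_nonneg)
  have "(\<Sum>i\<in>I. (1/2::real) ^ Suc i) \<le> (\<Sum>i. (1/2) ^ Suc i)"
    by (rule sum_le_suminf[OF sums_summable[OF power_half_series] I(1)]) simp
  also have "\<dots> = 1" using power_half_series by (rule sums_unique[symmetric])
  finally have "(\<Sum>i\<in>I. r i powr s) \<le> e / 2 + e / 2 * 1"
    unfolding rs q_def sum.distrib sum_distrib_left[symmetric]
    using 1 e by (intro add_mono mult_left_mono) auto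
  then have "(\<Sum>i\<in>I. r i powr s) \<le> e" by simp
  moreover have "0 < r i" for i using r[of i] d0[of i] by linarith
  ultimately show thesis using that[OF I, of r] diam by blast
qed

lemma hausdorff_measure_2_real:
  assumes "E \<subseteq> {u..v::real}"
  shows "hausdorff_measure 2 E = 0"
proof -
  have "hausdorff_content 2 e E \<le> ennreal x" if e: "0 < e" and x: "0 < x" for e x
  proof -
    define d where "d = \<bar>v - u\<bar> + 1"
    have d: "0 < d" by (simp add: d_def)
    obtain n :: nat where n: "d / e + d\<^sup>2 / x < n" using reals_Archimedean2 by blast
    have n0: "0 < real n" using n d e x by (smt (verit) divide_pos_pos zero_less_power)
    have n1: "d / real n \<le> e"
    proof -
      have "d / e < n" using n d x by (smt (verit) divide_pos_pos zero_less_power)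
      then show ?thesis using n0 e by (simp add: field_simps)
    qed
    have n2: "d\<^sup>2 / real n \<le> x"
    proof -
      have "d\<^sup>2 / x < n" using n d e by (smt (verit) divide_pos_pos zero_less_power)
      then show ?thesis using n0 x by (simp add: field_simps)
    qed
    define U where "U i = (if i < n then {u + real i * (d / n) .. u + real (Suc i) * (d / n)} else {})" for i
    have dU: "diameter (U i) = (if i < n then d / n else 0)" for i
    proof -
      have "u + real i * (d / n) \<le> u + real (Suc i) * (d / n)" using n0 d by (simp add: field_simps)
      moreover have "u + real (Suc i) * (d / n) - (u + real i * (d / n)) = d / n"
        using n0 by (simp add: divide_simps) (simp add: algebra_simps)
      ultimately show ?thesis unfolding U_def by (simp del: of_nat_Suc add: diameter_closed_interval)
    qed
    have cover: "E \<subseteq> (\<Union>i. U i)"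
    proof
      fix y assume "y \<in> E"
      then have y: "u \<le> y" "y \<le> v" using assms by auto
      define i where "i = nat \<lfloor>(y - u) / (d / n)\<rfloor>"
      have "0 \<le> (y - u) / (d / n)" using y d n0 by simp
      then have i: "real i \<le> (y - u) / (d / n)" "(y - u) / (d / n) < real i + 1"
        by (auto simp: i_def)
      have "(y - u) * n < d * n" using y n0 by (simp add: d_def)
      then have "(y - u) / (d / n) < n" using d n0 by (simp add: divide_simps)
      then have "i < n" using i by linarith
      moreover have "y \<in> {u + real i * (d / n) .. u + real (Suc i) * (d / n)}"
      proof -
        have dn: "0 < d / n" using d n0 by simp
        have "real i * (d / n) \<le> y - u" using i(1) dn by (simp only: pos_le_divide_eq)
        moreover have "y - u < real (Suc i) * (d / n)" using i(2) dn by (simp only: pos_divide_less_eq of_nat_Suc) (simp add: add.commute)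
        ultimately show ?thesis by simp
      qed
      ultimately show "y \<in> (\<Union>i. U i)" by (auto simp: U_def intro!: exI[of _ i])
    qed
    have "hausdorff_content 2 e E \<le> (\<Sum>i. ennreal (diameter (U i) powr 2))"
    proof -
      have "bounded (U i) \<and> diameter (U i) \<le> e" for i
        using n1 e dU[of i] by (simp add: U_def split: if_splits)
      then show ?thesis unfolding hausdorff_content_def
        by (intro Inf_lower CollectI exI[of _ U] conjI refl cover) blast
    qed
    also have "\<dots> = (\<Sum>i<n. ennreal (diameter (U i) powr 2))"
      by (rule suminf_finite) (auto simp: dU)
    also have "\<dots> = (\<Sum>i<n. ennreal ((d / n)\<^sup>2))"
      using d n0 by (intro sum.cong) (auto simp: dU powr_numeral)
    also have "\<dots> = ennreal (n * (d / n)\<^sup>2)"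
      by (simp add: ennreal_mult ennreal_of_nat_eq_real_of_nat)
    also have "n * (d / n)\<^sup>2 = d\<^sup>2 / n" using n0 by (simp add: power2_eq_square)
    finally show ?thesis using n2 ennreal_leI order_trans by blast
  qed
  then have "hausdorff_content 2 e E \<le> 0" if "0 < e" for e
    using that by (metis (no_types, lifting) ennreal_le_epsilon add_0)
  then show ?thesis unfolding hausdorff_measure_def
    by (metis SUP_least greaterThan_iff le_zero_eq)
qed

text \<open>The infimum in the definition is over a nonempty set, because exponent 2 gives measure zero:
  \<open>n\<close> intervals of length \<open>d / n\<close> contribute \<open>d\<^sup>2 / n\<close>.\<close>
lemma hausdorff_dim_bounds:
  assumes "bounded E"
  shows "0 \<le> hausdorff_dim E" "hausdorff_dim E \<le> 2"
    "\<And>e. 0 < e \<Longrightarrow> \<exists>s. 0 < s \<and> hausdorff_measure s E = 0 \<and> s < hausdorff_dim E + e"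
proof -
  let ?X = "{s. 0 < s \<and> hausdorff_measure s E = 0}"
  obtain u v where "E \<subseteq> {u..v}" using assms
    by (metis bounded_closed_interval box_real(2) bounded_subset_cbox_symmetric)
  then have 2: "2 \<in> ?X" using hausdorff_measure_2_real by auto
  then have ne: "?X \<noteq> {}" by (metis empty_iff)
  have bb: "bdd_below ?X" by (rule bdd_belowI[of _ 0]) auto
  show "hausdorff_dim E \<le> 2" unfolding hausdorff_dim_def by (rule cInf_lower[OF 2 bb])
  show "0 \<le> hausdorff_dim E" unfolding hausdorff_dim_def
    by (rule cInf_greatest[OF ne]) simp
  show "\<exists>s. 0 < s \<and> hausdorff_measure s E = 0 \<and> s < hausdorff_dim E + e" if "0 < e" for e
  proof -
    have "\<exists>x\<in>?X. x < hausdorff_dim E + e"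
      by (rule cInf_lessD[OF ne]) (use that in \<open>simp add: hausdorff_dim_def\<close>)
    then show ?thesis by blast
  qed
qed

section \<open>Packing numbers of quasi self-similar sets\<close>

text \<open>Small pieces of \<open>E\<close> can be blown up into \<open>E\<close> without losing more than a fixed factor, and \<open>E\<close> can
  be shrunk into its own small balls. Elements of a group map its limit set onto itself, so only parts of
  it can be shrunk by them; hence the finite cover by sets \<open>F i\<close>.\<close>
locale quasi_self_similar =
  fixes E :: "real set" and F :: "'i \<Rightarrow> real set" and L :: "'i set" and a :: real
  assumes compact: "compact E" and a: "0 < a" "a \<le> 1 / 3"
    and finite_L: "finite L" and cover: "E \<subseteq> (\<Union>i\<in>L. F i)"
    and blow_up: "\<And>S r. S \<subseteq> E \<Longrightarrow> 0 < r \<Longrightarrow> (\<And>y z. y \<in> S \<Longrightarrow> z \<in> S \<Longrightarrow> \<bar>y - z\<bar> \<le> r) \<Longrightarrow>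
        \<exists>g. g ` S \<subseteq> E \<and> (\<forall>y\<in>S. \<forall>z\<in>S. a / r * \<bar>y - z\<bar> \<le> \<bar>g y - g z\<bar>)"
    and blow_down: "\<And>x r i. x \<in> E \<Longrightarrow> 0 < r \<Longrightarrow> r \<le> 1 \<Longrightarrow> i \<in> L \<Longrightarrow>
        \<exists>g. g ` F i \<subseteq> E \<inter> ball x r \<and> (\<forall>y\<in>F i. \<forall>z\<in>F i. a * r * \<bar>y - z\<bar> \<le> \<bar>g y - g z\<bar>)"
begin

text \<open>A separated set in a member \<open>S i\<close> of an efficient cover is blown up by the factor \<open>a / r i \<ge> 2\<close>, so it
  is controlled by a packing number at a scale at least twice as large. The exponent \<open>s\<close> is reproduced
  because the cover satisfies \<open>\<Sum> r i powr s \<le> a powr s\<close>. The constant \<open>A\<close> depends on the cover and hence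
  on \<open>s\<close>.\<close>
lemma packing_bound_of_null_measure:
  assumes "0 < s" "hausdorff_measure s E = 0"
  shows "\<exists>A>0. \<forall>t X. 0 < t \<longrightarrow> t \<le> 1 \<longrightarrow> X \<subseteq> E \<longrightarrow> sep t X \<longrightarrow> card X \<le> A * t powr - s"
proof -
  \<comment> \<open>The first bound closes the induction, the second forces \<open>r i \<le> a / 2\<close>.\<close>
  define e where "e = min (a powr s) ((a / 2) powr s)"
  have e0: "0 < e" using a by (auto simp: e_def)
  obtain I :: "nat set" and S r where I: "finite I" "E \<subseteq> (\<Union>i\<in>I. S i)"
    and r0: "\<And>i. i \<in> I \<Longrightarrow> 0 < r i"
    and diam: "\<And>i y z. i \<in> I \<Longrightarrow> y \<in> S i \<Longrightarrow> z \<in> S i \<Longrightarrow> \<bar>y - z\<bar> \<le> r i"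
    and sum: "(\<Sum>i\<in>I. r i powr s) \<le> e"
    using hausdorff_null_finite_cover[OF compact assms(2,1) e0] by blast
  have ra: "2 \<le> a / r i" if "i \<in> I" for i
  proof -
    have "r i powr s \<le> (\<Sum>i\<in>I. r i powr s)" using that I(1) by (intro member_le_sum) auto
    also have "\<dots> \<le> (a / 2) powr s" using sum by (simp add: e_def)
    finally have "r i \<le> a / 2"
      using powr_less_mono2[of s "a / 2" "r i"] assms(1) a r0[OF that] by fastforce
    then show ?thesis using r0[OF that] by (simp add: field_simps)
  qed
  \<comment> \<open>The induction starts from scales between 1 and \<open>R\<close>, a bound for the scales that one blow-up can reach
    from a scale below 1.\<close>
  define R where "R = 1 + (\<Sum>i\<in>I. a / r i)"
  have R1: "1 \<le> R" using a r0 unfolding R_def by (auto intro!: sum_nonneg simp: less_imp_le)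
  have Ri: "a / r i \<le> R" if "i \<in> I" for i
  proof -
    have "a / r i \<le> (\<Sum>i\<in>I. a / r i)"
      using that I(1) a r0 by (intro member_le_sum) (auto simp: less_imp_le)
    then show ?thesis by (simp add: R_def)
  qed
  have "bounded E" using compact by (rule compact_imp_bounded)
  then obtain d where d: "0 \<le> d" "\<And>x y. x \<in> E \<Longrightarrow> y \<in> E \<Longrightarrow> \<bar>x - y\<bar> \<le> d"
    using bounded_two_points[of E] by (metis dist_real_def abs_ge_zero order_trans nle_le)
  define A where "A = (1 + d) * R powr s"
  have A0: "0 < A" using d R1 by (simp add: A_def)
  have claim: "\<forall>t X. (1/2) ^ n \<le> t \<longrightarrow> t \<le> R \<longrightarrow> X \<subseteq> E \<longrightarrow> sep t X \<longrightarrow> card X \<le> A * t powr - s" for n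
  proof (induction n)
    case 0
    show ?case
    proof (intro allI impI)
      fix t X assume t: "(1/2) ^ 0 \<le> t" "t \<le> R" "X \<subseteq> E" "sep t X"
      have "real (card X) \<le> 1 + d / t"
        by (rule sep_card_le) (use t d in auto)
      also have "\<dots> \<le> (1 + d) * 1" using frac_le[of d d 1 t] t d by simp
      also have "\<dots> \<le> (1 + d) * (R powr s * t powr - s)"
      proof (rule mult_left_mono)
        have "t powr s \<le> R powr s" using t assms(1) by (intro powr_mono2) auto
        then show "1 \<le> R powr s * t powr - s" using t by (simp add: powr_minus divide_simps)
      qed (use d in auto)
      finally show "card X \<le> A * t powr - s" by (simp add: A_def)
    qed
  next
    case (Suc n)
    show ?case
    proof (intro allI impI)
      fix t X assume t: "(1/2) ^ Suc n \<le> t" "t \<le> R" "X \<subseteq> E" "sep t X"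
      show "card X \<le> A * t powr - s"
      proof (cases "1 \<le> t")
        case True
        then have "(1/2) ^ n \<le> t" using power_le_one[of "1/2::real" n] by linarith
        then show ?thesis using Suc t by blast
      next
        case False
        have t0: "0 < t" using t(1) by (smt (verit) zero_less_power half_gt_zero)
        have part: "card (X \<inter> S i) \<le> A * t powr - s * (a powr - s * r i powr s)" if i: "i \<in> I" for i
        proof -
          obtain g where g: "g ` (X \<inter> S i) \<subseteq> E"
            "\<forall>y\<in>X \<inter> S i. \<forall>z\<in>X \<inter> S i. a / r i * \<bar>y - z\<bar> \<le> \<bar>g y - g z\<bar>"
            using blow_up[of "X \<inter> S i" "r i"] r0[OF i] diam[OF i] t(3) by blast
          have ar: "0 < a / r i" using a r0[OF i] by simp
          have sp: "sep (a / r i * t) (g ` (X \<inter> S i))" and c: "card (g ` (X \<inter> S i)) = card (X \<inter> S i)"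
            using sep_image[OF sep_subset[OF t(4)] t0 ar, of "X \<inter> S i" g] g(2) by auto
          have "(1/2) ^ n \<le> 2 * t" using t(1) by simp
          also have "\<dots> \<le> a / r i * t" using ra[OF i] t0 by (intro mult_right_mono) auto
          finally have l: "(1/2) ^ n \<le> a / r i * t" .
          have u: "a / r i * t \<le> R"
            using Ri[OF i] False ar by (smt (verit) mult_left_le)
          have "card (g ` (X \<inter> S i)) \<le> A * (a / r i * t) powr - s"
            using Suc l u g(1) sp by blast
          also have "(a / r i * t) powr - s = t powr - s * (a powr - s * r i powr s)"
            using a r0[OF i] t0
            by (simp add: powr_mult powr_divide powr_minus divide_simps)
          finally show ?thesis using c by (simp add: mult.assoc)
        qed
        have "X = (\<Union>i\<in>I. X \<inter> S i)" using I(2) t(3) by blast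
        then have "card X \<le> (\<Sum>i\<in>I. card (X \<inter> S i))"
          using card_UN_le[OF I(1), of "\<lambda>i. X \<inter> S i"] by simp
        then have "real (card X) \<le> real (\<Sum>i\<in>I. card (X \<inter> S i))" by (rule of_nat_mono)
        also have "\<dots> \<le> (\<Sum>i\<in>I. A * t powr - s * (a powr - s * r i powr s))"
          unfolding of_nat_sum by (rule sum_mono) (use part in auto)
        also have "\<dots> = A * t powr - s * a powr - s * (\<Sum>i\<in>I. r i powr s)"
          by (simp add: sum_distrib_left mult.assoc)
        also have "\<dots> \<le> A * t powr - s * a powr - s * a powr s"
          using sum A0 by (intro mult_left_mono) (auto simp: e_def)
        also have "\<dots> = A * t powr - s" using a by (simp add: powr_minus)
        finally show ?thesis .
      qed
    qed
  qed
  show ?thesis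
  proof (intro exI[of _ A] conjI A0 allI impI)
    fix t X assume t: "0 < t" "t \<le> 1" "X \<subseteq> E" "sep t X"
    obtain n where "(1/2) ^ n < t" using real_arch_pow_inv[OF t(1), of "1/2"] by auto
    then show "card X \<le> A * t powr - s" using claim[of n] t R1 by (meson less_imp_le order_trans)
  qed
qed

text \<open>Around each point of \<open>X\<close> a shrunken copy of the richest part of \<open>Y\<close> is placed. Radius \<open>t / 3\<close> keeps
  copies around different points apart.\<close>
lemma packing_supermultiplicative:
  assumes X: "X \<subseteq> E" "sep t X" "0 < t" "t \<le> 1" and Y: "Y \<subseteq> E" "sep u Y" "0 < u" "u \<le> 1"
  shows "\<exists>Z\<subseteq>E. sep (a / 3 * t * u) Z \<and> card X * card Y \<le> card L * card Z"
proof (cases "L = {}")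
  case True
  then have "E = {}" using cover by auto
  then show ?thesis using X Y by (intro exI[of _ "{}"]) (auto simp: sep_def)
next
  case False
  have finX: "finite X" and finY: "finite Y" using X Y by (auto simp: sep_def)
  have "Y = (\<Union>i\<in>L. Y \<inter> F i)" using Y cover by blast
  then have "card Y \<le> (\<Sum>i\<in>L. card (Y \<inter> F i))"
    using card_UN_le[OF finite_L, of "\<lambda>i. Y \<inter> F i"] by simp
  moreover have "Max ((\<lambda>j. card (Y \<inter> F j)) ` L) \<in> (\<lambda>j. card (Y \<inter> F j)) ` L"
    by (rule Max_in) (use finite_L False in auto)
  then obtain i where i: "i \<in> L" "Max ((\<lambda>j. card (Y \<inter> F j)) ` L) = card (Y \<inter> F i)" by auto
  have "card (Y \<inter> F j) \<le> card (Y \<inter> F i)" if "j \<in> L" for j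
    unfolding i(2)[symmetric] by (rule Max_ge) (use finite_L that in auto)
  ultimately have cY: "card Y \<le> card L * card (Y \<inter> F i)"
    using sum_bounded_above[of L "\<lambda>j. card (Y \<inter> F j)" "card (Y \<inter> F i)"] by simp
  have "\<forall>x\<in>X. \<exists>g. g ` F i \<subseteq> E \<inter> ball x (t / 3) \<and>
      (\<forall>y\<in>F i. \<forall>z\<in>F i. a * (t / 3) * \<bar>y - z\<bar> \<le> \<bar>g y - g z\<bar>)"
    using X i(1) by (intro ballI blow_down) auto
  then obtain g where g: "\<And>x. x \<in> X \<Longrightarrow> g x ` F i \<subseteq> E \<inter> ball x (t / 3)"
      "\<And>x y z. x \<in> X \<Longrightarrow> y \<in> F i \<Longrightarrow> z \<in> F i \<Longrightarrow> a * (t / 3) * \<bar>y - z\<bar> \<le> \<bar>g x y - g x z\<bar>"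
    by metis
  define Z where "Z = (\<Union>x\<in>X. g x ` (Y \<inter> F i))"
  have at: "0 < a * (t / 3)" using a X by simp
  have im: "sep (a * (t / 3) * u) (g x ` (Y \<inter> F i))" "card (g x ` (Y \<inter> F i)) = card (Y \<inter> F i)"
    if "x \<in> X" for x
    using sep_image[OF sep_subset[OF Y(2)] Y(3) at, of "Y \<inter> F i" "g x"] g(2)[OF that] by auto
  have far: "t / 3 < \<bar>p - q\<bar>" if "x \<in> X" "y \<in> X" "x \<noteq> y" "p \<in> g x ` (Y \<inter> F i)" "q \<in> g y ` (Y \<inter> F i)"
    for x y p q
  proof -
    have "t \<le> \<bar>x - y\<bar>" using X(2) that by (auto simp: sep_def)
    moreover have "\<bar>x - p\<bar> < t / 3" "\<bar>y - q\<bar> < t / 3"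
      using g(1)[OF that(1)] g(1)[OF that(2)] that(4,5) by (auto simp: dist_real_def)
    ultimately show ?thesis by linarith
  qed
  have small: "a * (t / 3) * u \<le> t / 3"
  proof -
    have "a * u \<le> 1 * 1" using a Y by (intro mult_mono) auto
    then show ?thesis using X(3) by (simp add: field_simps)
  qed
  have "sep (a * (t / 3) * u) Z"
    unfolding sep_def
  proof (intro conjI ballI impI)
    show "finite Z" using finX finY by (auto simp: Z_def)
    fix p q assume "p \<in> Z" "q \<in> Z" "p \<noteq> q"
    then obtain x y where xy: "x \<in> X" "y \<in> X" "p \<in> g x ` (Y \<inter> F i)" "q \<in> g y ` (Y \<inter> F i)"
      unfolding Z_def by blast
    show "a * (t / 3) * u \<le> \<bar>p - q\<bar>"
    proof (cases "x = y")
      case True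
      then show ?thesis using im(1)[OF xy(1)] xy(3,4) \<open>p \<noteq> q\<close> unfolding sep_def by blast
    next
      case False
      then show ?thesis using far[OF xy(1,2) False xy(3,4)] small by linarith
    qed
  qed
  then have "sep (a / 3 * t * u) Z" by (simp add: mult.commute mult.left_commute)
  moreover have "card Z = (\<Sum>x\<in>X. card (g x ` (Y \<inter> F i)))"
    unfolding Z_def
  proof (rule card_UN_disjoint)
    show "\<forall>x\<in>X. \<forall>y\<in>X. x \<noteq> y \<longrightarrow> g x ` (Y \<inter> F i) \<inter> g y ` (Y \<inter> F i) = {}"
      using far X(3) by (smt (verit, del_insts) disjoint_iff divide_pos_pos)
  qed (use finX finY in auto)
  then have "card Z = card X * card (Y \<inter> F i)" using im(2) by simp
  then have "card X * card Y \<le> card L * card Z" using cY by (simp add: mult_le_mono2 mult.left_commute)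
  moreover have "Z \<subseteq> E" using g(1) by (fastforce simp: Z_def)
  ultimately show ?thesis by blast
qed

text \<open>By supermultiplicativity the \<open>n\<close>-th power of a packing number at scale \<open>t\<close> is at most a packing
  number at scale \<open>(a t / 3) ^ n\<close>, up to \<open>K ^ n\<close>. Taking \<open>n\<close>-th roots removes the constant of
  \<open>packing_bound_of_null_measure\<close>, and only then \<open>s\<close> may tend to the dimension.\<close>
lemma packing_bound:
  "\<exists>C>0. \<forall>t X. 0 < t \<longrightarrow> t \<le> 1 \<longrightarrow> X \<subseteq> E \<longrightarrow> sep t X \<longrightarrow> card X \<le> C * t powr - hausdorff_dim E"
proof -
  define K where "K = real (card L) + 1"
  have K: "0 < K" by (simp add: K_def)
  let ?b = "a / 3"
  have b: "0 < ?b" using a by simp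
  have power: "\<exists>Z\<subseteq>E. sep ((?b * t) ^ n) Z \<and> real (card X) ^ n \<le> K ^ n * card Z"
    if X: "X \<subseteq> E" "sep t X" "0 < t" "t \<le> 1" "E \<noteq> {}" for t X n
  proof (induction n)
    case 0
    obtain x where "x \<in> E" using X by blast
    then show ?case by (intro exI[of _ "{x}"]) (auto simp: sep_def)
  next
    case (Suc n)
    then obtain Z where Z: "Z \<subseteq> E" "sep ((?b * t) ^ n) Z" "real (card X) ^ n \<le> K ^ n * card Z" by blast
    have bt: "0 < ?b * t" "?b * t \<le> 1" using a X mult_le_one[of ?b t] by auto
    obtain W where W: "W \<subseteq> E" "sep (?b * t * (?b * t) ^ n) W" "card X * card Z \<le> card L * card W"
      using packing_supermultiplicative[OF X(1-4) Z(1,2)] bt by (auto simp: power_le_one)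
    have "real (card X) ^ Suc n \<le> K ^ n * (real (card X) * card Z)"
      using mult_left_mono[OF Z(3), of "real (card X)"] by (simp add: mult_ac)
    also have "real (card X) * card Z \<le> K * card W"
    proof -
      have "real (card X) * card Z \<le> card L * card W" using W(3) by (metis of_nat_le_iff of_nat_mult)
      then show ?thesis by (simp add: K_def algebra_simps)
    qed
    finally have "real (card X) ^ Suc n \<le> K ^ Suc n * card W" using K by (simp add: mult_ac)
    then show ?case using W by auto
  qed
  have main: "real (card X) \<le> K * (?b * t) powr - s"
    if X: "X \<subseteq> E" "sep t X" "0 < t" "t \<le> 1" and s: "0 < s" "hausdorff_measure s E = 0" for t X s
  proof (cases "E = {}")
    case False
    obtain A where A: "A > 0" "\<And>t X. 0 < t \<Longrightarrow> t \<le> 1 \<Longrightarrow> X \<subseteq> E \<Longrightarrow> sep t X \<Longrightarrow> card X \<le> A * t powr - s"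
      using packing_bound_of_null_measure[OF s] by blast
    have bt: "0 < ?b * t" "?b * t \<le> 1" using a X mult_le_one[of ?b t] by auto
    show ?thesis
    proof (rule le_of_power_le)
      fix n
      obtain Z where Z: "Z \<subseteq> E" "sep ((?b * t) ^ n) Z" "real (card X) ^ n \<le> K ^ n * card Z"
        using power[OF X False] by blast
      have "card Z \<le> A * ((?b * t) ^ n) powr - s"
        using A(2)[of "(?b * t) ^ n" Z] bt Z by (simp add: power_le_one)
      also have "((?b * t) ^ n) powr - s = ((?b * t) powr - s) ^ n"
      proof -
        have "((?b * t) ^ n) powr - s = ((?b * t) powr real n) powr - s"
          using bt by (simp only: powr_realpow)
        also have "\<dots> = ((?b * t) powr - s) powr real n" by (simp only: powr_powr mult.commute)
        also have "\<dots> = ((?b * t) powr - s) ^ n" by (intro powr_realpow) (metis bt(1) powr_gt_zero less_irrefl)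
        finally show ?thesis .
      qed
      finally have "K ^ n * card Z \<le> K ^ n * (A * ((?b * t) powr - s) ^ n)"
        using K by (intro mult_left_mono) auto
      then show "real (card X) ^ n \<le> A * (K * (?b * t) powr - s) ^ n"
        using Z(3) by (simp add: power_mult_distrib mult_ac)
    qed (metis K bt(1) powr_gt_zero less_irrefl mult_pos_pos)
  qed (use X K in auto)
  let ?d = "hausdorff_dim E"
  show ?thesis
  proof (intro exI[of _ "K * ?b powr - ?d"] conjI allI impI)
    show "0 < K * ?b powr - ?d" using K b by simp
    fix t X assume X: "0 < t" "t \<le> 1" "X \<subseteq> E" "sep t X"
    have bt: "0 < ?b * t" "?b * t \<le> 1" using a X mult_le_one[of ?b t] by auto
    have "real (card X) \<le> K * (?b * t) powr - (?d + e)" if e: "0 < e" for e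
    proof -
      obtain s where s: "0 < s" "hausdorff_measure s E = 0" "s < ?d + e"
        using hausdorff_dim_bounds(3)[OF compact_imp_bounded[OF compact] e] by blast
      have "real (card X) \<le> K * (?b * t) powr - s" using main X s by blast
      also have "\<dots> \<le> K * (?b * t) powr - (?d + e)"
        using s K bt by (intro mult_left_mono powr_mono') auto
      finally show ?thesis .
    qed
    then have "eventually (\<lambda>e. real (card X) \<le> K * (?b * t) powr - (?d + e)) (at_right 0)"
      by (simp add: eventually_at_right_less eventually_mono[OF eventually_at_right_less])
    moreover have "((\<lambda>e. K * (?b * t) powr - (?d + e)) \<longlongrightarrow> K * (?b * t) powr - (?d + 0)) (at_right 0)"
      using bt by (intro tendsto_intros) auto
    ultimately have "real (card X) \<le> K * (?b * t) powr - (?d + 0)"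
      using tendsto_lowerbound by (metis trivial_limit_at_right_real)
    also have "\<dots> = K * ?b powr - ?d * t powr - ?d"
      using powr_mult[of ?b t "- ?d"] b X by simp
    finally show "card X \<le> K * ?b powr - ?d * t powr - ?d" .
  qed
qed

lemma local_packing_bound:
  "\<exists>C>0. \<forall>t r X. 0 < t \<longrightarrow> t \<le> r \<longrightarrow> X \<subseteq> E \<longrightarrow> sep t X \<longrightarrow> (\<forall>y\<in>X. \<forall>z\<in>X. \<bar>y - z\<bar> \<le> r) \<longrightarrow>
     card X \<le> C * (r / t) powr hausdorff_dim E"
proof -
  let ?d = "hausdorff_dim E"
  obtain C where C: "0 < C" "\<And>t X. 0 < t \<Longrightarrow> t \<le> 1 \<Longrightarrow> X \<subseteq> E \<Longrightarrow> sep t X \<Longrightarrow> card X \<le> C * t powr - ?d"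
    using packing_bound by blast
  show ?thesis
  proof (intro exI[of _ "C * a powr - ?d"] conjI allI impI)
    show "0 < C * a powr - ?d" using C a by simp
    fix t r X
    assume X: "0 < t" "t \<le> r" "X \<subseteq> E" "sep t X" "\<forall>y\<in>X. \<forall>z\<in>X. \<bar>y - z\<bar> \<le> r"
    have r: "0 < r" using X by simp
    obtain g where g: "g ` X \<subseteq> E" "\<forall>y\<in>X. \<forall>z\<in>X. a / r * \<bar>y - z\<bar> \<le> \<bar>g y - g z\<bar>"
      using blow_up[OF X(3) r] X(5) by blast
    have "sep (a / r * t) (g ` X)" "card (g ` X) = card X"
      using sep_image[OF X(4,1), of "a / r" g] g(2) a r by auto
    moreover have "a / r * t \<le> 1"
    proof -
      have "a * t \<le> 1 * r" using a X by (intro mult_mono) auto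
      then show ?thesis using r by (simp add: divide_simps)
    qed
    ultimately have "card X \<le> C * (a / r * t) powr - ?d"
      using C(2)[of "a / r * t" "g ` X"] g(1) a r X(1) by simp
    also have "(a / r * t) powr - ?d = a powr - ?d * (r / t) powr ?d"
      using a r X(1) by (simp add: powr_mult powr_divide powr_minus divide_simps)
    finally show "card X \<le> C * a powr - ?d * (r / t) powr ?d" by (simp add: mult.assoc)
  qed
qed

end

section \<open>Decay of the Fourier transform\<close>

text \<open>The Fourier integral over a bounded interval whose endpoints lie outside the support \<open>[-2, 2]\<close>, so
  that integration by parts leaves no boundary terms.\<close>
definition osc :: "complex \<Rightarrow> (real \<Rightarrow> real) \<Rightarrow> complex" where
  "osc \<zeta> \<psi> = integral {-3..3} (\<lambda>t. of_real (\<psi> t) * exp (- (\<i> * of_real t * \<zeta>)))"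

lemma continuous_on_osc:
  "continuous_on {-3..3} \<psi> \<Longrightarrow>
    continuous_on {-3..3::real} (\<lambda>t. complex_of_real (\<psi> t) * exp (- (\<i> * of_real t * \<zeta>)))"
  by (intro continuous_intros)

lemma fourier_eq_osc:
  assumes "continuous_on {-3..3} \<psi>" "\<And>t. 2 < \<bar>t\<bar> \<Longrightarrow> \<psi> t = 0"
  shows "fourier \<psi> \<zeta> = osc \<zeta> \<psi>"
proof -
  let ?f = "\<lambda>t. complex_of_real (\<psi> t) * exp (- (\<i> * of_real t * \<zeta>))"
  have "?f t = indicator {-3..3} t *\<^sub>R ?f t" for t
    using assms(2)[of t] by (cases "t \<in> {-3..3}") auto
  then have "fourier \<psi> \<zeta> = (LINT t:{-3..3}|lborel. ?f t)"
    unfolding fourier_def set_lebesgue_integral_def by metis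
  also have "\<dots> = integral {-3..3} ?f"
    by (rule set_borel_integral_eq_integral(2)[OF borel_integrable_atLeastAtMost'[OF continuous_on_osc[OF assms(1)]]])
  finally show ?thesis by (simp add: osc_def)
qed

lemma osc_bound:
  assumes "continuous_on {-3..3} \<psi>" "\<And>t. t \<in> {-3..3} \<Longrightarrow> \<bar>\<psi> t\<bar> \<le> B" "0 \<le> B"
  shows "cmod (osc \<zeta> \<psi>) \<le> 6 * B * exp (3 * \<bar>Im \<zeta>\<bar>)"
proof -
  have "cmod (osc \<zeta> \<psi>) \<le> (B * exp (3 * \<bar>Im \<zeta>\<bar>)) * (3 - (-3))"
    unfolding osc_def
  proof (rule integral_bound)
    show "continuous_on {-3..3} (\<lambda>t. complex_of_real (\<psi> t) * exp (- (\<i> * of_real t * \<zeta>)))"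
      by (rule continuous_on_osc[OF assms(1)])
    fix t :: real assume t: "t \<in> {-3..3}"
    show "cmod (complex_of_real (\<psi> t) * exp (- (\<i> * of_real t * \<zeta>))) \<le> B * exp (3 * \<bar>Im \<zeta>\<bar>)"
    proof -
      have "t * Im \<zeta> \<le> \<bar>t\<bar> * \<bar>Im \<zeta>\<bar>" by (metis abs_ge_self abs_mult)
      also have "\<dots> \<le> 3 * \<bar>Im \<zeta>\<bar>" using t by (intro mult_right_mono) auto
      finally show "cmod (complex_of_real (\<psi> t) * exp (- (\<i> * of_real t * \<zeta>))) \<le> B * exp (3 * \<bar>Im \<zeta>\<bar>)"
        using assms(2)[OF t] assms(3) by (auto simp: norm_mult norm_exp_eq_Re intro!: mult_mono)
    qed
  qed simp
  then show ?thesis by (simp add: mult_ac)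
qed

lemma osc_deriv:
  assumes der: "\<And>t. (\<psi> has_real_derivative \<psi>' t) (at t)" and cont: "continuous_on {-3..3} \<psi>'"
    and zero: "\<psi> 3 = 0" "\<psi> (-3) = 0"
  shows "osc \<zeta> \<psi>' = \<i> * \<zeta> * osc \<zeta> \<psi>"
proof -
  let ?e = "\<lambda>t. exp (- (\<i> * complex_of_real t * \<zeta>))"
  have cont0: "continuous_on {-3..3} \<psi>" using der by (meson DERIV_atLeastAtMost_imp_continuous_on)
  have "((\<lambda>t. of_real (\<psi> t) * ?e t) has_vector_derivative
      of_real (\<psi>' t) * ?e t - \<i> * \<zeta> * (of_real (\<psi> t) * ?e t)) (at t within {-3..3})" for t
  proof -
    have 1: "((\<lambda>t. complex_of_real (\<psi> t)) has_vector_derivative of_real (\<psi>' t)) (at t within {-3..3})"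
      using der[of t] has_field_derivative_at_within
      by (intro has_vector_derivative_of_real) (auto simp: has_real_derivative_iff_has_vector_derivative[symmetric])
    have "((\<lambda>z. exp (- (\<i> * z * \<zeta>))) has_field_derivative (- (\<i> * \<zeta>) * ?e t)) (at (complex_of_real t))"
      by (auto intro!: derivative_eq_intros)
    then have "((\<lambda>t. exp (- (\<i> * complex_of_real t * \<zeta>))) has_vector_derivative (- (\<i> * \<zeta>) * ?e t)) (at t within {-3..3})"
      using has_vector_derivative_real_field[of "\<lambda>z. exp (- (\<i> * z * \<zeta>))" "- (\<i> * \<zeta>) * ?e t" t "{-3..3}"]
      by (simp add: o_def)
    from has_vector_derivative_mult[OF 1 this] show ?thesis by (simp add: algebra_simps)
  qed
  then have "((\<lambda>t. of_real (\<psi>' t) * ?e t - \<i> * \<zeta> * (of_real (\<psi> t) * ?e t)) has_integral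
      of_real (\<psi> 3) * ?e 3 - of_real (\<psi> (-3)) * ?e (-3)) {-3..3}"
    by (intro fundamental_theorem_of_calculus) auto
  then have "integral {-3..3} (\<lambda>t. of_real (\<psi>' t) * ?e t - \<i> * \<zeta> * (of_real (\<psi> t) * ?e t)) = 0"
    using zero by (simp add: integral_unique)
  moreover have "integral {-3..3} (\<lambda>t. of_real (\<psi>' t) * ?e t - \<i> * \<zeta> * (of_real (\<psi> t) * ?e t))
      = osc \<zeta> \<psi>' - \<i> * \<zeta> * osc \<zeta> \<psi>"
    unfolding osc_def
    by (subst integral_diff) (intro integrable_continuous_real continuous_intros continuous_on_osc cont cont0 | simp)+
  ultimately show ?thesis by simp
qed

text \<open>Three integrations by parts; on a horizontal strip the exponential factor is bounded on the
  support.\<close>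
lemma fourier_decay:
  assumes smooth: "smooth \<phi>" and supp: "\<And>t. 2 < \<bar>t\<bar> \<Longrightarrow> \<phi> t = 0" and c: "0 \<le> c"
  shows "\<exists>B>0. \<forall>\<zeta>. \<bar>Im \<zeta>\<bar> \<le> c \<longrightarrow> cmod (fourier \<phi> \<zeta>) \<le> B \<and> cmod \<zeta> ^ 3 * cmod (fourier \<phi> \<zeta>) \<le> B"
proof -
  define d where "d n = (deriv ^^ n) \<phi>" for n
  have der: "(d n has_real_derivative d (Suc n) t) (at t)" for n t
    using smooth by (auto simp: d_def smooth_def field_differentiable_derivI)
  have cont: "continuous_on {-3..3} (d n)" for n
    using der by (meson DERIV_atLeastAtMost_imp_continuous_on)
  have zero: "d n t = 0" if "2 < \<bar>t\<bar>" for n t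
    using that
  proof (induction n arbitrary: t)
    case (Suc n)
    have op: "open {t::real. 2 < \<bar>t\<bar>}" by (intro open_Collect_less continuous_intros)
    have "(d n has_real_derivative 0) (at t)"
      by (rule has_field_derivative_transform_within_open[OF DERIV_const op, of t 0])
        (use Suc in auto)
    then show ?case using der DERIV_unique by blast
  qed (use supp in \<open>simp add: d_def\<close>)
  have step: "osc \<zeta> (d (Suc n)) = \<i> * \<zeta> * osc \<zeta> (d n)" for n \<zeta>
    using osc_deriv[OF der cont] zero by simp
  have F: "fourier \<phi> \<zeta> = osc \<zeta> (d 0)" for \<zeta>
    using fourier_eq_osc[of \<phi> \<zeta>] cont[of 0] supp by (simp add: d_def)
  have cube: "osc \<zeta> (d 3) = (\<i> * \<zeta>) ^ 3 * fourier \<phi> \<zeta>" for \<zeta>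
    using step[of \<zeta> 0] step[of \<zeta> 1] step[of \<zeta> 2] by (simp add: F eval_nat_numeral)
  have "\<exists>B>0. \<forall>t\<in>{-3..3}. \<bar>d n t\<bar> \<le> B" for n
  proof -
    have "bounded (d n ` {-3..3})" by (intro compact_imp_bounded compact_continuous_image cont compact_Icc)
    then show ?thesis by (auto simp: bounded_pos)
  qed
  then obtain B where B: "\<And>n. 0 < B n" "\<And>n t. t \<in> {-3..3} \<Longrightarrow> \<bar>d n t\<bar> \<le> B n" by metis
  define C where "C = 6 * (B 0 + B 3) * exp (3 * c)"
  have le_C: "6 * B n * exp (3 * \<bar>Im \<zeta>\<bar>) \<le> C" if "\<bar>Im \<zeta>\<bar> \<le> c" "n = 0 \<or> n = 3" for n \<zeta>
    unfolding C_def using that B(1)[of 0] B(1)[of 3] by (auto intro!: mult_mono)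
  have bd: "cmod (osc \<zeta> (d n)) \<le> C" if "\<bar>Im \<zeta>\<bar> \<le> c" "n = 0 \<or> n = 3" for n \<zeta>
  proof -
    have "cmod (osc \<zeta> (d n)) \<le> 6 * B n * exp (3 * \<bar>Im \<zeta>\<bar>)"
      by (rule osc_bound[OF cont]) (use B(1)[of n] B(2) in \<open>auto simp: less_imp_le\<close>)
    then show ?thesis using le_C[OF that] by linarith
  qed
  show ?thesis
  proof (intro exI[of _ C] conjI allI impI)
    show "0 < C" using B(1)[of 0] B(1)[of 3] by (simp add: C_def)
    fix \<zeta> assume z: "\<bar>Im \<zeta>\<bar> \<le> c"
    show "cmod (fourier \<phi> \<zeta>) \<le> C" using bd[OF z, of 0] by (simp add: F)
    show "cmod \<zeta> ^ 3 * cmod (fourier \<phi> \<zeta>) \<le> C"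
      using bd[OF z, of 3] by (simp add: cube norm_mult norm_power)
  qed
qed

text \<open>Substituting \<open>T + H t\<close> turns the cutoff into \<open>\<phi>\<close> and splits off \<open>exp (- \<i> T \<xi>)\<close>, whose modulus is not 1
  because \<open>\<xi>\<close> is complex.\<close>
lemma cmod_fourier_cutoff:
  assumes H: "0 < H"
  shows "cmod (fourier (cutoff \<phi> T H) \<xi>) = exp (T * Im \<xi>) * cmod (fourier \<phi> (of_real H * \<xi>))"
proof -
  have eq: "complex_of_real (cutoff \<phi> T H (T + H * t)) * exp (- (\<i> * of_real (T + H * t) * \<xi>)) =
      (exp (- (\<i> * of_real T * \<xi>)) / of_real H) * (of_real (\<phi> t) * exp (- (\<i> * of_real t * (of_real H * \<xi>))))" for t
  proof -
    have "exp (- (\<i> * of_real (T + H * t) * \<xi>)) = exp (- (\<i> * of_real T * \<xi>)) * exp (- (\<i> * of_real t * (of_real H * \<xi>)))"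
      by (simp add: exp_add[symmetric] algebra_simps)
    moreover have "cutoff \<phi> T H (T + H * t) = \<phi> t / H" using H by (simp add: cutoff_def)
    ultimately show ?thesis by (simp add: mult_ac)
  qed
  have "fourier (cutoff \<phi> T H) \<xi> = H *\<^sub>R
      (\<integral>t. complex_of_real (cutoff \<phi> T H (T + H * t)) * exp (- (\<i> * of_real (T + H * t) * \<xi>)) \<partial>lborel)"
    unfolding fourier_def by (subst lborel_integral_real_affine[of H _ T]) (use H in simp_all)
  also have "\<dots> = exp (- (\<i> * of_real T * \<xi>)) * fourier \<phi> (of_real H * \<xi>)"
    unfolding eq integral_mult_right_zero fourier_def[symmetric] using H by (simp add: scaleR_conv_of_real)
  finally show ?thesis by (simp add: norm_mult norm_exp_eq_Re)
qed

section \<open>Moebius maps\<close>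

definition den :: "real^2^2 \<Rightarrow> complex \<Rightarrow> complex" where
  "den A z = of_real (A$2$1) * z + of_real (A$2$2)"

definition pole :: "real^2^2 \<Rightarrow> real" where
  "pole A = - (A$2$2) / A$2$1"

lemma moeb_eq: "moeb A z = (of_real (A$1$1) * z + of_real (A$1$2)) / den A z"
  by (simp add: moeb_def moebius_def den_def)

lemma matrix_mult_2:
  fixes A B :: "real^2^2"
  shows "(A ** B)$i$j = A$i$1 * B$1$j + A$i$2 * B$2$j"
  by (simp add: matrix_matrix_mult_def sum_2)

lemma den_eq_pole: "A$2$1 \<noteq> 0 \<Longrightarrow> den A z = of_real (A$2$1) * (z - of_real (pole A))"
  by (simp add: den_def pole_def algebra_simps)

lemma norm_den: "A$2$1 \<noteq> 0 \<Longrightarrow> cmod (den A z) = \<bar>A$2$1\<bar> * cmod (z - of_real (pole A))"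
  by (simp add: den_eq_pole norm_mult)

text \<open>The source of all distance estimates for Moebius maps below.\<close>
lemma moeb_diff:
  assumes "det A = 1" "den A z \<noteq> 0" "den A w \<noteq> 0"
  shows "moeb A z - moeb A w = (z - w) / (den A z * den A w)"
proof -
  have "complex_of_real (A$1$1) * of_real (A$2$2) - of_real (A$1$2) * of_real (A$2$1) = 1"
    using assms(1) unfolding of_real_mult[symmetric] of_real_diff[symmetric] det_2[symmetric] by simp
  moreover have "(of_real (A$1$1) * z + of_real (A$1$2)) * den A w
      - (of_real (A$1$1) * w + of_real (A$1$2)) * den A z
      = (z - w) * (complex_of_real (A$1$1) * of_real (A$2$2) - of_real (A$1$2) * of_real (A$2$1))"
    by (simp add: den_def algebra_simps)
  ultimately have "(of_real (A$1$1) * z + of_real (A$1$2)) * den A w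
      - (of_real (A$1$1) * w + of_real (A$1$2)) * den A z = z - w"
    by simp
  then show ?thesis using assms by (simp add: moeb_eq diff_frac_eq)
qed

lemma den_mult: "den B z \<noteq> 0 \<Longrightarrow> den (A ** B) z = den A (moeb B z) * den B z"
  by (simp add: den_def[of A] den_def[of "A ** B"] moeb_eq matrix_mult_2 field_simps)
    (simp add: den_def algebra_simps)

lemma moeb_mult: "den B z \<noteq> 0 \<Longrightarrow> moeb (A ** B) z = moeb A (moeb B z)"
proof -
  assume B: "den B z \<noteq> 0"
  have "of_real ((A ** B)$1$1) * z + of_real ((A ** B)$1$2) =
      (of_real (A$1$1) * moeb B z + of_real (A$1$2)) * den B z"
    using B by (simp add: moeb_eq[of B] matrix_mult_2 distrib_right) (simp add: den_def algebra_simps)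
  then show ?thesis using B by (simp add: moeb_eq[of "A ** B"] moeb_eq[of A] den_mult)
qed

lemma den_one [simp]: "den (mat 1) z = 1"
  by (simp add: den_def mat_def)

lemma moeb_one [simp]: "moeb (mat 1) z = z"
  by (simp add: moeb_eq) (simp add: mat_def)

lemma deriv_moeb:
  assumes "det A = 1" "den A z \<noteq> 0"
  shows "(moeb A has_field_derivative 1 / (den A z)\<^sup>2) (at z)" "deriv (moeb A) z = 1 / (den A z)\<^sup>2"
proof -
  have d: "complex_of_real (A$1$1) * of_real (A$2$2) - of_real (A$1$2) * of_real (A$2$1) = 1"
    using assms(1) unfolding of_real_mult[symmetric] of_real_diff[symmetric] det_2[symmetric] by simp
  have eq: "of_real (A$1$1) * den A z - (of_real (A$1$1) * z + of_real (A$1$2)) * of_real (A$2$1) = 1"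
    using d by (simp add: den_def algebra_simps)
  have "((\<lambda>z. (of_real (A$1$1) * z + of_real (A$1$2)) / den A z) has_field_derivative
      (of_real (A$1$1) * den A z - (of_real (A$1$1) * z + of_real (A$1$2)) * of_real (A$2$1)) / (den A z * den A z)) (at z)"
    using assms(2) unfolding den_def
    by (auto intro!: derivative_eq_intros)
  then show *: "(moeb A has_field_derivative 1 / (den A z)\<^sup>2) (at z)"
    unfolding eq by (simp add: moeb_eq[abs_def] power2_eq_square)
  show "deriv (moeb A) z = 1 / (den A z)\<^sup>2" using * by (rule DERIV_imp_deriv)
qed

lemma den_cnj: "den A (cnj z) = cnj (den A z)"
  by (simp add: den_def)

lemma moeb_cnj: "moeb A (cnj z) = cnj (moeb A z)"
  by (simp add: moeb_eq den_cnj)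

lemma Im_moeb:
  assumes "det A = 1" "den A z \<noteq> 0"
  shows "Im (moeb A z) = Im z / (cmod (den A z))\<^sup>2"
proof -
  have "den A (cnj z) \<noteq> 0" using assms by (simp add: den_cnj)
  then have "moeb A z - cnj (moeb A z) = (z - cnj z) / (den A z * cnj (den A z))"
    using moeb_diff[OF assms, of "cnj z"] by (simp add: moeb_cnj den_cnj)
  moreover have "den A z * cnj (den A z) = of_real ((cmod (den A z))\<^sup>2)"
    by (metis complex_norm_square)
  ultimately have "Im (moeb A z - cnj (moeb A z)) = Im (z - cnj z) / (cmod (den A z))\<^sup>2"
    by (simp only: Im_divide_of_real)
  then show ?thesis by simp
qed

lemma den_nonzero_of_Im:
  assumes "det A = 1" "Im z \<noteq> 0"
  shows "den A z \<noteq> 0"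
proof
  assume z: "den A z = 0"
  then have "Im (den A z) = 0" "Re (den A z) = 0" by simp_all
  then have "A$2$1 = 0" "A$2$2 = 0" using assms(2) by (auto simp: den_def)
  then show False using assms(1) by (simp add: det_2)
qed

lemma matrix_inv_det_1:
  fixes A :: "real^2^2"
  assumes "det A = 1"
  shows "matrix_inv A ** A = mat 1" "A ** matrix_inv A = mat 1"
proof -
  have "\<exists>B. A ** B = mat 1 \<and> B ** A = mat 1"
    using assms invertible_det_nz[of A] by (simp add: invertible_def)
  then have "A ** matrix_inv A = mat 1 \<and> matrix_inv A ** A = mat 1"
    unfolding matrix_inv_def by (rule someI_ex)
  then show "matrix_inv A ** A = mat 1" "A ** matrix_inv A = mat 1" by auto
qed

text \<open>These two entries of the inverse give the pole of a map as the image of infinity under its inverse.\<close>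
lemma left_inverse_entries:
  fixes A B :: "real^2^2"
  assumes "B ** A = mat 1" "det A = 1"
  shows "B$1$1 = A$2$2" "B$2$1 = - A$2$1"
proof -
  have e: "(B ** A)$i$j = (if i = j then 1 else 0)" for i j by (simp add: assms(1) mat_def)
  have "B$1$1 * A$1$1 + B$1$2 * A$2$1 = 1" "B$1$1 * A$1$2 + B$1$2 * A$2$2 = 0"
     "B$2$1 * A$1$1 + B$2$2 * A$2$1 = 0" "B$2$1 * A$1$2 + B$2$2 * A$2$2 = 1"
    using e[of 1 1] e[of 1 2] e[of 2 1] e[of 2 2] by (auto simp: matrix_mult_2)
  moreover have "A$1$1 * A$2$2 - A$1$2 * A$2$1 = 1" using assms(2) by (simp add: det_2)
  ultimately show "B$1$1 = A$2$2" "B$2$1 = - A$2$1" by algebra+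
qed

section \<open>Reduced words\<close>

lemma bar_bar: "a \<in> letters m \<Longrightarrow> bar m (bar m a) = a"
  by (auto simp: letters_def bar_def)

lemma bar_letters: "a \<in> letters m \<Longrightarrow> bar m a \<in> letters m"
  by (auto simp: letters_def bar_def)

lemma bar_neq: "a \<in> letters m \<Longrightarrow> bar m a \<noteq> a"
  by (auto simp: letters_def bar_def)

lemma bar_eq_iff: "a \<in> letters m \<Longrightarrow> b \<in> letters m \<Longrightarrow> a = bar m b \<longleftrightarrow> b = bar m a"
  using bar_bar by metis

lemma words_letters: "w \<in> words m \<Longrightarrow> set w \<subseteq> letters m"
  by (simp add: words_def)

lemma finite_letters [simp]: "finite (letters m)"
  by (simp add: letters_def)

lemma words_append_iff:
  "u @ v \<in> words m \<longleftrightarrow> u \<in> words m \<and> v \<in> words m \<and> follows m u v"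
  by (auto simp: words_def follows_def successively_append_iff)

lemma words_Cons_iff:
  "a # w \<in> words m \<longleftrightarrow> a \<in> letters m \<and> w \<in> words m \<and> follows m [a] w"
  by (auto simp: words_def follows_def successively_Cons)

lemma words_Nil [simp]: "[] \<in> words m"
  by (simp add: words_def)

lemma words_single [simp]: "[a] \<in> words m \<longleftrightarrow> a \<in> letters m"
  by (simp add: words_def)

lemma follows_Nil [simp]: "follows m [] w" "follows m w []"
  by (auto simp: follows_def)

lemma words_take: "w \<in> words m \<Longrightarrow> take n w \<in> words m"
  by (metis append_take_drop_id words_append_iff)

lemma finite_words_length: "finite {w \<in> words m. length w = n}"
  by (rule finite_subset[OF _ finite_lists_length_eq[of "letters m" n]]) (auto simp: words_def)

lemma follows_bar_swap:
  "w \<in> words_ne m \<Longrightarrow> b \<in> letters m \<Longrightarrow> follows m w [b] \<longleftrightarrow> b \<noteq> bar m (last w)"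
proof -
  assume w: "w \<in> words_ne m" and b: "b \<in> letters m"
  then have "last w \<in> letters m" using words_letters[of w m] last_in_set[of w] by (auto simp: words_ne_def)
  then show ?thesis using w bar_eq_iff[OF _ b] by (simp add: follows_def words_ne_def)
qed

lemma bar_word_words:
  assumes "w \<in> words m" shows "bar_word m w \<in> words m"
proof -
  have "set (bar_word m w) \<subseteq> letters m"
    using assms bar_letters by (auto simp: bar_word_def words_def)
  moreover have "successively (\<lambda>a b. bar m b \<noteq> bar m (bar m a)) w"
  proof (rule successively_mono)
    show "successively (\<lambda>a b. a \<noteq> bar m b) w" using assms by (simp add: words_def)
  next
    fix a b assume "a \<in> set w" "b \<in> set w" "a \<noteq> bar m b"
    then show "bar m b \<noteq> bar m (bar m a)" using assms bar_bar by (metis subsetD words_letters)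
  qed
  ultimately show ?thesis
    by (simp add: words_def bar_word_def successively_rev successively_map)
qed

lemma last_bar_word: "w \<noteq> [] \<Longrightarrow> last (bar_word m w) = bar m (hd w)"
  and hd_bar_word: "w \<noteq> [] \<Longrightarrow> hd (bar_word m w) = bar m (last w)"
  by (auto simp: bar_word_def last_rev hd_rev hd_map last_map)

lemma bar_word_bar_word: "set w \<subseteq> letters m \<Longrightarrow> bar_word m (bar_word m w) = w"
  by (simp add: bar_word_def rev_map) (induction w; auto simp: bar_bar)

lemma word_mat_append: "word_mat \<gamma> (u @ v) = word_mat \<gamma> u ** word_mat \<gamma> v"
  by (induction u) (auto simp: word_mat_def matrix_mul_assoc)

lemma word_mat_Nil [simp]: "word_mat \<gamma> [] = mat 1"
  by (simp add: word_mat_def)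

lemma word_mat_Cons: "word_mat \<gamma> (a # w) = \<gamma> a ** word_mat \<gamma> w"
  by (simp add: word_mat_def)

text \<open>The left action of a letter on reduced words in the free group.\<close>
definition cons_red :: "nat \<Rightarrow> nat \<Rightarrow> nat list \<Rightarrow> nat list" where
  "cons_red m a w = (case w of [] \<Rightarrow> [a] | b # v \<Rightarrow> if b = bar m a then v else a # b # v)"

lemma red_append: "red m (u @ v) = foldr (cons_red m) u (red m v)"
  by (induction u) (auto simp: cons_red_def split: list.splits)

lemma red_words: "w \<in> words m \<Longrightarrow> red m w = w"
proof (induction w)
  case (Cons a w)
  then have "red m w = w" "a \<in> letters m" "set w \<subseteq> letters m" by (auto simp: words_def successively_Cons)
  then show ?case using Cons.prems bar_eq_iff[of a m "hd w"]
    by (cases w) (auto simp: words_def)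
qed simp

lemma cons_red_words: "w \<in> words m \<Longrightarrow> a \<in> letters m \<Longrightarrow> cons_red m a w \<in> words m"
  using red_in_words[of "a # w" m] red_append[of m "[a]" w] by (auto simp: red_words words_def)

lemma cons_red_cancel:
  assumes "w \<in> words m" "a \<in> letters m"
  shows "cons_red m (bar m a) (cons_red m a w) = w"
proof (cases w)
  case (Cons b v)
  show ?thesis
  proof (cases "b = bar m a")
    case True
    then have 1: "cons_red m a w = v" using Cons by (simp add: cons_red_def)
    show ?thesis
    proof (cases v)
      case (Cons c u)
      then have "b \<noteq> bar m c" "c \<in> letters m" using assms \<open>w = b # v\<close> by (auto simp: words_def)
      then have "c \<noteq> bar m (bar m a)" using True assms bar_bar[of a m] by metis
      then show ?thesis using 1 Cons \<open>w = b # v\<close> True by (simp add: cons_red_def)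
    qed (use 1 Cons True in \<open>simp add: cons_red_def\<close>)
  next
    case False
    then show ?thesis using Cons assms by (simp add: cons_red_def bar_bar)
  qed
qed (use assms in \<open>simp add: cons_red_def bar_bar\<close>)

text \<open>Each letter acts injectively, since the barred letter undoes it.\<close>
lemma foldr_cons_red_inj:
  assumes "set u \<subseteq> letters m" "x \<in> words m" "y \<in> words m"
    "foldr (cons_red m) u x = foldr (cons_red m) u y"
  shows "x = y"
proof -
  have 1: "foldr (cons_red m) u z \<in> words m" if "z \<in> words m" "set u \<subseteq> letters m" for u z
    using that by (induction u) (auto intro: cons_red_words)
  show ?thesis using assms
  proof (induction u)
    case (Cons a u)
    then have a: "a \<in> letters m" and u: "set u \<subseteq> letters m" by simp_all
    have "cons_red m a (foldr (cons_red m) u x) = cons_red m a (foldr (cons_red m) u y)"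
      using Cons.prems(4) by simp
    then have "foldr (cons_red m) u x = foldr (cons_red m) u y"
      using cons_red_cancel[OF 1[OF Cons.prems(2) u] a] cons_red_cancel[OF 1[OF Cons.prems(3) u] a]
      by metis
    then show ?case using Cons.IH[OF u Cons.prems(2,3)] by blast
  qed simp
qed

lemma red_bar_word_self:
  assumes "set w \<subseteq> letters m"
  shows "red m (w @ bar_word m w) = []"
  using assms
proof (induction w rule: rev_induct)
  case (snoc a w)
  have "red m ((w @ [a]) @ bar_word m (w @ [a])) = foldr (cons_red m) w (cons_red m a (cons_red m (bar m a) (red m (bar_word m w))))"
    by (simp add: red_append bar_word_def)
      (simp add: cons_red_def)
  also have "cons_red m a (cons_red m (bar m a) (red m (bar_word m w))) = red m (bar_word m w)"
  proof -
    have "red m (bar_word m w) \<in> words m"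
      using snoc bar_letters by (intro red_in_words) (auto simp: bar_word_def)
    then show ?thesis using cons_red_cancel[of "red m (bar_word m w)" m "bar m a"] snoc
      by (simp add: bar_letters bar_bar)
  qed
  finally show ?case using snoc by (simp add: red_append)
qed (simp add: bar_word_def)

text \<open>In the free group \<open>v w\<^sup>-\<^sup>1 = 1\<close> only for \<open>v = w\<close>: both \<open>bar_word m w\<close> and \<open>bar_word m v\<close> would be sent to
  the empty word by \<open>v\<close>.\<close>
lemma red_append_bar_word_neq_Nil:
  assumes "v \<in> words m" "w \<in> words m" "v \<noteq> w"
  shows "red m (v @ bar_word m w) \<noteq> []"
proof
  assume "red m (v @ bar_word m w) = []"
  then have "foldr (cons_red m) v (bar_word m w) = foldr (cons_red m) v (bar_word m v)"
    using red_bar_word_self[of v m] assms by (simp add: red_append red_words bar_word_words words_letters)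
  then have "bar_word m w = bar_word m v"
    using foldr_cons_red_inj assms bar_word_words words_letters by metis
  then show False using assms bar_word_bar_word words_letters by metis
qed

section \<open>Ping-pong and cylinders\<close>

definition nexts :: "nat \<Rightarrow> nat list \<Rightarrow> nat set" where
  "nexts m w = {b \<in> letters m. follows m w [b]}"

lemma nexts_letters: "b \<in> nexts m w \<Longrightarrow> b \<in> letters m"
  by (simp add: nexts_def)

lemma nexts_Nil [simp]: "nexts m [] = letters m"
  by (simp add: nexts_def)

lemma nexts_iff: "w \<in> words m \<Longrightarrow> w \<noteq> [] \<Longrightarrow> b \<in> nexts m w \<longleftrightarrow> b \<in> letters m \<and> b \<noteq> bar m (last w)"
  using follows_bar_swap[of w m b] by (auto simp: nexts_def words_ne_def)

lemma nexts_append: "v \<noteq> [] \<Longrightarrow> nexts m (u @ v) = nexts m v"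
  by (simp add: nexts_def follows_def)

lemma hd_nexts: "u @ v \<in> words m \<Longrightarrow> v \<noteq> [] \<Longrightarrow> hd v \<in> nexts m u"
  using words_letters[of v m] by (cases v) (auto simp: nexts_def words_append_iff follows_def)

lemma words_snoc_iff: "w @ [b] \<in> words m \<longleftrightarrow> w \<in> words m \<and> b \<in> nexts m w"
  by (auto simp: words_append_iff nexts_def)

locale schottky =
  fixes m :: nat and D :: "nat \<Rightarrow> complex set" and \<gamma> :: "nat \<Rightarrow> real^2^2"
  assumes data: "schottky_data m D \<gamma>"
begin

abbreviation act :: "nat list \<Rightarrow> complex \<Rightarrow> complex" where
  "act w \<equiv> moeb (word_mat \<gamma> w)"

abbreviation lower :: "nat list \<Rightarrow> real" where
  "lower w \<equiv> word_mat \<gamma> w$2$1"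

abbreviation wpole :: "nat list \<Rightarrow> real" where
  "wpole w \<equiv> pole (word_mat \<gamma> w)"

lemma m_ge_2: "2 \<le> m"
  using data by (simp add: schottky_data_def)

lemma disk: "a \<in> letters m \<Longrightarrow> \<exists>c::real. \<exists>r>0. D a = ball (of_real c) r"
  using data by (auto simp: schottky_data_def)

lemma open_D: "a \<in> letters m \<Longrightarrow> open (D a)"
  using disk[of a] by auto

lemma compact_closure_D: "a \<in> letters m \<Longrightarrow> compact (closure (D a))"
  using disk[of a] by auto

lemma closure_D_disjoint:
  "a \<in> letters m \<Longrightarrow> b \<in> letters m \<Longrightarrow> a \<noteq> b \<Longrightarrow> closure (D a) \<inter> closure (D b) = {}"
  using data by (auto simp: schottky_data_def disjoint_family_on_def)

lemma D_eq_letter: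
  "a \<in> letters m \<Longrightarrow> b \<in> letters m \<Longrightarrow> z \<in> D a \<Longrightarrow> z \<in> closure (D b) \<Longrightarrow> a = b"
  using closure_D_disjoint[of a b] closure_subset[of "D a"] by blast

lemma det_letter: "a \<in> letters m \<Longrightarrow> det (\<gamma> a) = 1"
  using data by (simp add: schottky_data_def)

lemma moeb_letter:
  assumes a: "a \<in> letters m" and z: "z \<notin> closure (D (bar m a))"
  shows "den (\<gamma> a) z \<noteq> 0" "moeb (\<gamma> a) z \<in> D a"
proof -
  have "moeb_sphere (\<gamma> a) ` (- (Some ` closure (D (bar m a)))) = Some ` D a"
    using a data by (simp add: schottky_data_def)
  then have "moeb_sphere (\<gamma> a) (Some z) \<in> Some ` D a" using z by blast
  then show "den (\<gamma> a) z \<noteq> 0" "moeb (\<gamma> a) z \<in> D a"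
    by (auto simp: den_def split: if_splits)
qed

lemma moeb_letter_infinity:
  assumes a: "a \<in> letters m"
  shows "\<gamma> a$2$1 \<noteq> 0" "complex_of_real (\<gamma> a$1$1 / \<gamma> a$2$1) \<in> D a"
proof -
  have "moeb_sphere (\<gamma> a) ` (- (Some ` closure (D (bar m a)))) = Some ` D a"
    using a data by (simp add: schottky_data_def)
  then have "moeb_sphere (\<gamma> a) None \<in> Some ` D a" by blast
  then show "\<gamma> a$2$1 \<noteq> 0" "complex_of_real (\<gamma> a$1$1 / \<gamma> a$2$1) \<in> D a"
    by (auto split: if_splits)
qed

lemma det_word: "set w \<subseteq> letters m \<Longrightarrow> det (word_mat \<gamma> w) = 1"
  by (induction w) (auto simp: word_mat_Cons det_mul det_letter)

lemma word_mat_bar_letter: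
  assumes "a \<in> letters m"
  shows "\<gamma> (bar m a) ** \<gamma> a = mat 1" "\<gamma> a ** \<gamma> (bar m a) = mat 1"
  using matrix_inv_det_1[OF det_letter[OF assms]] assms data by (auto simp: schottky_data_def)

lemma word_mat_bar_word:
  assumes "set w \<subseteq> letters m"
  shows "word_mat \<gamma> (bar_word m w) ** word_mat \<gamma> w = mat 1"
  using assms
proof (induction w)
  case (Cons a w)
  have "word_mat \<gamma> (bar_word m (a # w)) = word_mat \<gamma> (bar_word m w) ** \<gamma> (bar m a)"
    by (simp add: bar_word_def word_mat_append word_mat_Cons)
  then have "word_mat \<gamma> (bar_word m (a # w)) ** word_mat \<gamma> (a # w)
      = word_mat \<gamma> (bar_word m w) ** (\<gamma> (bar m a) ** \<gamma> a) ** word_mat \<gamma> w"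
    by (simp add: word_mat_Cons matrix_mul_assoc)
  then show ?case using Cons word_mat_bar_letter(1)[of a] by simp
qed (simp add: bar_word_def)

lemma word_mat_cancel: "cancel m v w \<Longrightarrow> set v \<subseteq> letters m \<Longrightarrow> word_mat \<gamma> v = word_mat \<gamma> w \<and> set w \<subseteq> letters m"
proof (induction rule: cancel.induct)
  case (1 u a v)
  then have a: "a \<in> letters m" by simp
  have "word_mat \<gamma> (u @ a # bar m a # v) = word_mat \<gamma> u ** (\<gamma> a ** \<gamma> (bar m a)) ** word_mat \<gamma> v"
    by (simp add: word_mat_append word_mat_Cons matrix_mul_assoc)
  then show ?case using 1 word_mat_bar_letter(2)[OF a] by (simp add: word_mat_append)
qed

lemma word_mat_red:
  assumes "set w \<subseteq> letters m" shows "word_mat \<gamma> (red m w) = word_mat \<gamma> w"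
proof -
  have "word_mat \<gamma> w = word_mat \<gamma> v \<and> set v \<subseteq> letters m" if "(cancel m)\<^sup>*\<^sup>* w v" for v
    using that by induction (use assms word_mat_cancel in auto)
  then show ?thesis using cancel_red by metis
qed

text \<open>Ping-pong: a point outside the closed disk of \<open>bar m (last w)\<close> is moved from disk to disk
  while the letters of \<open>w\<close> are applied from right to left.\<close>
lemma moeb_word:
  assumes "w \<in> words m" "w \<noteq> []" "z \<notin> closure (D (bar m (last w)))"
  shows "den (word_mat \<gamma> w) z \<noteq> 0 \<and> act w z \<in> D (hd w)"
  using assms
proof (induction w)
  case (Cons a w)
  then have a: "a \<in> letters m" and w: "w \<in> words m" "follows m [a] w" by (auto simp: words_Cons_iff)
  show ?case
  proof (cases "w = []")
    case True
    then show ?thesis using Cons a moeb_letter[of a z] by (simp add: word_mat_Cons)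
  next
    case False
    then have IH: "den (word_mat \<gamma> w) z \<noteq> 0" "act w z \<in> D (hd w)"
      using Cons w by auto
    have h: "hd w \<in> letters m" using w False words_letters by (meson hd_in_set subsetD)
    then have "hd w \<noteq> bar m a" using w(2) False a bar_eq_iff[of a m "hd w"] by (auto simp: follows_def)
    then have "act w z \<notin> closure (D (bar m a))"
      using D_eq_letter[OF h bar_letters[OF a] IH(2)] by blast
    then show ?thesis
      using moeb_letter[OF a] IH by (simp add: word_mat_Cons den_mult moeb_mult)
  qed
qed simp

text \<open>Ping-pong for the point at infinity, written with matrix entries.\<close>
lemma word_infinity:
  assumes "w \<in> words m" "w \<noteq> []"
  shows "lower w \<noteq> 0 \<and> complex_of_real (word_mat \<gamma> w$1$1 / lower w) \<in> D (hd w)"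
  using assms
proof (induction w)
  case (Cons a w)
  then have a: "a \<in> letters m" and w: "w \<in> words m" "follows m [a] w" by (auto simp: words_Cons_iff)
  show ?case
  proof (cases "w = []")
    case True
    then show ?thesis using a moeb_letter_infinity[of a] by (simp add: word_mat_Cons)
  next
    case False
    define B where "B = word_mat \<gamma> w"
    define q where "q = B$1$1 / B$2$1"
    have IH: "B$2$1 \<noteq> 0" "complex_of_real q \<in> D (hd w)"
      using Cons w False by (auto simp: B_def q_def)
    have h: "hd w \<in> letters m" using w False words_letters by (meson hd_in_set subsetD)
    then have "hd w \<noteq> bar m a" using w(2) False a bar_eq_iff[of a m "hd w"] by (auto simp: follows_def)
    then have "complex_of_real q \<notin> closure (D (bar m a))"
      using D_eq_letter[OF h bar_letters[OF a] IH(2)] by blast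
    note L = moeb_letter[OF a this]
    have c: "(\<gamma> a ** B)$2$1 = (\<gamma> a$2$1 * q + \<gamma> a$2$2) * B$2$1"
      "(\<gamma> a ** B)$1$1 = (\<gamma> a$1$1 * q + \<gamma> a$1$2) * B$2$1"
      using IH(1) by (simp_all add: matrix_mult_2 q_def field_simps)
    have "den (\<gamma> a) (of_real q) = of_real (\<gamma> a$2$1 * q + \<gamma> a$2$2)" by (simp add: den_def)
    then have nz: "\<gamma> a$2$1 * q + \<gamma> a$2$2 \<noteq> 0" using L(1) by (metis of_real_0)
    have "moeb (\<gamma> a) (of_real q) = of_real ((\<gamma> a ** B)$1$1 / (\<gamma> a ** B)$2$1)"
      unfolding c using IH(1) nz by (simp add: moeb_eq den_def)
    then show ?thesis using L(2) c(1) nz IH(1) by (simp add: word_mat_Cons B_def)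
  qed
qed simp

text \<open>The pole is the image of infinity under the inverse, which belongs to the barred word.\<close>
lemma word_pole:
  assumes "w \<in> words m" "w \<noteq> []"
  shows "lower w \<noteq> 0" "complex_of_real (wpole w) \<in> D (bar m (last w))"
proof -
  show "lower w \<noteq> 0" using word_infinity[OF assms] by simp
  have e: "word_mat \<gamma> (bar_word m w)$1$1 = word_mat \<gamma> w$2$2"
    "word_mat \<gamma> (bar_word m w)$2$1 = - lower w"
    using left_inverse_entries[OF word_mat_bar_word det_word, of w] words_letters[OF assms(1)] by auto
  have "bar_word m w \<noteq> []" using assms by (simp add: bar_word_def)
  then show "complex_of_real (wpole w) \<in> D (bar m (last w))"
    using word_infinity[OF bar_word_words[OF assms(1)]] assms(2) e
    by (simp add: pole_def hd_bar_word)
qed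

lemma nexts_not_closure:
  assumes "w \<in> words m" "w \<noteq> []" "b \<in> nexts m w" "z \<in> closure (D b)"
  shows "z \<notin> closure (D (bar m (last w)))"
proof -
  have "last w \<in> letters m" using assms(1,2) words_letters by (meson last_in_set subsetD)
  then show ?thesis
    using assms closure_D_disjoint[of b "bar m (last w)"] bar_letters by (auto simp: nexts_iff)
qed

lemma den_word_nonzero:
  assumes "w \<in> words m" "b \<in> nexts m w" "z \<in> closure (D b)"
  shows "den (word_mat \<gamma> w) z \<noteq> 0"
  using assms moeb_word nexts_not_closure by (cases "w = []") auto

lemma moeb_append:
  assumes "u @ v \<in> words m" "b \<in> nexts m (u @ v)" "z \<in> closure (D b)"
  shows "act (u @ v) z = act u (act v z)"
proof (cases "v = []")
  case False
  then have "den (word_mat \<gamma> v) z \<noteq> 0"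
    using den_word_nonzero[of v b z] assms by (simp add: words_append_iff nexts_append)
  then show ?thesis by (simp add: word_mat_append moeb_mult)
qed simp

lemma moeb_word_inj:
  assumes "w \<in> words m" "a \<in> nexts m w" "y \<in> closure (D a)" "b \<in> nexts m w" "z \<in> closure (D b)"
    "act w y = act w z"
  shows "y = z"
  using moeb_diff[OF det_word[OF words_letters[OF assms(1)]]
      den_word_nonzero[OF assms(1-3)] den_word_nonzero[OF assms(1,4,5)]]
    den_word_nonzero[OF assms(1-3)] den_word_nonzero[OF assms(1,4,5)] assms(6)
  by simp

lemma D_closure: "z \<in> D b \<Longrightarrow> z \<in> closure (D b)"
  using closure_subset by blast

text \<open>The letters \<open>bar\<close> of the last letter of \<open>w\<close> and \<open>c\<close> are excluded; at least four are available.\<close>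
lemma ex_next:
  assumes "w \<in> words m"
  shows "\<exists>b\<in>nexts m w. b \<noteq> c"
proof -
  have "card {bar m (last w), c} < card (letters m)"
    using m_ge_2 card_insert_le_m1[of 2 "{c}" "bar m (last w)"] by (simp add: letters_def)
  then obtain b where "b \<in> letters m" "b \<notin> {bar m (last w), c}"
    by (metis card_mono finite.emptyI finite.insertI linorder_not_le subsetI)
  then show ?thesis using assms nexts_iff[of w m b] by (cases "w = []") auto
qed

text \<open>For \<open>w = w' a\<close> this is smaller than the usual cylinder, the image of \<open>D a\<close> under the map of \<open>w'\<close>. The
  choice makes the empty word an ordinary case and makes \<open>\<gamma>\<^sub>w\<close> itself the map that blows \<open>D b\<close> down.\<close>
definition cyl :: "nat list \<Rightarrow> complex set" where
  "cyl w = act w ` (\<Union>b\<in>nexts m w. D b)"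

lemma cyl_hd: "w \<in> words m \<Longrightarrow> w \<noteq> [] \<Longrightarrow> cyl w \<subseteq> D (hd w)"
  using moeb_word nexts_not_closure D_closure by (fastforce simp: cyl_def)

lemma cyl_append_inner:
  assumes "u @ v \<in> words m" "x \<in> cyl (u @ v)"
  obtains b y where "b \<in> nexts m u" "y \<in> D b" "y \<in> cyl v" "x = act u y"
proof -
  obtain b z where b: "b \<in> nexts m (u @ v)" "z \<in> D b" "x = act (u @ v) z"
    using assms(2) by (auto simp: cyl_def)
  then have x: "x = act u (act v z)"
    using moeb_append[OF assms(1) b(1) D_closure[OF b(2)]] by simp
  show thesis
  proof (cases "v = []")
    case True
    then have bu: "b \<in> nexts m u" using b(1) by simp
    have "z \<in> cyl v" using True b(2) nexts_letters[OF bu] by (auto simp: cyl_def)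
    then show ?thesis using that[OF bu b(2)] b(3) True by simp
  next
    case False
    then have "act v z \<in> cyl v" using b by (auto simp: cyl_def nexts_append)
    moreover have "v \<in> words m" using assms(1) by (simp add: words_append_iff)
    ultimately show ?thesis
      using that[OF hd_nexts[OF assms(1) False] _ _ x] cyl_hd False by blast
  qed
qed

lemma cyl_append: "u @ v \<in> words m \<Longrightarrow> cyl (u @ v) \<subseteq> cyl u"
  using cyl_append_inner[of u v] unfolding cyl_def[of u] by blast

lemma cyl_take: "w \<in> words m \<Longrightarrow> cyl w \<subseteq> cyl (take n w)"
  using cyl_append[of "take n w" "drop n w"] by simp

text \<open>A letter maps into its own disk, which determines the first letter; it is injective, so it can be
  stripped off.\<close>
lemma cyl_unique:
  assumes "length u = length v" "u \<in> words m" "v \<in> words m" "x \<in> cyl u" "x \<in> cyl v"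
  shows "u = v"
  using assms
proof (induction u v arbitrary: x rule: list_induct2)
  case (Cons a u b v)
  have ab: "a \<in> letters m" "b \<in> letters m" "u \<in> words m" "v \<in> words m"
    using Cons.prems by (auto simp: words_Cons_iff)
  have "x \<in> D a" "x \<in> D b" using Cons.prems cyl_hd by fastforce+
  then have "a = b" using D_eq_letter[OF ab(1,2)] D_closure by blast
  obtain c y where y: "c \<in> nexts m [a]" "y \<in> D c" "y \<in> cyl u" "x = act [a] y"
    using cyl_append_inner[of "[a]" u x] Cons.prems by auto
  obtain d z where z: "d \<in> nexts m [a]" "z \<in> D d" "z \<in> cyl v" "x = act [a] z"
    using cyl_append_inner[of "[b]" v x] Cons.prems \<open>a = b\<close> by auto
  have "y = z" using moeb_word_inj[of "[a]" c y d z] y z ab D_closure by auto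
  then show ?case using Cons.IH[OF ab(3,4) y(3)] z(3) \<open>a = b\<close> by simp
qed simp

end

section \<open>Cylinders as approximate similar copies\<close>

text \<open>The constants on which all estimates depend. They exist because there are finitely many letters and
  the closed disks are compact and disjoint.\<close>
locale schottky_geometry = schottky +
  fixes \<kappa> K M :: real
  assumes kappa: "0 < \<kappa>" "\<kappa> \<le> 1" and K: "1 \<le> K" and M: "1 \<le> M"
    and separated: "\<And>a b y z. a \<in> letters m \<Longrightarrow> b \<in> letters m \<Longrightarrow> a \<noteq> b \<Longrightarrow>
        y \<in> closure (D a) \<Longrightarrow> z \<in> closure (D b) \<Longrightarrow> \<kappa> \<le> cmod (y - z)"
    and bounded_D: "\<And>a b y z. a \<in> letters m \<Longrightarrow> b \<in> letters m \<Longrightarrow>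
        y \<in> closure (D a) \<Longrightarrow> z \<in> closure (D b) \<Longrightarrow> cmod (y - z) \<le> K"
    and entry_bound: "\<And>a. a \<in> letters m \<Longrightarrow> \<bar>\<gamma> a$2$1\<bar> \<le> M"

lemma (in schottky) ex_schottky_geometry: "\<exists>\<kappa> K M. schottky_geometry m D \<gamma> \<kappa> K M"
proof -
  let ?L = "letters m"
  have "\<forall>p\<in>?L \<times> ?L. \<exists>d>0. fst p \<noteq> snd p \<longrightarrow>
      (\<forall>y\<in>closure (D (fst p)). \<forall>z\<in>closure (D (snd p)). d \<le> dist y z)"
  proof
    fix p assume p: "p \<in> ?L \<times> ?L"
    show "\<exists>d>0. fst p \<noteq> snd p \<longrightarrow>
      (\<forall>y\<in>closure (D (fst p)). \<forall>z\<in>closure (D (snd p)). d \<le> dist y z)"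
    proof (cases "fst p = snd p")
      case False
      then show ?thesis
        using separate_compact_closed[OF compact_closure_D[of "fst p"] closed_closure
            closure_D_disjoint[of "fst p" "snd p"]] p by auto
    qed (auto intro: exI[of _ 1])
  qed
  then obtain d where d: "\<And>p. p \<in> ?L \<times> ?L \<Longrightarrow> 0 < d p"
     "\<And>p y z. p \<in> ?L \<times> ?L \<Longrightarrow> fst p \<noteq> snd p \<Longrightarrow> y \<in> closure (D (fst p)) \<Longrightarrow> z \<in> closure (D (snd p)) \<Longrightarrow>
       d p \<le> dist y z"
    by metis
  define \<kappa> where "\<kappa> = Min (insert 1 (d ` (?L \<times> ?L)))"
  have k0: "0 < \<kappa>" unfolding \<kappa>_def using d(1) by (subst Min_gr_iff) auto
  have k1: "\<kappa> \<le> 1" unfolding \<kappa>_def by (rule Min_le) auto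
  have kd: "\<kappa> \<le> d p" if "p \<in> ?L \<times> ?L" for p unfolding \<kappa>_def using that by (intro Min_le) auto
  have "bounded (\<Union>a\<in>?L. closure (D a))"
    using compact_closure_D compact_imp_bounded by (intro bounded_UN) auto
  then obtain e where e: "\<forall>y\<in>(\<Union>a\<in>?L. closure (D a)). \<forall>z\<in>(\<Union>a\<in>?L. closure (D a)). dist y z \<le> e"
    unfolding bounded_two_points ..
  define M where "M = Max (insert 1 ((\<lambda>a. \<bar>\<gamma> a$2$1\<bar>) ` ?L))"
  have "schottky_geometry m D \<gamma> \<kappa> (max 1 e) M"
  proof unfold_locales
    show "0 < \<kappa>" "\<kappa> \<le> 1" by (rule k0, rule k1)
    show "1 \<le> max 1 e" by simp
    show "1 \<le> M" unfolding M_def by (rule Max_ge) auto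
    fix a assume a: "a \<in> ?L"
    show "\<bar>\<gamma> a$2$1\<bar> \<le> M" unfolding M_def by (rule Max_ge) (use a in auto)
    fix b y z assume b: "b \<in> ?L" "y \<in> closure (D a)" "z \<in> closure (D b)"
    show "cmod (y - z) \<le> max 1 e" 
    proof -
      have "dist y z \<le> e" by (rule e[rule_format]) (use a b in blast)+
      then show ?thesis by (simp add: dist_norm)
    qed
    assume "a \<noteq> b"
    then show "\<kappa> \<le> cmod (y - z)" using kd[of "(a, b)"] d(2)[of "(a, b)" y z] a b by (simp add: dist_norm)
  qed
  then show ?thesis by blast
qed

context schottky_geometry
begin

text \<open>Up to bounded factors \<open>scale w\<close> is the derivative of \<open>\<gamma>\<^sub>w\<close> on the disks that may follow \<open>w\<close>, and the
  diameter of \<open>cyl w\<close>.\<close>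
definition scale :: "nat list \<Rightarrow> real" where
  "scale w = (if w = [] then 1 else 1 / (lower w)\<^sup>2)"

lemma scale_pos: "w \<in> words m \<Longrightarrow> 0 < scale w"
  using word_pole(1)[of w] by (simp add: scale_def)

lemma pole_dist:
  assumes "w \<in> words m" "w \<noteq> []" "b \<in> nexts m w" "z \<in> closure (D b)"
  shows "\<kappa> \<le> cmod (z - of_real (wpole w))" "cmod (z - of_real (wpole w)) \<le> K"
proof -
  have l: "bar m (last w) \<in> letters m"
    using assms(1,2) words_letters bar_letters by (meson last_in_set subsetD)
  have p: "complex_of_real (wpole w) \<in> closure (D (bar m (last w)))"
    using word_pole(2)[OF assms(1,2)] D_closure by blast
  have b: "b \<in> letters m" "b \<noteq> bar m (last w)" using assms nexts_iff[OF assms(1,2)] by auto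
  show "\<kappa> \<le> cmod (z - of_real (wpole w))" using separated[OF b(1) l b(2) assms(4) p] .
  show "cmod (z - of_real (wpole w)) \<le> K" using bounded_D[OF b(1) l assms(4) p] .
qed

text \<open>The product is the distance from \<open>z\<close> to the pole of \<open>\<gamma>\<^sub>w\<close> (or 1 for the empty word).\<close>
lemma den_scale:
  assumes "w \<in> words m" "b \<in> nexts m w" "z \<in> closure (D b)"
  shows "\<kappa> \<le> sqrt (scale w) * cmod (den (word_mat \<gamma> w) z)" "sqrt (scale w) * cmod (den (word_mat \<gamma> w) z) \<le> K"
proof -
  have "sqrt (scale w) * cmod (den (word_mat \<gamma> w) z) =
      (if w = [] then 1 else cmod (z - of_real (wpole w)))"
    using word_pole(1)[OF assms(1)] norm_den[of "word_mat \<gamma> w" z]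
    by (simp add: scale_def real_sqrt_divide)
  then show "\<kappa> \<le> sqrt (scale w) * cmod (den (word_mat \<gamma> w) z)" "sqrt (scale w) * cmod (den (word_mat \<gamma> w) z) \<le> K"
    using kappa K pole_dist[OF assms(1) _ assms(2,3)] by auto
qed

text \<open>By \<open>moeb_diff\<close> distances are divided by the two denominators, which \<open>den_scale\<close> controls.\<close>
lemma bilipschitz:
  assumes w: "w \<in> words m" and y: "a \<in> nexts m w" "y \<in> closure (D a)" and z: "b \<in> nexts m w" "z \<in> closure (D b)"
  shows "scale w / K\<^sup>2 * cmod (y - z) \<le> cmod (act w y - act w z)"
    "cmod (act w y - act w z) \<le> scale w / \<kappa>\<^sup>2 * cmod (y - z)"
proof -
  define A where "A = word_mat \<gamma> w"
  define s where "s = sqrt (scale w)"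
  have s: "0 < s" "scale w = s\<^sup>2" using scale_pos[OF w] by (auto simp: s_def)
  define u where "u = s * cmod (den A y)"
  define v where "v = s * cmod (den A z)"
  have uv: "\<kappa> \<le> u" "u \<le> K" "\<kappa> \<le> v" "v \<le> K"
    using den_scale[OF w y] den_scale[OF w z] by (auto simp: u_def v_def A_def s_def)
  have eq: "cmod (moeb A y - moeb A z) = scale w * cmod (y - z) / (u * v)"
    using moeb_diff[OF det_word[OF words_letters[OF w]] den_word_nonzero[OF w y] den_word_nonzero[OF w z]] s
    by (simp add: A_def[symmetric] norm_divide norm_mult u_def v_def power2_eq_square)
  have "\<kappa> * \<kappa> \<le> u * v" "u * v \<le> K * K" using uv kappa by (auto intro!: mult_mono)
  moreover have "0 < u * v" using uv kappa by simp
  moreover have "0 \<le> scale w * cmod (y - z)" using scale_pos[OF w] by simp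
  ultimately show "scale w / K\<^sup>2 * cmod (y - z) \<le> cmod (act w y - act w z)"
    "cmod (act w y - act w z) \<le> scale w / \<kappa>\<^sup>2 * cmod (y - z)"
    unfolding A_def[symmetric] eq power2_eq_square times_divide_eq_left
    using kappa by (auto intro!: divide_left_mono)
qed

lemma cyl_diameter:
  assumes "w \<in> words m" "x \<in> cyl w" "y \<in> cyl w"
  shows "cmod (x - y) \<le> scale w * (K / \<kappa>\<^sup>2)"
proof -
  obtain a b y' z' where yz: "a \<in> nexts m w" "y' \<in> D a" "x = act w y'"
     "b \<in> nexts m w" "z' \<in> D b" "y = act w z'"
    using assms(2,3) unfolding cyl_def by blast
  have "cmod (x - y) \<le> scale w / \<kappa>\<^sup>2 * cmod (y' - z')"
    using bilipschitz(2)[OF assms(1) yz(1) _ yz(4)] yz D_closure by blast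
  also have "\<dots> \<le> scale w / \<kappa>\<^sup>2 * K"
    using bounded_D[of a b y' z'] yz D_closure nexts_letters scale_pos[OF assms(1)]
    by (intro mult_left_mono) auto
  finally show ?thesis by simp
qed

lemma cyl_gap:
  assumes "w \<in> words m" "a \<in> nexts m w" "y \<in> D a" "b \<in> nexts m w" "z \<in> D b" "a \<noteq> b"
  shows "scale w * (\<kappa> / K\<^sup>2) \<le> cmod (act w y - act w z)"
proof -
  have "scale w / K\<^sup>2 * \<kappa> \<le> scale w / K\<^sup>2 * cmod (y - z)"
    using separated[of a b y z] assms D_closure nexts_letters scale_pos[OF assms(1)]
    by (intro mult_left_mono) auto
  also have "\<dots> \<le> cmod (act w y - act w z)"
    using bilipschitz(1)[OF assms(1,2) _ assms(4)] assms D_closure by blast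
  finally show ?thesis by simp
qed

text \<open>The lower left entry of \<open>\<gamma>\<^sub>w \<gamma>\<^sub>b\<close> is the product of those of the factors with the distance from the
  pole of \<open>\<gamma>\<^sub>w\<close> to the image of infinity under \<open>\<gamma>\<^sub>b\<close>.\<close>
lemma scale_snoc:
  assumes "w \<in> words m" "b \<in> nexts m w"
  shows "scale w \<le> (M * K)\<^sup>2 * scale (w @ [b])"
proof -
  have b: "b \<in> letters m" using assms nexts_letters by blast
  have cb: "\<gamma> b$2$1 \<noteq> 0" "complex_of_real (\<gamma> b$1$1 / \<gamma> b$2$1) \<in> D b"
    using moeb_letter_infinity[OF b] by auto
  define A where "A = word_mat \<gamma> w"
  have *: "\<bar>lower (w @ [b])\<bar> \<le> (if w = [] then 1 else \<bar>A$2$1\<bar>) * (M * K)"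
  proof (cases "w = []")
    case True
    have "\<bar>\<gamma> b$2$1\<bar> * 1 \<le> M * K" using entry_bound[OF b] K M by (intro mult_mono) auto
    then show ?thesis using True by (simp add: word_mat_Cons)
  next
    case False
    have c: "A$2$1 \<noteq> 0" using word_pole(1)[OF assms(1) False] by (simp add: A_def)
    have "(A ** \<gamma> b)$2$1 = A$2$1 * (\<gamma> b$2$1 * (\<gamma> b$1$1 / \<gamma> b$2$1 - pole A))"
      using cb(1) c by (simp add: matrix_mult_2 pole_def field_simps)
    moreover have "\<bar>\<gamma> b$1$1 / \<gamma> b$2$1 - pole A\<bar> \<le> K"
      using pole_dist(2)[OF assms(1) False assms(2) D_closure[OF cb(2)]]
      unfolding A_def of_real_diff[symmetric] norm_of_real .
    then have "\<bar>\<gamma> b$2$1\<bar> * \<bar>\<gamma> b$1$1 / \<gamma> b$2$1 - pole A\<bar> \<le> M * K"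
      using entry_bound[OF b] M by (intro mult_mono) auto
    ultimately show ?thesis using False
      by (simp add: word_mat_append word_mat_Cons A_def[symmetric] abs_mult mult_left_mono)
  qed
  have nz: "lower (w @ [b]) \<noteq> 0" using word_pole(1)[of "w @ [b]"] assms by (simp add: words_snoc_iff)
  have sq: "(lower (w @ [b]))\<^sup>2 \<le> ((if w = [] then 1 else \<bar>A$2$1\<bar>) * (M * K))\<^sup>2"
    using power_mono[OF *, of 2] by simp
  show ?thesis
  proof (cases "w = []")
    case True
    then show ?thesis using sq nz by (simp add: scale_def divide_simps)
  next
    case False
    have c: "A$2$1 \<noteq> 0" using word_pole(1)[OF assms(1) False] by (simp add: A_def)
    then show ?thesis using sq nz False by (simp add: scale_def divide_simps A_def power_mult_distrib mult.commute)
  qed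
qed

definition real_pt :: "nat \<Rightarrow> real" where
  "real_pt b = (SOME x. complex_of_real x \<in> D b)"

lemma real_pt: "b \<in> letters m \<Longrightarrow> complex_of_real (real_pt b) \<in> D b"
  unfolding real_pt_def
proof (rule someI_ex)
  assume "b \<in> letters m"
  then obtain c r where "0 < r" "D b = ball (complex_of_real c) r" using disk by blast
  then have "complex_of_real c \<in> D b" by simp
  then show "\<exists>x. complex_of_real x \<in> D b" ..
qed

lemma moeb_real:
  assumes "w \<in> words m" "b \<in> nexts m w" "complex_of_real x \<in> closure (D b)"
  shows "act w (of_real x) = of_real (Re (act w (of_real x)))"
  using Im_moeb[OF det_word[OF words_letters[OF assms(1)]] den_word_nonzero[OF assms]]
  by (simp add: complex_eq_iff)

text \<open>At every prefix of \<open>w\<close> a point is placed into a sibling of the subcylinder that contains the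
  cylinders of all longer prefixes. If all scales of the prefixes were at least \<open>e\<close>, these points would be separated by a multiple of
  \<open>e\<close>, and a bounded interval contains only boundedly many such points.\<close>
lemma prefix_scale_small:
  assumes w: "w \<in> words m" and e: "0 < e" and n: "real (length w) > 1 + K * K\<^sup>2 / (e * \<kappa>)"
  shows "\<exists>i<length w. scale (take i w) < e"
proof (rule ccontr)
  assume "\<not> ?thesis"
  then have big: "e \<le> scale (take i w)" if "i < length w" for i using that by force
  have tk: "take i w \<in> words m" for i using w by (rule words_take)
  have "\<forall>i. \<exists>b\<in>nexts m (take i w). b \<noteq> w ! i" using ex_next[OF tk] by blast
  then obtain b where b: "\<And>i. b i \<in> nexts m (take i w)" "\<And>i. b i \<noteq> w ! i" by metis
  have bD: "complex_of_real (real_pt (b i)) \<in> D (b i)" for i using real_pt b(1) nexts_letters by blast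
  define q where "q i = Re (act (take i w) (of_real (real_pt (b i))))" for i
  have q: "act (take i w) (of_real (real_pt (b i))) = of_real (q i)" for i
    unfolding q_def using moeb_real[OF tk b(1) D_closure[OF bD]] .
  have gap: "e * (\<kappa> / K\<^sup>2) \<le> \<bar>q i - q j\<bar>" if ij: "i < j" "j < length w" for i j
  proof -
    define v where "v = drop i (take j w)"
    have v: "take j w = take i w @ v" "v \<noteq> []" "hd v = w ! i"
    proof -
      show "take j w = take i w @ v"
        using append_take_drop_id[of i "take j w"] ij by (simp add: v_def min_def)
      show "v \<noteq> []" "hd v = w ! i" using ij by (auto simp: v_def hd_drop_conv_nth)
    qed
    have vw: "take i w @ v \<in> words m" using tk[of j] v by simp
    have bn: "b j \<in> nexts m (take i w @ v)" using b(1)[of j] v by simp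
    have "act v (of_real (real_pt (b j))) \<in> cyl v"
      using bD[of j] bn v(2) by (auto simp: cyl_def nexts_append)
    then have inD: "act v (of_real (real_pt (b j))) \<in> D (w ! i)"
      using cyl_hd[of v] v vw by (auto simp: words_append_iff)
    have "complex_of_real (q j) = act (take i w) (act v (of_real (real_pt (b j))))"
      using q[of j] moeb_append[OF vw bn D_closure[OF bD]] v by simp
    then have "scale (take i w) * (\<kappa> / K\<^sup>2) \<le> cmod (of_real (q i) - of_real (q j))"
      using cyl_gap[OF tk b(1)[of i] bD _ inD b(2)] hd_nexts[OF vw v(2)] v(3) q[of i] by simp
    moreover have "e * (\<kappa> / K\<^sup>2) \<le> scale (take i w) * (\<kappa> / K\<^sup>2)"
      using big[of i] ij kappa by (intro mult_right_mono) auto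
    ultimately show ?thesis by (simp flip: of_real_diff)
  qed
  have t0: "0 < e * (\<kappa> / K\<^sup>2)" using e kappa K by simp
  have gap': "e * (\<kappa> / K\<^sup>2) \<le> \<bar>q i - q j\<bar>" if "i \<noteq> j" "i < length w" "j < length w" for i j
    using that gap[of i j] gap[of j i] by (cases "i < j") (auto simp: abs_minus_commute)
  then have "inj_on q {..<length w}" using t0 by (force intro!: inj_onI)
  then have "card (q ` {..<length w}) = length w" by (simp add: card_image)
  moreover have "sep (e * (\<kappa> / K\<^sup>2)) (q ` {..<length w})"
    unfolding sep_def
  proof (intro conjI ballI impI)
    fix y z assume "y \<in> q ` {..<length w}" "z \<in> q ` {..<length w}" "y \<noteq> z"
    then obtain i j where "y = q i" "z = q j" "i < length w" "j < length w" "i \<noteq> j" by blast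
    then show "e * (\<kappa> / K\<^sup>2) \<le> \<bar>y - z\<bar>" using gap' by simp
  qed simp
  moreover have "\<bar>y - z\<bar> \<le> K" if yz: "y \<in> q ` {..<length w}" "z \<in> q ` {..<length w}" for y z
  proof -
    have inD: "\<exists>a\<in>letters m. complex_of_real (q i) \<in> closure (D a)" for i
    proof (cases "take i w = []")
      case True
      then have "complex_of_real (q i) = complex_of_real (real_pt (b i))"
        using q[of i] by (simp only: word_mat_Nil moeb_one)
      then show ?thesis using bD[of i] b(1)[of i] D_closure nexts_letters by metis
    next
      case False
      have "complex_of_real (q i) \<in> cyl (take i w)" unfolding q[symmetric] cyl_def using bD b(1) by blast
      then have "complex_of_real (q i) \<in> D (hd (take i w))" using cyl_hd[OF tk False] by blast
      moreover have "hd (take i w) \<in> letters m"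
        using words_letters[OF tk] hd_in_set[OF False] by blast
      ultimately show ?thesis using D_closure by blast
    qed
    obtain i j where ij: "y = q i" "z = q j" using yz by blast
    obtain a b where "a \<in> letters m" "complex_of_real y \<in> closure (D a)"
      "b \<in> letters m" "complex_of_real z \<in> closure (D b)"
      using inD[of i] inD[of j] ij by blast
    then have "cmod (complex_of_real y - complex_of_real z) \<le> K" by (intro bounded_D)
    then show ?thesis by (simp flip: of_real_diff)
  qed
  ultimately have "real (length w) \<le> 1 + K / (e * (\<kappa> / K\<^sup>2))"
    using sep_card_le[OF _ t0, of "q ` {..<length w}" K] K by auto
  then show False using n by simp
qed

text \<open>The cylinder of \<open>w\<close> contains two points at a distance comparable to \<open>scale w\<close> and lies in the cylinder
  of every prefix of \<open>w\<close>.\<close>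
lemma scale_small:
  assumes "0 < e"
  shows "\<exists>n. \<forall>w\<in>words m. n \<le> length w \<longrightarrow> scale w < e"
proof -
  define c where "c = (K / \<kappa>\<^sup>2) / (\<kappa> / K\<^sup>2)"
  have c: "0 < c" using kappa K by (simp add: c_def)
  define e' where "e' = e / c"
  have e': "0 < e'" using assms c by (simp add: e'_def)
  obtain n :: nat where n: "real n > 1 + K * K\<^sup>2 / (e' * \<kappa>)" using reals_Archimedean2 by blast
  show ?thesis
  proof (intro exI[of _ n] ballI impI)
    fix w assume w: "w \<in> words m" "n \<le> length w"
    then obtain i where i: "scale (take i w) < e'" using prefix_scale_small[OF w(1) e'] n by force
    obtain a where a: "a \<in> nexts m w" using ex_next[OF w(1)] by blast
    obtain b where b: "b \<in> nexts m w" "b \<noteq> a" using ex_next[OF w(1)] by blast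
    let ?f = "act w"
    have aD: "complex_of_real (real_pt a) \<in> D a" and bD: "complex_of_real (real_pt b) \<in> D b"
      using real_pt a b nexts_letters by blast+
    have "scale w * (\<kappa> / K\<^sup>2) \<le> cmod (?f (of_real (real_pt b)) - ?f (of_real (real_pt a)))"
      using cyl_gap[OF w(1) b(1) bD a aD b(2)] .
    also have "\<dots> \<le> scale (take i w) * (K / \<kappa>\<^sup>2)"
    proof (rule cyl_diameter[OF words_take[OF w(1)]])
      show "?f (of_real (real_pt b)) \<in> cyl (take i w)" "?f (of_real (real_pt a)) \<in> cyl (take i w)"
        using cyl_take[OF w(1), of i] a b aD bD unfolding cyl_def[of w] by blast+
    qed
    also have "\<dots> < e' * (K / \<kappa>\<^sup>2)" using i kappa K by (intro mult_strict_right_mono) auto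
    also have "\<dots> = e * (\<kappa> / K\<^sup>2)" using kappa K by (simp add: e'_def c_def)
    finally show "scale w < e" using kappa K by (simp add: divide_simps mult_less_cancel_right)
  qed
qed

section \<open>The limit set as the set of nested cylinders\<close>

definition limset :: "real set" where
  "limset = {x. \<forall>n. \<exists>w\<in>words m. length w = n \<and> complex_of_real x \<in> cyl w}"

lemma limset_cyl:
  assumes "x \<in> limset" obtains w where "w \<in> words m" "length w = n" "complex_of_real x \<in> cyl w"
  using assms unfolding limset_def by blast

lemma limset_letter: "x \<in> limset \<Longrightarrow> \<exists>b\<in>letters m. complex_of_real x \<in> D b"
  using limset_cyl[of x 0] by (auto simp: cyl_def)

lemma limset_cyl_extends:
  assumes "x \<in> limset" "w \<in> words m" "complex_of_real x \<in> cyl w"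
  shows "\<exists>v. w @ v \<in> words m \<and> length v = n \<and> complex_of_real x \<in> cyl (w @ v)"
proof -
  obtain u where u: "u \<in> words m" "length u = length w + n" "complex_of_real x \<in> cyl u"
    using limset_cyl[OF assms(1)] by blast
  have "take (length w) u = w"
  proof (rule cyl_unique[OF _ words_take[OF u(1)] assms(2) _ assms(3)])
    show "complex_of_real x \<in> cyl (take (length w) u)" using u cyl_take by blast
  qed (use u in auto)
  then have "w @ drop (length w) u = u" by (metis append_take_drop_id)
  then show ?thesis using u by (intro exI[of _ "drop (length w) u"]) auto
qed

text \<open>If \<open>x\<close> has the code \<open>v\<close>, then its image has the code \<open>w @ v\<close>; the letter \<open>b\<close> is the first letter of \<open>v\<close>,
  so the concatenation is reduced.\<close>
lemma limset_forward:
  assumes "x \<in> limset" "w \<in> words m" "b \<in> nexts m w" "complex_of_real x \<in> D b"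
  shows "Re (act w (of_real x)) \<in> limset" "complex_of_real (Re (act w (of_real x))) = act w (of_real x)"
    "act w (of_real x) \<in> cyl w"
proof -
  show eq: "complex_of_real (Re (act w (of_real x))) = act w (of_real x)"
    using moeb_real[OF assms(2,3) D_closure[OF assms(4)]] by simp
  show "act w (of_real x) \<in> cyl w" using assms(3,4) by (auto simp: cyl_def)
  have "\<exists>u\<in>words m. length u = n \<and> act w (of_real x) \<in> cyl u" for n
  proof -
    obtain v where v: "v \<in> words m" "length v = Suc n" "complex_of_real x \<in> cyl v"
      using limset_cyl[OF assms(1)] by blast
    have v0: "v \<noteq> []" using v(2) by auto
    have "complex_of_real x \<in> D (hd v)" using cyl_hd[OF v(1) v0] v(3) by blast
    moreover have "hd v \<in> letters m" using v v0 words_letters hd_in_set by blast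
    ultimately have "hd v = b"
      using D_eq_letter D_closure assms(3,4) nexts_letters by blast
    then have wv: "w @ v \<in> words m"
      using assms(2,3) v(1) v0 by (auto simp: words_append_iff nexts_def follows_def)
    obtain c z where z: "c \<in> nexts m v" "z \<in> D c" "complex_of_real x = act v z"
      using v(3) by (auto simp: cyl_def)
    have c: "c \<in> nexts m (w @ v)" using z(1) v0 by (simp add: nexts_append)
    have "act w (of_real x) = act (w @ v) z"
      using moeb_append[OF wv c D_closure[OF z(2)]] z(3) by simp
    then have "act w (of_real x) \<in> cyl (w @ v)" using c z(2) by (auto simp: cyl_def)
    then have "act w (of_real x) \<in> cyl (take n (w @ v))" using cyl_take[OF wv] by blast
    then show ?thesis using v(2) words_take[OF wv] by (intro bexI[of _ "take n (w @ v)"]) auto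
  qed
  then show "Re (act w (of_real x)) \<in> limset" by (simp add: limset_def eq)
qed

text \<open>Codes of \<open>y\<close> that are longer than \<open>w\<close> extend \<open>w\<close>, and the rest of such a code is a code of the
  preimage.\<close>
lemma limset_backward:
  assumes "y \<in> limset" "w \<in> words m" "complex_of_real y \<in> cyl w"
  shows "\<exists>x\<in>limset. \<exists>b\<in>nexts m w. complex_of_real x \<in> D b \<and> act w (of_real x) = of_real y"
proof -
  obtain b z where b: "b \<in> nexts m w" "z \<in> D b" "complex_of_real y = act w z"
    using assms(3) by (auto simp: cyl_def)
  have dz: "den (word_mat \<gamma> w) z \<noteq> 0" using den_word_nonzero[OF assms(2) b(1) D_closure[OF b(2)]] .
  have "Im z / (cmod (den (word_mat \<gamma> w) z))\<^sup>2 = 0"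
    using Im_moeb[OF det_word[OF words_letters[OF assms(2)]] dz] b(3)[symmetric] by simp
  then have "Im z = 0" using dz by simp
  then have z: "complex_of_real (Re z) = z" by (simp add: complex_eq_iff)
  have "\<exists>v\<in>words m. length v = n \<and> complex_of_real (Re z) \<in> cyl v" for n
  proof -
    obtain v where v: "w @ v \<in> words m" "length v = n" "complex_of_real y \<in> cyl (w @ v)"
      using limset_cyl_extends[OF assms] by blast
    obtain c x where x: "c \<in> nexts m w" "x \<in> D c" "x \<in> cyl v" "complex_of_real y = act w x"
      using cyl_append_inner[OF v(1,3)] by blast
    have "x = z"
      using moeb_word_inj[OF assms(2) x(1) D_closure[OF x(2)] b(1) D_closure[OF b(2)]] x(4) b(3) by simp
    then show ?thesis using v x z by (auto simp: words_append_iff)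
  qed
  then have "Re z \<in> limset" by (simp add: limset_def)
  then show ?thesis using b z by (intro bexI[of _ "Re z"] bexI[of _ b]) auto
qed

text \<open>Closed disks make the levels compact. A level is still contained in the union of the cylinders one
  step coarser (\<open>level_Suc\<close>), so levels and cylinders define the same limit.\<close>
definition level :: "nat \<Rightarrow> complex set" where
  "level n = (\<Union>w\<in>{w \<in> words m. length w = n}. \<Union>b\<in>nexts m w. act w ` closure (D b))"

lemma compact_level: "compact (level n)"
  unfolding level_def
proof (intro compact_UN finite_words_length)
  fix w assume "w \<in> {w \<in> words m. length w = n}"
  then have w: "w \<in> words m" by simp
  show "finite (nexts m w)" by (rule finite_subset[OF _ finite_letters[of m]]) (auto simp: nexts_def)
  fix b assume b: "b \<in> nexts m w"
  show "compact (act w ` closure (D b))"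
  proof (rule compact_continuous_image)
    show "compact (closure (D b))" using compact_closure_D nexts_letters[OF b] by blast
    show "continuous_on (closure (D b)) (act w)"
      using deriv_moeb(1)[OF det_word[OF words_letters[OF w]] den_word_nonzero[OF w b]]
      by (intro continuous_at_imp_continuous_on ballI) (rule DERIV_isCont)
  qed
qed

lemma cyl_level: "w \<in> words m \<Longrightarrow> cyl w \<subseteq> level (length w)"
  unfolding cyl_def level_def using closure_subset by blast

lemma level_Suc: "x \<in> level (Suc n) \<Longrightarrow> \<exists>w\<in>words m. length w = n \<and> x \<in> cyl w"
proof -
  assume "x \<in> level (Suc n)"
  then obtain u b z where u: "u \<in> words m" "length u = Suc n" "b \<in> nexts m u" "z \<in> closure (D b)" "x = act u z"
    by (auto simp: level_def)
  obtain w a where w: "u = w @ [a]" using u(2) by (metis append_butlast_last_id list.size(3) nat.distinct(1))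
  have wa: "w \<in> words m" "a \<in> nexts m w" using u(1) w words_snoc_iff by auto
  have "b \<in> nexts m [a]" using u(3) w by (simp add: nexts_append)
  then have "act [a] z \<in> D a"
    using moeb_word[of "[a]" z] nexts_not_closure[of "[a]" b z] u(4) nexts_letters[OF wa(2)] by simp
  moreover have "x = act w (act [a] z)" using moeb_append[of w "[a]" b z] u w by simp
  ultimately have "x \<in> cyl w" using wa(2) by (auto simp: cyl_def)
  then show ?thesis using wa u(2) w by auto
qed

lemma limset_level: "x \<in> limset \<longleftrightarrow> (\<forall>n. complex_of_real x \<in> level n)"
proof
  assume x: "x \<in> limset"
  show "\<forall>n. complex_of_real x \<in> level n"
  proof
    fix n
    obtain w where "w \<in> words m" "length w = n" "complex_of_real x \<in> cyl w" using limset_cyl[OF x] .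
    then show "complex_of_real x \<in> level n" using cyl_level[of w] by auto
  qed
next
  assume "\<forall>n. complex_of_real x \<in> level n"
  then show "x \<in> limset" unfolding limset_def using level_Suc by simp
qed

lemma compact_limset: "compact limset"
proof -
  have "limset = (\<Inter>n. complex_of_real -` level n)" by (auto simp: limset_level)
  moreover have "closed (complex_of_real -` level n)" for n
    by (intro closed_vimage compact_imp_closed compact_level continuous_intros)
  ultimately have "closed limset" by auto
  moreover have "bounded limset"
    unfolding bounded_two_points
  proof (intro exI[of _ K] ballI)
    fix x y assume "x \<in> limset" "y \<in> limset"
    then obtain a b where "a \<in> letters m" "complex_of_real x \<in> closure (D a)"
      "b \<in> letters m" "complex_of_real y \<in> closure (D b)"
      using limset_letter D_closure by meson
    then have "cmod (complex_of_real x - complex_of_real y) \<le> K" by (intro bounded_D)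
    then show "dist x y \<le> K" by (simp add: dist_real_def flip: of_real_diff)
  qed
  ultimately show ?thesis by (simp add: compact_eq_bounded_closed)
qed

text \<open>A limit point of points in the cylinders of \<open>b b \<dots> b\<close>.\<close>
lemma limset_meets_D:
  assumes b: "b \<in> letters m"
  shows "\<exists>x\<in>limset. complex_of_real x \<in> D b"
proof -
  define w where "w n = replicate n b" for n :: nat
  have bb: "b \<noteq> bar m b" using bar_neq[OF b] by simp
  have wn: "w n \<in> words m" "b \<in> nexts m (w n)" for n
  proof (induction n)
    case (Suc n)
    { case 1
      have "w (Suc n) = w n @ [b]" by (simp add: w_def replicate_append_same)
      then show ?case using Suc words_snoc_iff by simp }
    { case 2
      show ?case using b bb by (simp add: nexts_def follows_def w_def last_replicate) }
  qed (use b in \<open>auto simp: w_def nexts_def\<close>)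
  define q where "q n = Re (act (w n) (of_real (real_pt b)))" for n
  have q: "complex_of_real (q n) = act (w n) (of_real (real_pt b))" for n
    unfolding q_def using moeb_real[OF wn D_closure[OF real_pt[OF b]]] by simp
  have qc: "complex_of_real (q n) \<in> cyl (w n)" for n
    using wn real_pt[OF b] by (auto simp: q cyl_def)
  have ql: "complex_of_real (q n) \<in> level k" if "k \<le> n" for k n
  proof -
    have "take k (w n) = w k" using that by (simp add: w_def min_def)
    then have "complex_of_real (q n) \<in> cyl (w k)" using qc cyl_take[OF wn(1), of n k] by auto
    then show ?thesis using cyl_level[OF wn(1), of k] by (auto simp: w_def)
  qed
  have qD: "complex_of_real (q (Suc n)) \<in> closure (D b)" for n
    using qc[of "Suc n"] cyl_hd[OF wn(1)[of "Suc n"]] D_closure by (auto simp: w_def)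
  have "compact (closure (D b))" using compact_closure_D[OF b] .
  then obtain l r where l: "l \<in> closure (D b)" "strict_mono r"
      "((\<lambda>n. complex_of_real (q (Suc n))) \<circ> r) \<longlonglongrightarrow> l"
    using qD by (metis compact_def)
  have "l \<in> \<real>"
    by (rule closed_sequentially[OF closed_complex_Reals _ l(3)]) simp
  then obtain x where x: "l = complex_of_real x" by (auto simp: Reals_def)
  have "l \<in> level k" for k
  proof (rule Lim_in_closed_set[OF compact_imp_closed[OF compact_level] _ _ l(3)])
    show "\<forall>\<^sub>F n in sequentially. ((\<lambda>n. complex_of_real (q (Suc n))) \<circ> r) n \<in> level k"
    proof (rule eventually_sequentiallyI[of k])
      fix n assume "k \<le> n"
      then have "k \<le> Suc (r n)" using seq_suble[OF l(2), of n] by linarith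
      then show "((\<lambda>n. complex_of_real (q (Suc n))) \<circ> r) n \<in> level k" using ql by simp
    qed
  qed simp
  then have "x \<in> limset" using x by (simp add: limset_level)
  moreover obtain c where c: "c \<in> letters m" "complex_of_real x \<in> D c" using limset_letter[OF \<open>x \<in> limset\<close>] by blast
  then have "c = b" using D_eq_letter[OF c(1) b c(2)] l(1) x by blast
  ultimately show ?thesis using c by blast
qed

lemma word_mat_group: "set w \<subseteq> letters m \<Longrightarrow> word_mat \<gamma> w \<in> schottky_group m \<gamma>"
  unfolding schottky_group_def hull_def
proof (rule InterI, clarify)
  fix G assume w: "set w \<subseteq> letters m" and G: "\<gamma> ` letters m \<subseteq> G" "mat 1 \<in> G" "\<forall>A\<in>G. \<forall>B\<in>G. A ** B \<in> G"
  show "word_mat \<gamma> w \<in> G" using w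
    by (induction w) (use G in \<open>auto simp: word_mat_Cons\<close>)
qed

lemma group_word_mat: "A \<in> schottky_group m \<gamma> \<Longrightarrow> \<exists>w\<in>words m. A = word_mat \<gamma> w"
proof -
  let ?T = "word_mat \<gamma> ` words m"
  have mult: "word_mat \<gamma> u ** word_mat \<gamma> v \<in> ?T" if "u \<in> words m" "v \<in> words m" for u v
  proof -
    have l: "set (u @ v) \<subseteq> letters m" using that words_letters by simp
    have "word_mat \<gamma> u ** word_mat \<gamma> v = word_mat \<gamma> (red m (u @ v))"
      using word_mat_red[OF l] by (simp add: word_mat_append)
    then show ?thesis using red_in_words[OF l] by blast
  qed
  have inv: "matrix_inv (word_mat \<gamma> u) \<in> ?T" if "u \<in> words m" for u
  proof -
    have "word_mat \<gamma> (bar_word m u) = word_mat \<gamma> (bar_word m u) ** (word_mat \<gamma> u ** matrix_inv (word_mat \<gamma> u))"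
      using matrix_inv_det_1(2)[OF det_word[OF words_letters[OF that]]] by simp
    also have "\<dots> = matrix_inv (word_mat \<gamma> u)"
      by (simp add: matrix_mul_assoc word_mat_bar_word[OF words_letters[OF that]])
    finally show ?thesis using bar_word_words[OF that] by (metis imageI)
  qed
  have "schottky_group m \<gamma> \<subseteq> ?T"
    unfolding schottky_group_def
  proof (rule hull_minimal)
    show "\<gamma> ` letters m \<subseteq> ?T"
    proof
      fix B assume "B \<in> \<gamma> ` letters m"
      then obtain a where a: "a \<in> letters m" "B = \<gamma> a" by blast
      then show "B \<in> ?T" by (intro image_eqI[of _ _ "[a]"]) (auto simp: word_mat_Cons)
    qed
    have "mat 1 \<in> ?T" by (intro image_eqI[of _ _ "[]"]) auto
    then show "mat 1 \<in> ?T \<and> (\<forall>A\<in>?T. \<forall>B\<in>?T. A ** B \<in> ?T) \<and> (\<forall>A\<in>?T. matrix_inv A \<in> ?T)"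
      using mult inv by blast
  qed
  then show "A \<in> schottky_group m \<gamma> \<Longrightarrow> \<exists>w\<in>words m. A = word_mat \<gamma> w" by blast
qed

text \<open>A base point of imaginary part 1 has distance at least 1 from all poles, so the maps \<open>\<gamma>\<^sub>w\<close> bring it
  close to their cylinders as \<open>scale w\<close> tends to 0. The orbit stays off the real axis, so it never
  reaches the limit.\<close>
lemma limset_subset_limit_set: "limset \<subseteq> limit_set m \<gamma>"
proof
  fix x assume x: "x \<in> limset"
  have one: "1 \<in> letters m" using m_ge_2 by (simp add: letters_def)
  define z where "z = Complex (real_pt 1) 1"
  have z: "Im z = 1" by (simp add: z_def)
  have zD: "cmod (z - y) \<le> 1 + K" if "b \<in> letters m" "y \<in> closure (D b)" for y b
  proof -
    have "z - y = \<i> + (of_real (real_pt 1) - y)" by (simp add: z_def complex_eq_iff)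
    then have "cmod (z - y) \<le> 1 + cmod (of_real (real_pt 1) - y)" by (metis norm_ii norm_triangle_ineq)
    then show ?thesis using bounded_D[OF one that(1) D_closure[OF real_pt[OF one]] that(2)] by simp
  qed
  have "complex_of_real x islimpt ((\<lambda>A. moeb A z) ` schottky_group m \<gamma>)"
    unfolding islimpt_approachable
  proof (intro allI impI)
    fix e :: real assume e: "0 < e"
    define e' where "e' = e / ((1 + K) / \<kappa>)"
    have e': "0 < e'" using e K kappa by (simp add: e'_def)
    obtain n where n: "\<And>w. w \<in> words m \<Longrightarrow> n \<le> length w \<Longrightarrow> scale w < e'" using scale_small[OF e'] by blast
    obtain w where w: "w \<in> words m" "length w = Suc n" "complex_of_real x \<in> cyl w" using limset_cyl[OF x] by blast
    obtain b y where y: "b \<in> nexts m w" "y \<in> D b" "complex_of_real x = act w y" using w(3) by (auto simp: cyl_def)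
    have w0: "w \<noteq> []" using w(2) by auto
    define A where "A = word_mat \<gamma> w"
    have dA: "det A = 1" unfolding A_def using det_word words_letters w(1) by blast
    have dz: "den A z \<noteq> 0" using den_nonzero_of_Im[OF dA] z by simp
    have dy: "den A y \<noteq> 0" unfolding A_def using den_word_nonzero[OF w(1) y(1) D_closure[OF y(2)]] .
    define s where "s = sqrt (scale w)"
    have s: "0 < s" "scale w = s\<^sup>2" using scale_pos[OF w(1)] by (auto simp: s_def)
    have u: "1 \<le> s * cmod (den A z)"
    proof -
      have c: "A$2$1 \<noteq> 0" using word_pole(1)[OF w(1) w0] by (simp add: A_def)
      have "s * cmod (den A z) = cmod (z - of_real (pole A))"
        using norm_den[OF c, of z] c w0 by (simp add: s_def scale_def A_def real_sqrt_divide)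
      also have "\<dots> \<ge> \<bar>Im (z - of_real (pole A))\<bar>" by (rule abs_Im_le_cmod)
      finally show ?thesis using z by simp
    qed
    have v: "\<kappa> \<le> s * cmod (den A y)"
      using den_scale(1)[OF w(1) y(1) D_closure[OF y(2)]] by (simp add: s_def A_def)
    have "cmod (moeb A z - moeb A y) = scale w * cmod (z - y) / ((s * cmod (den A z)) * (s * cmod (den A y)))"
      using moeb_diff[OF dA dz dy] s by (simp add: norm_divide norm_mult power2_eq_square)
    also have "\<dots> \<le> scale w * cmod (z - y) / (1 * \<kappa>)"
    proof (rule divide_left_mono)
      show le: "1 * \<kappa> \<le> (s * cmod (den A z)) * (s * cmod (den A y))"
        using u v kappa by (intro mult_mono) auto
      then have "0 < (s * cmod (den A z)) * (s * cmod (den A y))" using kappa by linarith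
      then show "0 < (s * cmod (den A z)) * (s * cmod (den A y)) * (1 * \<kappa>)" using kappa by simp
      show "0 \<le> scale w * cmod (z - y)" using scale_pos[OF w(1)] by simp
    qed
    also have "\<dots> \<le> scale w * ((1 + K) / \<kappa>)"
      using zD[OF nexts_letters[OF y(1)] D_closure[OF y(2)]] kappa scale_pos[OF w(1)]
      by (simp add: divide_right_mono mult_left_mono)
    also have "\<dots> < e' * ((1 + K) / \<kappa>)" using n[OF w(1)] w(2) K kappa by (intro mult_strict_right_mono) auto
    also have "\<dots> = e" using K kappa by (simp add: e'_def)
    finally have "dist (moeb A z) (of_real x) < e" using y(3) by (simp add: A_def dist_norm)
    moreover have "Im (moeb A z) \<noteq> 0" using Im_moeb[OF dA dz] z dz by simp
    then have "moeb A z \<noteq> of_real x" by (metis Im_complex_of_real)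
    moreover have "A \<in> schottky_group m \<gamma>" unfolding A_def using word_mat_group words_letters w(1) by blast
    ultimately show "\<exists>x'\<in>(\<lambda>A. moeb A z) ` schottky_group m \<gamma>. x' \<noteq> complex_of_real x \<and> dist x' (complex_of_real x) < e"
      by blast
  qed
  then show "x \<in> limit_set m \<gamma>" unfolding limit_set_def using z by (intro CollectI exI[of _ z]) simp
qed

text \<open>Write \<open>w = w1 w2\<close> with \<open>w2\<close> of fixed length \<open>N\<close>. Unless \<open>\<gamma>\<^sub>w\<^sub>2 z\<close> lies in the closed disk
  that \<open>w1\<close> cannot be applied to, ping-pong places \<open>\<gamma>\<^sub>w z\<close> into the right cylinder. In the exceptional case \<open>z\<close>
  would lie in the closed image of that disk under \<open>\<gamma>\<^sub>w\<^sub>2\<^sup>-\<^sup>1\<close>, which meets the real axis and has diameter less than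
  \<open>Im z\<close>.\<close>
lemma orbit_in_level:
  assumes z: "0 < Im z"
  shows "\<exists>N. \<forall>w\<in>words m. N \<le> length w \<longrightarrow> act w z \<in> level n"
proof -
  define e where "e = Im z / (K / \<kappa>\<^sup>2)"
  have e: "0 < e" using z K kappa by (simp add: e_def)
  obtain N where N: "\<And>w. w \<in> words m \<Longrightarrow> N \<le> length w \<Longrightarrow> scale w < e" using scale_small[OF e] by blast
  show ?thesis
  proof (intro exI[of _ "Suc n + N"] ballI impI)
    fix w assume w: "w \<in> words m" "Suc n + N \<le> length w"
    define w1 where "w1 = take (length w - N) w"
    define w2 where "w2 = drop (length w - N) w"
    have w12: "w1 @ w2 = w" "length w2 = N" "Suc n \<le> length w1" "w1 \<noteq> []"
      using w(2) by (auto simp: w1_def w2_def)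
    have ww: "w1 \<in> words m" "w2 \<in> words m" "follows m w1 w2" using w(1) w12(1) words_append_iff by auto
    have l1: "last w1 \<in> letters m" using ww(1) w12(4) words_letters last_in_set by blast
    define b where "b = bar m (last w1)"
    have b: "b \<in> letters m" using l1 bar_letters by (simp add: b_def)
    have notin: "act w2 z \<notin> closure (D b)"
    proof
      assume v: "act w2 z \<in> closure (D b)"
      define w3 where "w3 = bar_word m w2"
      have w3: "w3 \<in> words m" "length w3 = N" using bar_word_words[OF ww(2)] w12(2) by (auto simp: w3_def bar_word_def)
      have bn: "b \<in> nexts m w3"
      proof (cases "w2 = []")
        case True
        then show ?thesis using b by (simp add: w3_def bar_word_def)
      next
        case False
        have h: "hd w2 \<in> letters m" using False ww(2) words_letters hd_in_set by blast
        have "last w1 \<noteq> bar m (hd w2)" using ww(3) False w12(4) by (simp add: follows_def)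
        then have "b \<noteq> bar m (last w3)"
          using h l1 bar_bar bar_letters last_bar_word[OF False] unfolding b_def w3_def by metis
        then show ?thesis using nexts_iff[OF w3(1)] b False by (auto simp: w3_def bar_word_def)
      qed
      have "act w3 (act w2 z) = z"
        using moeb_mult[OF den_nonzero_of_Im[OF det_word[OF words_letters[OF ww(2)]]], of z "word_mat \<gamma> w3"] z
          word_mat_bar_word[OF words_letters[OF ww(2)]] by (simp add: w3_def)
      moreover have "cmod (act w3 (act w2 z) - act w3 (of_real (real_pt b))) \<le> scale w3 / \<kappa>\<^sup>2 * cmod (act w2 z - of_real (real_pt b))"
        using bilipschitz(2)[OF w3(1) bn v bn D_closure[OF real_pt[OF b]]] .
      moreover have "\<dots> \<le> scale w3 / \<kappa>\<^sup>2 * K"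
        using bounded_D[OF b b v D_closure[OF real_pt[OF b]]] scale_pos[OF w3(1)] by (intro mult_left_mono) auto
      moreover have "scale w3 * (K / \<kappa>\<^sup>2) < e * (K / \<kappa>\<^sup>2)"
        using N[OF w3(1)] w3(2) K kappa by (intro mult_strict_right_mono) auto
      moreover have "e * (K / \<kappa>\<^sup>2) = Im z" using K kappa by (simp add: e_def)
      ultimately have "cmod (z - act w3 (of_real (real_pt b))) < Im z" by simp
      moreover have "Im (act w3 (of_real (real_pt b))) = 0"
        using moeb_real[OF w3(1) bn D_closure[OF real_pt[OF b]]] by (metis Im_complex_of_real)
      ultimately show False using abs_Im_le_cmod[of "z - act w3 (of_real (real_pt b))"] by simp
    qed
    define t where "t = take n w1"
    define s where "s = drop n w1"
    have ts: "t @ s = w1" "length t = n" "s \<noteq> []" "last s = last w1"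
      using w12(3) by (auto simp: t_def s_def last_drop)
    have tsw: "t \<in> words m" "s \<in> words m" "hd s \<in> nexts m t"
      using ww(1) ts words_append_iff hd_nexts[of t s m] by auto
    have sv: "act s (act w2 z) \<in> D (hd s)"
      using moeb_word[OF tsw(2) ts(3)] notin ts(4) by (simp add: b_def)
    have "word_mat \<gamma> w = word_mat \<gamma> t ** word_mat \<gamma> (s @ w2)"
      using w12(1) ts(1) by (metis append.assoc word_mat_append)
    moreover have sw2: "set (s @ w2) \<subseteq> letters m" using tsw(2) ww(2) words_letters by auto
    ultimately have "act w z = act t (act (s @ w2) z)"
      using moeb_mult[OF den_nonzero_of_Im[OF det_word[OF sw2]], of z "word_mat \<gamma> t"] z by simp
    also have "act (s @ w2) z = act s (act w2 z)"
      using moeb_mult[OF den_nonzero_of_Im[OF det_word[OF words_letters[OF ww(2)]]], of z "word_mat \<gamma> s"] z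
      by (simp add: word_mat_append)
    finally have "act w z \<in> cyl t" using sv tsw(3) by (auto simp: cyl_def)
    then show "act w z \<in> level n" using cyl_level[OF tsw(1)] ts(2) by blast
  qed
qed

text \<open>All but finitely many points of an orbit lie in the compact level \<open>n\<close>.\<close>
lemma limit_set_subset_limset: "limit_set m \<gamma> \<subseteq> limset"
proof
  fix x assume "x \<in> limit_set m \<gamma>"
  then obtain z where z: "0 < Im z" "complex_of_real x islimpt ((\<lambda>A. moeb A z) ` schottky_group m \<gamma>)"
    by (auto simp: limit_set_def)
  have "complex_of_real x \<in> level n" for n
  proof -
    obtain N where N: "\<And>w. w \<in> words m \<Longrightarrow> N \<le> length w \<Longrightarrow> act w z \<in> level n"
      using orbit_in_level[OF z(1)] by blast
    let ?F = "(\<lambda>w. act w z) ` (\<Union>k<N. {w \<in> words m. length w = k})"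
    have "(\<lambda>A. moeb A z) ` schottky_group m \<gamma> \<subseteq> ?F \<union> level n"
    proof
      fix y assume "y \<in> (\<lambda>A. moeb A z) ` schottky_group m \<gamma>"
      then obtain w where w: "w \<in> words m" "y = act w z" using group_word_mat by blast
      show "y \<in> ?F \<union> level n"
      proof (cases "N \<le> length w")
        case True
        then show ?thesis using N[OF w(1)] w(2) by simp
      next
        case False
        then show ?thesis using w by auto
      qed
    qed
    then have "complex_of_real x islimpt (?F \<union> level n)" using z(2) islimpt_subset by blast
    moreover have "finite ?F" using finite_words_length by (intro finite_imageI finite_UN_I) auto
    ultimately have "complex_of_real x islimpt level n"
      using islimpt_Un islimpt_finite by blast
    then show ?thesis using compact_imp_closed[OF compact_level] closed_limpt by blast
  qed
  then show "x \<in> limset" by (simp add: limset_level)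
qed

lemma limit_set_eq: "limit_set m \<gamma> = limset"
  using limit_set_subset_limset limset_subset_limit_set by blast

section \<open>Self-similarity of the limit set\<close>

text \<open>The longest word whose cylinder contains \<open>S\<close>: then \<open>S\<close> meets two of the next subcylinders, so
  its diameter is comparable to \<open>scale w\<close>.\<close>
lemma splitting_cylinder:
  assumes S: "S \<subseteq> limset" and yz: "y \<in> S" "z \<in> S" "y \<noteq> z"
  obtains w a b where "w \<in> words m" "of_real ` S \<subseteq> cyl w" "a \<in> nexts m w" "b \<in> nexts m w" "a \<noteq> b"
    "\<exists>y\<in>S. complex_of_real y \<in> act w ` D a" "\<exists>z\<in>S. complex_of_real z \<in> act w ` D b"
proof -
  define P where "P k \<longleftrightarrow> (\<exists>w\<in>words m. length w = k \<and> complex_of_real ` S \<subseteq> cyl w)" for k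
  define e where "e = \<bar>y - z\<bar> / (K / \<kappa>\<^sup>2)"
  have e: "0 < e" using yz(3) K kappa by (simp add: e_def)
  obtain n where n: "\<And>w. w \<in> words m \<Longrightarrow> n \<le> length w \<Longrightarrow> scale w < e" using scale_small[OF e] by blast
  have "\<not> P n"
  proof
    assume "P n"
    then obtain w where w: "w \<in> words m" "length w = n" "complex_of_real ` S \<subseteq> cyl w" by (auto simp: P_def)
    have "cmod (complex_of_real y - complex_of_real z) \<le> scale w * (K / \<kappa>\<^sup>2)"
      using cyl_diameter[OF w(1)] w(3) yz by blast
    also have "\<dots> < e * (K / \<kappa>\<^sup>2)" using n[OF w(1)] w(2) K kappa by (intro mult_strict_right_mono) auto
    also have "\<dots> = \<bar>y - z\<bar>" using K kappa by (simp add: e_def)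
    finally show False by (simp flip: of_real_diff)
  qed
  have "P 0"
  proof -
    have "complex_of_real ` S \<subseteq> cyl []" using S limset_letter by (fastforce simp: cyl_def)
    then show ?thesis by (auto simp: P_def)
  qed
  with \<open>\<not> P n\<close> obtain k where k: "P k" "\<not> P (Suc k)" by (induction n) auto
  obtain w where w: "w \<in> words m" "length w = k" "complex_of_real ` S \<subseteq> cyl w" using k(1) by (auto simp: P_def)
  have "\<forall>x\<in>S. \<exists>b. w @ [b] \<in> words m \<and> complex_of_real x \<in> cyl (w @ [b])"
  proof
    fix x assume x: "x \<in> S"
    obtain v where "w @ v \<in> words m" "length v = 1" "complex_of_real x \<in> cyl (w @ v)"
      using limset_cyl_extends[OF _ w(1), of x 1] x S w(3) by blast
    then show "\<exists>b. w @ [b] \<in> words m \<and> complex_of_real x \<in> cyl (w @ [b])"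
      by (metis One_nat_def length_0_conv length_Suc_conv)
  qed
  then obtain f where f: "\<And>x. x \<in> S \<Longrightarrow> w @ [f x] \<in> words m \<and> complex_of_real x \<in> cyl (w @ [f x])" by metis
  have in_act: "f x \<in> nexts m w \<and> complex_of_real x \<in> act w ` D (f x)" if x: "x \<in> S" for x
  proof -
    obtain b u where u: "b \<in> nexts m w" "u \<in> D b" "u \<in> cyl [f x]" "complex_of_real x = act w u"
      using cyl_append_inner[of w "[f x]" "of_real x"] f[OF x] by blast
    have fx: "f x \<in> nexts m w" using f[OF x] words_snoc_iff by blast
    have "u \<in> D (f x)" using cyl_hd[of "[f x]"] u(3) nexts_letters[OF fx] by auto
    then show ?thesis using u(4) fx by blast
  qed
  have "\<exists>x\<in>S. f x \<noteq> f y"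
  proof (rule ccontr)
    assume "\<not> ?thesis"
    then have "complex_of_real ` S \<subseteq> cyl (w @ [f y])" using f by auto
    then have "P (Suc k)" using f[OF yz(1)] w(2) by (auto simp: P_def intro!: bexI[of _ "w @ [f y]"])
    then show False using k(2) by simp
  qed
  then obtain x where x: "x \<in> S" "f x \<noteq> f y" by blast
  show thesis
    using that[OF w(1,3), of "f x" "f y"] in_act[OF x(1)] in_act[OF yz(1)] x yz(1) by blast
qed

text \<open>The inverse of \<open>\<gamma>\<^sub>w\<close> for the word \<open>w\<close> of \<open>splitting_cylinder\<close>.\<close>
lemma limset_blow_up:
  assumes S: "S \<subseteq> limset" and r: "0 < r" and diam: "\<And>y z. y \<in> S \<Longrightarrow> z \<in> S \<Longrightarrow> \<bar>y - z\<bar> \<le> r"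
  shows "\<exists>g. g ` S \<subseteq> limset \<and> (\<forall>y\<in>S. \<forall>z\<in>S. (\<kappa>^3 / K\<^sup>2) / r * \<bar>y - z\<bar> \<le> \<bar>g y - g z\<bar>)"
proof (cases "\<exists>y\<in>S. \<exists>z\<in>S. y \<noteq> z")
  case False
  then show ?thesis using S by (intro exI[of _ id]) auto
next
  case True
  then obtain y0 z0 where "y0 \<in> S" "z0 \<in> S" "y0 \<noteq> z0" by blast
  then obtain w a b where w: "w \<in> words m" "of_real ` S \<subseteq> cyl w" "a \<in> nexts m w" "b \<in> nexts m w" "a \<noteq> b"
    "\<exists>y\<in>S. complex_of_real y \<in> act w ` D a" "\<exists>z\<in>S. complex_of_real z \<in> act w ` D b"
    using splitting_cylinder[OF S] by metis
  have "\<forall>y\<in>S. \<exists>x. x \<in> limset \<and> (\<exists>b\<in>nexts m w. complex_of_real x \<in> D b \<and> act w (of_real x) = of_real y)"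
    using limset_backward[OF _ w(1)] S w(2) by blast
  then obtain g where g: "\<And>y. y \<in> S \<Longrightarrow> g y \<in> limset"
    "\<And>y. y \<in> S \<Longrightarrow> \<exists>b\<in>nexts m w. complex_of_real (g y) \<in> D b \<and> act w (of_real (g y)) = of_real y"
    by metis
  obtain y z y' z' where y: "y \<in> S" "y' \<in> D a" "complex_of_real y = act w y'"
    and z: "z \<in> S" "z' \<in> D b" "complex_of_real z = act w z'" using w(6,7) by blast
  have "scale w * (\<kappa> / K\<^sup>2) \<le> cmod (complex_of_real y - complex_of_real z)"
    using cyl_gap[OF w(1,3) y(2) w(4) z(2) w(5)] y(3) z(3) by simp
  also have "\<dots> \<le> r" using diam[OF y(1) z(1)] by (simp flip: of_real_diff)
  finally have sr: "scale w * (\<kappa> / K\<^sup>2) \<le> r" .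
  have "\<kappa>^3 / K\<^sup>2 / r * \<bar>u - v\<bar> \<le> \<bar>g u - g v\<bar>" if uv: "u \<in> S" "v \<in> S" for u v
  proof -
    obtain c d where c: "c \<in> nexts m w" "complex_of_real (g u) \<in> D c" "act w (of_real (g u)) = of_real u"
      and d: "d \<in> nexts m w" "complex_of_real (g v) \<in> D d" "act w (of_real (g v)) = of_real v"
      using g(2) uv by metis
    have "cmod (complex_of_real u - complex_of_real v) \<le> scale w / \<kappa>\<^sup>2 * cmod (complex_of_real (g u) - complex_of_real (g v))"
      using bilipschitz(2)[OF w(1) c(1) D_closure[OF c(2)] d(1) D_closure[OF d(2)]] c(3) d(3) by simp
    then have 1: "\<bar>u - v\<bar> \<le> scale w / \<kappa>\<^sup>2 * \<bar>g u - g v\<bar>" by (simp flip: of_real_diff)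
    have "\<kappa>^3 / K\<^sup>2 / r * \<bar>u - v\<bar> \<le> \<kappa>^3 / K\<^sup>2 / r * (scale w / \<kappa>\<^sup>2 * \<bar>g u - g v\<bar>)"
      using 1 kappa r by (intro mult_left_mono) auto
    also have "\<dots> = (scale w * (\<kappa> / K\<^sup>2)) / r * \<bar>g u - g v\<bar>"
      using kappa by (simp add: power2_eq_square power3_eq_cube mult_ac)
    also have "\<dots> \<le> 1 * \<bar>g u - g v\<bar>"
    proof (rule mult_right_mono)
      show "scale w * (\<kappa> / K\<^sup>2) / r \<le> 1" using sr r by (simp only: divide_le_eq_1_pos)
    qed simp
    finally show ?thesis by simp
  qed
  then show ?thesis using g(1) by blast
qed

text \<open>The shortest word \<open>w\<close> whose cylinder contains \<open>x\<close> and has diameter less than \<open>r\<close> has scale comparable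
  to \<open>r\<close>. One more letter \<open>b\<close> is inserted to make \<open>w @ [b]\<close> applicable to \<open>D c\<close>.\<close>
lemma limset_blow_down:
  assumes x: "x \<in> limset" and r: "0 < r" "r \<le> 1" and c: "c \<in> letters m"
  shows "\<exists>g. g ` {y \<in> limset. complex_of_real y \<in> D c} \<subseteq> limset \<inter> ball x r \<and>
    (\<forall>y\<in>{y \<in> limset. complex_of_real y \<in> D c}. \<forall>z\<in>{y \<in> limset. complex_of_real y \<in> D c}.
      (\<kappa>\<^sup>2 / (K^3 * (M * K)^4)) * r * \<bar>y - z\<bar> \<le> \<bar>g y - g z\<bar>)"
proof -
  define R where "R = (M * K)\<^sup>2"
  have "1 * 1 \<le> M * K" using M K by (intro mult_mono) auto
  then have R: "1 \<le> R" by (simp add: R_def)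
  define P where "P n \<longleftrightarrow> (\<exists>w\<in>words m. length w = n \<and> complex_of_real x \<in> cyl w \<and> scale w * (K / \<kappa>\<^sup>2) < r)" for n
  have "0 < r / (K / \<kappa>\<^sup>2)" using r K kappa by simp
  then obtain n where n: "\<And>w. w \<in> words m \<Longrightarrow> n \<le> length w \<Longrightarrow> scale w < r / (K / \<kappa>\<^sup>2)" using scale_small by blast
  obtain w0 where w0: "w0 \<in> words m" "length w0 = n" "complex_of_real x \<in> cyl w0" using limset_cyl[OF x] .
  have "scale w0 * (K / \<kappa>\<^sup>2) < r" 
  proof -
    have "0 < K / \<kappa>\<^sup>2" using K kappa by simp
    then show ?thesis using n[OF w0(1)] w0(2) by (simp only: pos_less_divide_eq order_refl)
  qed
  then have "P n" using w0 by (auto simp: P_def)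
  then obtain k where k: "P k" "\<And>j. j < k \<Longrightarrow> \<not> P j" using exists_least_iff[of P] by blast
  obtain w where w: "w \<in> words m" "length w = k" "complex_of_real x \<in> cyl w" "scale w * (K / \<kappa>\<^sup>2) < r"
    using k(1) by (auto simp: P_def)
  have big: "r * (\<kappa>\<^sup>2 / K) \<le> R * scale w"
  proof (cases k)
    case 0
    have "r * (\<kappa>\<^sup>2 / K) \<le> 1 * 1"
      using r kappa K power_mono[OF kappa(2), of 2] by (intro mult_mono) (auto simp: divide_simps)
    then show ?thesis using 0 w(2) R by (simp add: scale_def)
  next
    case (Suc j)
    obtain v b where v: "w = v @ [b]"
      using w(2) Suc by (metis append_butlast_last_id list.size(3) nat.distinct(1))
    have vb: "v \<in> words m" "b \<in> nexts m v" using w(1) v words_snoc_iff by auto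
    have "complex_of_real x \<in> cyl v" using w(1,3) v cyl_append by blast
    moreover have "\<not> P j" "length v = j" using k(2) Suc w(2) v by auto
    ultimately have "r \<le> scale v * (K / \<kappa>\<^sup>2)" using vb(1) unfolding P_def by force
    then have "r * (\<kappa>\<^sup>2 / K) \<le> scale v" using K kappa by (simp add: field_simps)
    then show ?thesis using scale_snoc[OF vb] v by (simp add: R_def)
  qed
  obtain b where b: "b \<in> nexts m w" "b \<noteq> bar m c" using ex_next[OF w(1)] by blast
  define v where "v = w @ [b]"
  have v: "v \<in> words m" using w(1) b(1) words_snoc_iff by (simp add: v_def)
  have cv: "c \<in> nexts m v" using c b(2) by (simp add: v_def nexts_def follows_def)
  have "r * (\<kappa>\<^sup>2 / K) \<le> R * (R * scale v)"
    using big scale_snoc[OF w(1) b(1)] R unfolding R_def[symmetric] v_def[symmetric]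
    by (meson mult_left_mono order_trans zero_le_one)
  then have *: "r * (\<kappa>\<^sup>2 / K) / (R * R) / K\<^sup>2 \<le> R * (R * scale v) / (R * R) / K\<^sup>2"
    using R by (intro divide_right_mono) auto
  have low: "\<kappa>\<^sup>2 / (K^3 * (M * K)^4) * r \<le> scale v / K\<^sup>2"
  proof -
    have "R * (R * scale v) / (R * R) = scale v" using R by simp
    moreover have "r * (\<kappa>\<^sup>2 / K) / (R * R) / K\<^sup>2 = \<kappa>\<^sup>2 / (K^3 * (M * K)^4) * r"
      by (simp add: R_def power2_eq_square power3_eq_cube power4_eq_xxxx mult_ac)
    ultimately show ?thesis using * by simp
  qed
  define g where "g y = Re (act v (of_real y))" for y
  have g: "g y \<in> limset" "complex_of_real (g y) = act v (of_real y)" "act v (of_real y) \<in> cyl v"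
    if "y \<in> limset" "complex_of_real y \<in> D c" for y
    using limset_forward[OF that(1) v cv that(2)] by (auto simp: g_def)
  have "g y \<in> ball x r" if y: "y \<in> limset" "complex_of_real y \<in> D c" for y
  proof -
    have "complex_of_real (g y) \<in> cyl w" using g[OF y] cyl_append[of w "[b]"] v by (auto simp: v_def)
    then have "cmod (complex_of_real x - complex_of_real (g y)) \<le> scale w * (K / \<kappa>\<^sup>2)"
      using cyl_diameter[OF w(1,3)] by blast
    then show ?thesis using w(4) by (simp add: dist_real_def flip: of_real_diff)
  qed
  moreover have "\<kappa>\<^sup>2 / (K^3 * (M * K)^4) * r * \<bar>y - z\<bar> \<le> \<bar>g y - g z\<bar>"
    if y: "y \<in> limset" "complex_of_real y \<in> D c" and z: "z \<in> limset" "complex_of_real z \<in> D c" for y z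
  proof -
    have "\<kappa>\<^sup>2 / (K^3 * (M * K)^4) * r * \<bar>y - z\<bar> \<le> scale v / K\<^sup>2 * \<bar>y - z\<bar>"
      using low by (intro mult_right_mono) auto
    also have "\<dots> = scale v / K\<^sup>2 * cmod (complex_of_real y - complex_of_real z)" by (simp flip: of_real_diff)
    also have "\<dots> \<le> cmod (complex_of_real (g y) - complex_of_real (g z))"
      using bilipschitz(1)[OF v cv D_closure[OF y(2)] cv D_closure[OF z(2)]] g(2)[OF y] g(2)[OF z] by simp
    finally show ?thesis by (simp flip: of_real_diff)
  qed
  ultimately show ?thesis using g(1) by (intro exI[of _ g]) auto
qed

lemma limset_self_similar:
  obtains a where "quasi_self_similar limset (\<lambda>c. {x \<in> limset. complex_of_real x \<in> D c}) (letters m) a"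
proof -
  define a1 where "a1 = \<kappa>^3 / K\<^sup>2"
  define a2 where "a2 = \<kappa>\<^sup>2 / (K^3 * (M * K)^4)"
  define a where "a = min (1 / 3) (min a1 a2)"
  have a: "0 < a" "a \<le> 1 / 3" "a \<le> a1" "a \<le> a2"
  proof -
    have "0 < a1" "0 < a2" using kappa K M by (auto simp: a1_def a2_def)
    then show "0 < a" "a \<le> 1 / 3" "a \<le> a1" "a \<le> a2" unfolding a_def by linarith+
  qed
  have "quasi_self_similar limset (\<lambda>c. {x \<in> limset. complex_of_real x \<in> D c}) (letters m) a"
  proof unfold_locales
    show "compact limset" by (rule compact_limset)
    show "0 < a" "a \<le> 1 / 3" by (rule a(1), rule a(2))
    show "finite (letters m)" by simp
    show "limset \<subseteq> (\<Union>i\<in>letters m. {x \<in> limset. complex_of_real x \<in> D i})" using limset_letter by blast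
  next
    fix S and r :: real assume S: "S \<subseteq> limset" "0 < r" "\<And>y z. y \<in> S \<Longrightarrow> z \<in> S \<Longrightarrow> \<bar>y - z\<bar> \<le> r"
    obtain g where g: "g ` S \<subseteq> limset" "\<forall>y\<in>S. \<forall>z\<in>S. a1 / r * \<bar>y - z\<bar> \<le> \<bar>g y - g z\<bar>"
      using limset_blow_up[OF S] unfolding a1_def by blast
    have "a / r * \<bar>y - z\<bar> \<le> a1 / r * \<bar>y - z\<bar>" for y z
      using a(3) S(2) by (intro mult_right_mono divide_right_mono) auto
    then show "\<exists>g. g ` S \<subseteq> limset \<and> (\<forall>y\<in>S. \<forall>z\<in>S. a / r * \<bar>y - z\<bar> \<le> \<bar>g y - g z\<bar>)"
      using g by (meson order_trans)
  next
    fix x r :: real and c assume x: "x \<in> limset" "0 < r" "r \<le> 1" "c \<in> letters m"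
    let ?F = "{x \<in> limset. complex_of_real x \<in> D c}"
    obtain g where g: "g ` ?F \<subseteq> limset \<inter> ball x r" "\<forall>y\<in>?F. \<forall>z\<in>?F. a2 * r * \<bar>y - z\<bar> \<le> \<bar>g y - g z\<bar>"
      using limset_blow_down[OF x] unfolding a2_def by blast
    have "a * r * \<bar>y - z\<bar> \<le> a2 * r * \<bar>y - z\<bar>" for y z
      using a(4) x(2) by (intro mult_right_mono) auto
    then show "\<exists>g. g ` ?F \<subseteq> limset \<inter> ball x r \<and> (\<forall>y\<in>?F. \<forall>z\<in>?F. a * r * \<bar>y - z\<bar> \<le> \<bar>g y - g z\<bar>)"
      using g by (meson order_trans)
  qed
  then show thesis by (rule that)
qed

text \<open>The pieces of the limit set in the two or more subcylinders of \<open>splitting_cylinder\<close> are separated by a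
  multiple of their joint diameter. Intervals of radius \<open>h\<close> around them form one connected component, so
  this separation is less than \<open>2 h\<close>.\<close>
lemma component_of_nbhd:
  assumes h: "0 < h" and comp: "ball c r \<in> components (\<Union>x\<in>limset. ball x h)"
  shows "0 < r" "r \<le> (1 + K^3 / \<kappa>^3) * h" "\<exists>x\<in>limset. \<bar>x - c\<bar> < r"
proof -
  define U where "U = (\<Union>x\<in>limset. ball x h)"
  define S where "S = {x \<in> limset. x \<in> ball c r}"
  have comp: "ball c r \<in> components U" using comp by (simp add: U_def)
  have ne: "ball c r \<noteq> {}" using in_components_nonempty[OF comp] .
  then show r: "0 < r" by simp
  have absorb: "x \<in> ball c r \<and> ball x h \<subseteq> ball c r" if "x \<in> limset" "y \<in> ball c r" "\<bar>x - y\<bar> < h" for x y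
  proof -
    have "ball x h \<subseteq> ball c r"
    proof (rule components_maximal[OF comp])
      show "connected (ball x h)" by simp
      show "ball x h \<subseteq> U" using that(1) by (auto simp: U_def)
      show "ball c r \<inter> ball x h \<noteq> {}" using that(2,3) by (auto simp: dist_real_def)
    qed
    moreover have "x \<in> ball x h" using h by simp
    ultimately show ?thesis by blast
  qed
  have near: "\<exists>x\<in>S. \<bar>x - y\<bar> < h" if y: "y \<in> ball c r" for y
  proof -
    have "y \<in> U" using in_components_subset[OF comp] y by blast
    then obtain x where "x \<in> limset" "\<bar>x - y\<bar> < h" by (auto simp: U_def dist_real_def)
    then show ?thesis using absorb[OF _ y] by (auto simp: S_def)
  qed
  show "\<exists>x\<in>limset. \<bar>x - c\<bar> < r"
    using near[of c] r by (auto simp: S_def dist_real_def abs_minus_commute)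
  define B where "B = 2 * h * (1 + K^3 / \<kappa>^3)"
  have diamS: "\<bar>x - y\<bar> \<le> 2 * h * (K^3 / \<kappa>^3)" if xy: "x \<in> S" "y \<in> S" for x y
  proof (cases "x = y")
    case True
    then show ?thesis using h K kappa by simp
  next
    case False
    have "S \<subseteq> limset" by (auto simp: S_def)
    then obtain w a b where w: "w \<in> words m" "of_real ` S \<subseteq> cyl w" "a \<in> nexts m w" "b \<in> nexts m w" "a \<noteq> b"
      "\<exists>y\<in>S. complex_of_real y \<in> act w ` D a" "\<exists>z\<in>S. complex_of_real z \<in> act w ` D b"
      using splitting_cylinder[OF _ xy False] by metis
    define S1 where "S1 = {y \<in> S. complex_of_real y \<in> act w ` D a}"
    define S2 where "S2 = S - S1"
    have gap: "scale w * (\<kappa> / K\<^sup>2) \<le> \<bar>u - v\<bar>" if uv: "u \<in> S1" "v \<in> S2" for u v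
    proof -
      obtain u' where u': "u' \<in> D a" "complex_of_real u = act w u'" using uv(1) by (auto simp: S1_def)
      have "complex_of_real v \<in> cyl w" using uv(2) w(2) by (auto simp: S2_def)
      then obtain d v' where v': "d \<in> nexts m w" "v' \<in> D d" "complex_of_real v = act w v'" by (auto simp: cyl_def)
      have "d \<noteq> a" using uv(2) v' by (auto simp: S1_def S2_def)
      then have "scale w * (\<kappa> / K\<^sup>2) \<le> cmod (complex_of_real u - complex_of_real v)"
        using cyl_gap[OF w(1,3) u'(1) v'(1,2)] u'(2) v'(3) by simp
      then show ?thesis by (simp flip: of_real_diff)
    qed
    obtain p where p: "p \<in> S" "complex_of_real p \<in> act w ` D b" using w(7) by blast
    have "p \<notin> S1"
    proof
      assume "p \<in> S1"
      then have "complex_of_real p \<in> act w ` D a" by (simp add: S1_def)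
      then obtain u v where uv: "u \<in> D a" "v \<in> D b" "act w u = act w v" using p(2) by fastforce
      then have "scale w * (\<kappa> / K\<^sup>2) \<le> 0" using cyl_gap[OF w(1,3) uv(1) w(4) uv(2) w(5)] by simp
      moreover have "0 < scale w * (\<kappa> / K\<^sup>2)" using scale_pos[OF w(1)] kappa K by simp
      ultimately show False by linarith
    qed
    then have pS2: "p \<in> S2" using p(1) by (simp add: S2_def)
    obtain q where q: "q \<in> S1" using w(6) by (auto simp: S1_def)
    have "\<exists>u\<in>S1. \<exists>v\<in>S2. \<bar>u - v\<bar> < 2 * h"
    proof (rule ccontr)
      assume far: "\<not> ?thesis"
      let ?A = "\<Union>u\<in>S1. ball u h" and ?B = "\<Union>v\<in>S2. ball v h"
      have disj: "?A \<inter> ?B = {}"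
      proof (rule ccontr)
        assume "?A \<inter> ?B \<noteq> {}"
        then obtain t u v where "u \<in> S1" "v \<in> S2" "\<bar>u - t\<bar> < h" "\<bar>v - t\<bar> < h" by (auto simp: dist_real_def)
        moreover then have "\<bar>u - v\<bar> < 2 * h" by linarith
        ultimately show False using far by blast
      qed
      have "ball c r \<subseteq> ?A \<union> ?B"
      proof
        fix t assume "t \<in> ball c r"
        then obtain x where "x \<in> S" "\<bar>x - t\<bar> < h" using near by blast
        then show "t \<in> ?A \<union> ?B" by (cases "x \<in> S1") (auto simp: S2_def dist_real_def)
      qed
      moreover have "open ?A" "open ?B" by auto
      moreover have "q \<in> ?A \<inter> ball c r" using q h by (auto simp: S1_def S_def)
      moreover have "p \<in> ?B \<inter> ball c r"
      proof (rule IntI)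
        show "p \<in> ?B" by (rule UN_I[OF pS2]) (use h in simp)
        show "p \<in> ball c r" using p(1) by (simp add: S_def)
      qed
      moreover have "connected (ball c r)" by simp
      ultimately show False
        using connectedD[of "ball c r" ?A ?B] disj by blast
    qed
    then obtain u v where "u \<in> S1" "v \<in> S2" "\<bar>u - v\<bar> < 2 * h" by blast
    then have "scale w * (\<kappa> / K\<^sup>2) \<le> 2 * h" using gap by (meson less_imp_le order_trans)
    then have "scale w * (\<kappa> / K\<^sup>2) * (K^3 / \<kappa>^3) \<le> 2 * h * (K^3 / \<kappa>^3)"
      using K kappa by (intro mult_right_mono) auto
    moreover have "\<kappa> / K\<^sup>2 * (K^3 / \<kappa>^3) = K / \<kappa>\<^sup>2"
      using K kappa by (simp add: power2_eq_square power3_eq_cube)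
    moreover have "cmod (complex_of_real x - complex_of_real y) \<le> scale w * (K / \<kappa>\<^sup>2)"
      using cyl_diameter[OF w(1)] w(2) xy by blast
    ultimately have "cmod (complex_of_real x - complex_of_real y) \<le> 2 * h * (K^3 / \<kappa>^3)"
      unfolding mult.assoc by (metis order_trans)
    then show ?thesis by (simp flip: of_real_diff)
  qed
  have "2 * r \<le> B"
  proof (rule field_le_epsilon)
    fix e :: real assume e: "0 < e"
    define s where "s = max 0 (r - e / 2)"
    have s: "0 \<le> s" "s < r" "2 * r \<le> 2 * s + e" using e r by (auto simp: s_def max_def)
    have "c - s \<in> ball c r" "c + s \<in> ball c r" using s by (auto simp: dist_real_def)
    then obtain x y where x: "x \<in> S" "\<bar>x - (c - s)\<bar> < h" and y: "y \<in> S" "\<bar>y - (c + s)\<bar> < h" using near by meson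
    have "2 * s \<le> 2 * h + \<bar>x - y\<bar>" using x(2) y(2) by linarith
    also have "\<dots> \<le> B" using diamS[OF x(1) y(1)] by (simp add: B_def algebra_simps)
    finally show "2 * r \<le> B + e" using s(3) by linarith
  qed
  then have "2 * r \<le> 2 * ((1 + K^3 / \<kappa>^3) * h)" by (simp only: B_def mult_ac)
  then show "r \<le> (1 + K^3 / \<kappa>^3) * h" by simp
qed

end

section \<open>Area of the refined domain\<close>

lemma ex_maximal_sep:
  assumes "\<And>X. X \<subseteq> S \<Longrightarrow> sep t X \<Longrightarrow> real (card X) \<le> N" "0 < t"
  shows "\<exists>X\<subseteq>S. sep t X \<and> (\<forall>s\<in>S. \<exists>x\<in>X. \<bar>s - x\<bar> < t)"
proof -
  let ?P = "\<lambda>X. X \<subseteq> S \<and> sep t X"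
  have "?P {}" by (simp add: sep_def)
  moreover have "\<forall>X. ?P X \<longrightarrow> card X < Suc (nat \<lfloor>N\<rfloor>)"
  proof (intro allI impI)
    fix X assume "?P X"
    then have "real (card X) \<le> N" using assms(1) by blast
    then show "card X < Suc (nat \<lfloor>N\<rfloor>)" by linarith
  qed
  ultimately obtain X where X: "?P X" "\<And>Y. ?P Y \<Longrightarrow> card Y \<le> card X"
    using ex_has_greatest_nat[of ?P "{}" card "Suc (nat \<lfloor>N\<rfloor>)"] by blast
  have "\<exists>x\<in>X. \<bar>s - x\<bar> < t" if s: "s \<in> S" for s
  proof (rule ccontr)
    assume no: "\<not> ?thesis"
    then have far: "t \<le> \<bar>s - x\<bar>" if "x \<in> X" for x using that by force
    have "s \<notin> X" using far[of s] assms(2) by auto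
    moreover have "sep t (insert s X)"
      unfolding sep_def
    proof (intro conjI ballI impI)
      show "finite (insert s X)" using X(1) by (simp add: sep_def)
      fix x y assume "x \<in> insert s X" "y \<in> insert s X" "x \<noteq> y"
      then show "t \<le> \<bar>x - y\<bar>"
        using far[of x] far[of y] X(1) by (auto simp: sep_def abs_minus_commute)
    qed
    ultimately show False using X(2)[of "insert s X"] X(1) s sep_finite[of t X] by simp
  qed
  then show ?thesis using X(1) by blast
qed

lemma open_interval_is_ball:
  fixes S :: "real set"
  assumes "open S" "connected S" "bounded S" "S \<noteq> {}"
  shows "\<exists>c r. S = ball c r"
proof -
  have bdd: "bdd_below S" "bdd_above S"
    using assms(3) by (auto simp: bounded_imp_bdd_below bounded_imp_bdd_above)
  have "S = {Inf S<..<Sup S}"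
  proof
    show "S \<subseteq> {Inf S<..<Sup S}"
    proof
      fix x assume x: "x \<in> S"
      then obtain e where e: "0 < e" "ball x e \<subseteq> S" using assms(1) open_contains_ball by blast
      have "x - e / 2 \<in> ball x e" "x + e / 2 \<in> ball x e" using e(1) by (auto simp: dist_real_def)
      then have "x - e / 2 \<in> S" "x + e / 2 \<in> S" using e(2) by auto
      then have "Inf S \<le> x - e / 2" "x + e / 2 \<le> Sup S"
        using cInf_lower[OF _ bdd(1)] cSup_upper[OF _ bdd(2)] by auto
      then show "x \<in> {Inf S<..<Sup S}" using e(1) by auto
    qed
    show "{Inf S<..<Sup S} \<subseteq> S"
    proof
      fix x assume "x \<in> {Inf S<..<Sup S}"
      then obtain y z where "y \<in> S" "y < x" "z \<in> S" "x < z"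
        using cInf_lessD[OF assms(4)] less_cSupD[OF assms(4)] by (meson greaterThanLessThan_iff)
      then show "x \<in> S" using assms(2) unfolding is_interval_connected_1[symmetric] is_interval_1
        by (meson less_imp_le)
    qed
  qed
  also have "{Inf S<..<Sup S} = ball ((Inf S + Sup S) / 2) ((Sup S - Inf S) / 2)"
    by (rule greaterThanLessThan_eq_ball)
  finally show ?thesis by blast
qed

context schottky_geometry
begin

lemma limit_nbhd_eq: "limit_nbhd m \<gamma> h = (\<Union>x\<in>limset. ball x h)"
proof -
  have "(\<exists>x t. y = x + t \<and> x \<in> limset \<and> - h < t \<and> t < h) \<longleftrightarrow> (\<exists>x\<in>limset. \<bar>x - y\<bar> < h)" for y
  proof
    assume "\<exists>x\<in>limset. \<bar>x - y\<bar> < h"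
    then obtain x where "x \<in> limset" "\<bar>x - y\<bar> < h" by blast
    then show "\<exists>x t. y = x + t \<and> x \<in> limset \<and> - h < t \<and> t < h"
      by (intro exI[of _ x] exI[of _ "y - x"]) auto
  next
    assume "\<exists>x t. y = x + t \<and> x \<in> limset \<and> - h < t \<and> t < h"
    then obtain x t where "y = x + t" "x \<in> limset" "- h < t" "t < h" by blast
    then show "\<exists>x\<in>limset. \<bar>x - y\<bar> < h" by (intro bexI[of _ x]) auto
  qed
  then show ?thesis by (auto simp: limit_nbhd_def limit_set_eq dist_real_def)
qed

lemma real_trace_ball: "{x. complex_of_real x \<in> ball (complex_of_real c) r} = ball c r"
  by (auto simp: dist_norm simp flip: of_real_diff)

lemma Omega_near_limset:
  assumes h: "0 < h" and z: "z \<in> Omega_at m D \<gamma> b h"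
  shows "\<bar>Im z\<bar> \<le> (1 + K^3 / \<kappa>^3) * h"
    "\<exists>x\<in>limset. cmod (z - of_real x) \<le> 2 * (1 + K^3 / \<kappa>^3) * h"
proof -
  obtain c r where c: "z \<in> ball (complex_of_real c) r" "ball c r \<in> components (\<Union>x\<in>limset. ball x h)"
    using z unfolding Omega_at_def Omega_def real_trace_ball limit_nbhd_eq by blast
  note comp = component_of_nbhd[OF h c(2)]
  obtain x where x: "x \<in> limset" "\<bar>x - c\<bar> < r" using comp(3) by blast
  have zc: "cmod (z - of_real c) < r" using c(1) by (simp add: dist_norm norm_minus_commute)
  then show "\<bar>Im z\<bar> \<le> (1 + K^3 / \<kappa>^3) * h"
    using abs_Im_le_cmod[of "z - of_real c"] comp(2) by simp
  have "cmod (z - of_real x) \<le> cmod (z - of_real c) + cmod (of_real c - of_real x)"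
    using norm_triangle_ineq[of "z - of_real c" "of_real c - of_real x"] by simp
  also have "cmod (of_real c - of_real x) = \<bar>x - c\<bar>" by (simp flip: of_real_diff)
  finally have "cmod (z - of_real x) \<le> 2 * ((1 + K^3 / \<kappa>^3) * h)" using zc x(2) comp(2) by linarith
  then show "\<exists>x\<in>limset. cmod (z - of_real x) \<le> 2 * (1 + K^3 / \<kappa>^3) * h" using x(1) unfolding mult.assoc by blast
qed

text \<open>The supremum norm over the refined domain is then a supremum over a nonempty set.\<close>
lemma Omega_nonempty:
  assumes h: "0 < h" and b: "b \<in> letters m"
  shows "Omega_at m D \<gamma> b h \<noteq> {}"
proof -
  let ?U = "\<Union>x\<in>limset. ball x h"
  obtain x where x: "x \<in> limset" "complex_of_real x \<in> D b" using limset_meets_D[OF b] by blast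
  have xU: "x \<in> ?U" by (rule UN_I[OF x(1)]) (use h in simp)
  define S where "S = connected_component_set ?U x"
  have S: "S \<in> components ?U" "x \<in> S" using xU by (auto simp: S_def components_def)
  have "open S" unfolding S_def by (intro open_connected_component) auto
  moreover have "connected S" by (simp add: S_def)
  moreover have "bounded S"
  proof -
    obtain e where e: "\<And>x. x \<in> limset \<Longrightarrow> norm x \<le> e"
      using compact_imp_bounded[OF compact_limset] by (auto simp: bounded_iff)
    have "S \<subseteq> cball 0 (e + h)"
    proof
      fix y assume "y \<in> S"
      then obtain u where "u \<in> limset" "\<bar>u - y\<bar> < h"
        using in_components_subset[OF S(1)] by (auto simp: dist_real_def)
      then show "y \<in> cball 0 (e + h)" using e[of u] by auto
    qed
    then show ?thesis by (rule bounded_subset[OF bounded_cball])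
  qed
  ultimately obtain c r where "S = ball c r" using open_interval_is_ball S(2) by blast
  then have "complex_of_real x \<in> Omega m \<gamma> h"
  proof -
    have "complex_of_real x \<in> ball (complex_of_real c) r"
      using S(2) real_trace_ball[of c r] \<open>S = ball c r\<close> by blast
    then show ?thesis using S(1) \<open>S = ball c r\<close>
      unfolding Omega_def real_trace_ball limit_nbhd_eq by blast
  qed
  then show ?thesis using x(2) by (auto simp: Omega_at_def)
qed

lemma open_Omega_at: "b \<in> letters m \<Longrightarrow> open (Omega_at m D \<gamma> b h)"
  unfolding Omega_at_def Omega_def using open_D by (intro open_Int open_Union) auto

text \<open>A maximal \<open>h\<close>-separated set of limit points near \<open>Y\<close> has \<open>O((\<rho> / h) powr \<delta>)\<close> elements, and squares of
  side \<open>O(h)\<close> around them cover \<open>Y\<close>.\<close>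
lemma area_bound:
  "\<exists>C>0. \<forall>h>0. \<forall>\<rho>\<ge>h. \<forall>b Y. Y \<subseteq> Omega_at m D \<gamma> b h \<longrightarrow> (\<forall>y\<in>Y. \<forall>z\<in>Y. \<bar>Re y - Re z\<bar> \<le> \<rho>) \<longrightarrow>
    (\<exists>A\<in>sets lborel. Y \<subseteq> A \<and> emeasure lborel A \<le> ennreal (C * h\<^sup>2 * (\<rho> / h) powr hausdorff_dim limset))"
proof -
  let ?d = "hausdorff_dim limset"
  obtain a where "quasi_self_similar limset (\<lambda>c. {x \<in> limset. complex_of_real x \<in> D c}) (letters m) a"
    by (rule limset_self_similar)
  then interpret S: quasi_self_similar limset "\<lambda>c. {x \<in> limset. complex_of_real x \<in> D c}" "letters m" a .
  obtain C where C: "0 < C" "\<And>t r X. 0 < t \<Longrightarrow> t \<le> r \<Longrightarrow> X \<subseteq> limset \<Longrightarrow> sep t X \<Longrightarrow>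
      (\<forall>y\<in>X. \<forall>z\<in>X. \<bar>y - z\<bar> \<le> r) \<Longrightarrow> card X \<le> C * (r / t) powr ?d"
    using S.local_packing_bound by blast
  define B where "B = 1 + K^3 / \<kappa>^3"
  have B: "1 \<le> B" using K kappa by (simp add: B_def)
  \<comment> \<open>A point of \<open>Y\<close> is at most \<open>2 B h\<close> away from its limit point, which is less than \<open>h\<close> away from the separated
    set.\<close>
  define R where "R = 1 + 2 * B"
  define C' where "C' = C * (1 + 4 * B) powr ?d * (2 * R)\<^sup>2"
  have C': "0 < C'" using C(1) B by (simp add: C'_def R_def)
  show ?thesis
  proof (intro exI[of _ C'] conjI C' allI impI)
    fix h \<rho> b Y
    assume h: "0 < (h::real)" and \<rho>: "h \<le> \<rho>" and Y: "Y \<subseteq> Omega_at m D \<gamma> b h"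
      and diam: "\<forall>y\<in>Y. \<forall>z\<in>Y. \<bar>Re y - Re z\<bar> \<le> \<rho>"
    have "\<forall>z\<in>Y. \<exists>x. x \<in> limset \<and> cmod (z - of_real x) \<le> 2 * B * h"
      using Omega_near_limset(2)[OF h] Y unfolding B_def by blast
    then obtain g where g: "\<And>z. z \<in> Y \<Longrightarrow> g z \<in> limset" "\<And>z. z \<in> Y \<Longrightarrow> cmod (z - of_real (g z)) \<le> 2 * B * h"
      by metis
    have gd: "\<bar>g y - g z\<bar> \<le> (1 + 4 * B) * \<rho>" if yz: "y \<in> Y" "z \<in> Y" for y z
    proof -
      have "\<bar>Re y - g y\<bar> \<le> 2 * B * h" "\<bar>Re z - g z\<bar> \<le> 2 * B * h"
        using abs_Re_le_cmod[of "y - of_real (g y)"] abs_Re_le_cmod[of "z - of_real (g z)"] g(2) yz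
        by fastforce+
      moreover have "\<bar>Re y - Re z\<bar> \<le> \<rho>" using diam yz by blast
      moreover have "B * h \<le> B * \<rho>" using B \<rho> by simp
      moreover have "\<bar>g y - g z\<bar> \<le> \<bar>Re y - g y\<bar> + \<bar>Re z - g z\<bar> + \<bar>Re y - Re z\<bar>" by linarith
      ultimately have "\<bar>g y - g z\<bar> \<le> \<rho> + 4 * (B * \<rho>)" by linarith
      then show ?thesis by (simp add: algebra_simps)
    qed
    have r: "h \<le> (1 + 4 * B) * \<rho>"
    proof -
      have "1 * h \<le> (1 + 4 * B) * \<rho>" using B \<rho> h by (intro mult_mono) auto
      then show ?thesis by simp
    qed
    have card: "real (card X) \<le> C * ((1 + 4 * B) * \<rho> / h) powr ?d" if X: "X \<subseteq> g ` Y" "sep h X" for X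
    proof (rule C(2)[OF h r _ X(2)])
      show "X \<subseteq> limset" using X(1) g(1) by blast
      show "\<forall>y\<in>X. \<forall>z\<in>X. \<bar>y - z\<bar> \<le> (1 + 4 * B) * \<rho>"
      proof (intro ballI)
        fix y z assume "y \<in> X" "z \<in> X"
        then obtain y' z' where "y = g y'" "z = g z'" "y' \<in> Y" "z' \<in> Y" using X(1) by blast
        then show "\<bar>y - z\<bar> \<le> (1 + 4 * B) * \<rho>" using gd by simp
      qed
    qed
    obtain X where X: "X \<subseteq> g ` Y" "sep h X" "\<forall>s\<in>g ` Y. \<exists>x\<in>X. \<bar>s - x\<bar> < h"
      using ex_maximal_sep[OF card h] by blast
    have finX: "finite X" using X(2) by (rule sep_finite)
    define box where "box x = cbox (Complex (x - R * h) (- (R * h))) (Complex (x + R * h) (R * h))" for x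
    have Rh: "0 < R * h" using B h by (simp add: R_def)
    have box: "emeasure lborel (box x) = ennreal ((2 * R)\<^sup>2 * h\<^sup>2)" for x
    proof -
      have "emeasure lborel (box x) = ennreal (2 * (R * h) * (2 * (R * h)))"
        unfolding box_def using Rh
        by (subst emeasure_lborel_cbox) (auto simp: Basis_complex_def)
      then show ?thesis by (simp add: power2_eq_square mult_ac)
    qed
    show "\<exists>A\<in>sets lborel. Y \<subseteq> A \<and> emeasure lborel A \<le> ennreal (C' * h\<^sup>2 * (\<rho> / h) powr ?d)"
    proof (intro bexI conjI)
      show "(\<Union>x\<in>X. box x) \<in> sets lborel" using finX by (auto simp: box_def)
      show "Y \<subseteq> (\<Union>x\<in>X. box x)"
      proof
        fix z assume z: "z \<in> Y"
        then obtain x where x: "x \<in> X" "\<bar>g z - x\<bar> < h" using X(3) by blast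
        have "\<bar>Re z - g z\<bar> \<le> 2 * B * h" "\<bar>Im z\<bar> \<le> 2 * B * h"
          using abs_Re_le_cmod[of "z - of_real (g z)"] abs_Im_le_cmod[of "z - of_real (g z)"] g(2)[OF z] by auto
        then have "\<bar>Re z - x\<bar> \<le> R * h" "\<bar>Im z\<bar> \<le> R * h"
          using x(2) h by (auto simp: R_def algebra_simps)
        then have "z \<in> box x" by (auto simp: box_def in_cbox_complex_iff)
        then show "z \<in> (\<Union>x\<in>X. box x)" using x(1) by blast
      qed
      have "emeasure lborel (\<Union>x\<in>X. box x) \<le> (\<Sum>x\<in>X. emeasure lborel (box x))"
        using finX by (intro emeasure_subadditive_finite) (simp_all add: box_def image_subset_iff)
      also have "\<dots> = ennreal (real (card X) * ((2 * R)\<^sup>2 * h\<^sup>2))"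
        by (simp add: box ennreal_mult ennreal_of_nat_eq_real_of_nat)
      also have "\<dots> \<le> ennreal (C' * h\<^sup>2 * (\<rho> / h) powr ?d)"
      proof (rule ennreal_leI)
        have "real (card X) * ((2 * R)\<^sup>2 * h\<^sup>2) \<le> C * ((1 + 4 * B) * (\<rho> / h)) powr ?d * ((2 * R)\<^sup>2 * h\<^sup>2)"
          using card[OF X(1,2)] by (intro mult_right_mono) auto
        also have "((1 + 4 * B) * (\<rho> / h)) powr ?d = (1 + 4 * B) powr ?d * (\<rho> / h) powr ?d"
          by (rule powr_mult)
        finally show "real (card X) * ((2 * R)\<^sup>2 * h\<^sup>2) \<le> C' * h\<^sup>2 * (\<rho> / h) powr ?d"
          by (simp add: C'_def mult_ac)
      qed
      finally show "emeasure lborel (\<Union>x\<in>X. box x) \<le> ennreal (C' * h\<^sup>2 * (\<rho> / h) powr ?d)" .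
    qed
  qed
qed

end

section \<open>The phase\<close>

lemma abs_Im_Ln_le:
  assumes "0 < Re z" shows "\<bar>Im (Ln z)\<bar> \<le> \<bar>Im z\<bar> / Re z"
proof -
  have "z \<noteq> 0" using assms by auto
  then have "Im (Ln z) = arctan (Im z / Re z)" using arg_conv_arctan[OF assms] by (simp add: Arg_eq_Im_Ln)
  then show ?thesis using abs_arctan_le[of "Im z / Re z"] assms by (simp add: abs_divide)
qed

context schottky_geometry
begin

lemma Re_in_D: "b \<in> letters m \<Longrightarrow> z \<in> D b \<Longrightarrow> complex_of_real (Re z) \<in> D b"
proof -
  assume "b \<in> letters m" "z \<in> D b"
  then obtain c r where D: "D b = ball (complex_of_real c) r" using disk by blast
  have "cmod (complex_of_real c - of_real (Re z)) = \<bar>Re (complex_of_real c - z)\<bar>"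
    by (simp flip: of_real_diff)
  also have "\<dots> \<le> cmod (complex_of_real c - z)" by (rule abs_Re_le_cmod)
  finally show ?thesis using \<open>z \<in> D b\<close> D by (simp add: dist_norm)
qed

lemma words_neD: "w \<in> words_ne m \<Longrightarrow> w \<in> words m" "w \<in> words_ne m \<Longrightarrow> w \<noteq> []"
  by (auto simp: words_ne_def)

lemma deriv_word_eq:
  assumes w: "w \<in> words_ne m" and b: "b \<in> nexts m w" and z: "z \<in> D b"
  shows "deriv_word \<gamma> w z = 1 / (of_real (lower w) * (z - of_real (wpole w)))\<^sup>2"
    "lower w \<noteq> 0" "z \<noteq> of_real (wpole w)"
proof -
  show c: "lower w \<noteq> 0" using word_pole(1)[OF words_neD[OF w]] .
  have "den (word_mat \<gamma> w) z \<noteq> 0" using den_word_nonzero[OF words_neD(1)[OF w] b D_closure[OF z]] .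
  then show "z \<noteq> of_real (wpole w)" "deriv_word \<gamma> w z = 1 / (of_real (lower w) * (z - of_real (wpole w)))\<^sup>2"
    using deriv_moeb(2)[OF det_word[OF words_letters[OF words_neD(1)[OF w]]]]
    by (auto simp: deriv_word_def den_eq_pole[OF c])
qed

text \<open>For \<open>q = z - p\<close> with \<open>Im q\<close> small against \<open>Re q\<close>, the number \<open>1 / q\<^sup>2\<close> lies in the right half-plane,
  where the argument is an arctangent.\<close>
lemma Ln_deriv_word:
  assumes w: "w \<in> words_ne m" and b: "b \<in> nexts m w" and z: "z \<in> D b"
  shows "Re (Ln (deriv_word \<gamma> w z)) = - 2 * ln \<bar>lower w\<bar> - 2 * ln (cmod (z - of_real (wpole w)))"
    "\<bar>Im z\<bar> \<le> \<kappa> / 4 \<Longrightarrow> \<bar>Im (Ln (deriv_word \<gamma> w z))\<bar> \<le> 3 * \<bar>Im z\<bar> / \<kappa>"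
proof -
  define c where "c = lower w"
  define q where "q = z - of_real (wpole w)"
  have c: "c \<noteq> 0" and q: "q \<noteq> 0" and eq: "deriv_word \<gamma> w z = 1 / (of_real c * q)\<^sup>2"
    using deriv_word_eq[OF assms] by (auto simp: c_def q_def)
  have "cmod (deriv_word \<gamma> w z) = 1 / (\<bar>c\<bar>\<^sup>2 * (cmod q)\<^sup>2)"
    by (simp add: eq norm_divide norm_mult norm_power power_mult_distrib)
  moreover have "deriv_word \<gamma> w z \<noteq> 0" using c q by (simp add: eq)
  moreover have "ln (1 / (\<bar>c\<bar>\<^sup>2 * (cmod q)\<^sup>2)) = - 2 * ln \<bar>c\<bar> - 2 * ln (cmod q)"
  proof -
    have "ln (1 / (a\<^sup>2 * b\<^sup>2)) = - 2 * ln a - 2 * ln b" if "0 < a" "0 < b" for a b :: real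
      using that by (simp add: ln_div ln_mult ln_realpow)
    then show ?thesis using c q by (metis zero_less_abs_iff zero_less_norm_iff)
  qed
  ultimately show "Re (Ln (deriv_word \<gamma> w z)) = - 2 * ln \<bar>lower w\<bar> - 2 * ln (cmod (z - of_real (wpole w)))"
    by (simp add: c_def q_def)
  assume small: "\<bar>Im z\<bar> \<le> \<kappa> / 4"
  define u where "u = Re q"
  define y where "y = Im q"
  have y: "\<bar>y\<bar> \<le> \<kappa> / 4" "Im z = y" using small by (auto simp: y_def q_def)
  have "\<kappa> \<le> cmod q" unfolding q_def using pole_dist(1)[OF words_neD[OF w] b D_closure[OF z]] .
  then have u: "3 * \<kappa> / 4 \<le> \<bar>u\<bar>" using cmod_le[of q] y(1) by (simp add: u_def y_def)
  have yu: "\<bar>y\<bar> \<le> \<bar>u\<bar> / 3" using u y(1) by simp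
  have y2: "y\<^sup>2 \<le> u\<^sup>2 / 9" using power_mono[OF yu, of 2] by (simp add: power_divide)
  have u0: "0 < \<bar>u\<bar>" using u kappa by linarith
  then have u2: "0 < u\<^sup>2" by simp
  define d where "d = deriv_word \<gamma> w z"
  define k where "k = 1 / (c\<^sup>2 * ((cmod q)\<^sup>2)\<^sup>2)"
  have k: "0 < k" using c q by (simp add: k_def)
  have "d = of_real k * cnj (q\<^sup>2)"
  proof -
    have "complex_of_real k = 1 / (of_real c ^ 2 * (of_real ((cmod q)\<^sup>2))\<^sup>2)" by (simp add: k_def)
    also have "of_real ((cmod q)\<^sup>2) = q * cnj q" by (rule complex_norm_square)
    finally show ?thesis using c q by (simp add: d_def eq power_mult_distrib power2_eq_square)
  qed
  then have d: "Re d = k * (u\<^sup>2 - y\<^sup>2)" "Im d = - k * (2 * u * y)"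
    by (auto simp: u_def y_def power2_eq_square)
  have pos: "u\<^sup>2 * (8 / 9) \<le> u\<^sup>2 - y\<^sup>2" using y2 by simp
  then have pos': "0 < u\<^sup>2 - y\<^sup>2" using u2 by linarith
  have Red: "0 < Re d" unfolding d(1) using k pos' by (rule mult_pos_pos)
  have "\<bar>Im (Ln d)\<bar> \<le> \<bar>Im d\<bar> / Re d" by (rule abs_Im_Ln_le[OF Red])
  also have "\<dots> = (2 * \<bar>u\<bar> * \<bar>y\<bar>) / (u\<^sup>2 - y\<^sup>2)"
    using k by (simp add: d abs_mult)
  also have "\<dots> \<le> (2 * \<bar>u\<bar> * \<bar>y\<bar>) / (u\<^sup>2 * (8 / 9))"
    by (rule divide_left_mono[OF pos]) (use mult_pos_pos[OF pos', of "u\<^sup>2 * (8 / 9)"] u2 in simp_all)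
  also have "\<dots> = (9 / 4) * \<bar>y\<bar> / \<bar>u\<bar>"
  proof -
    have "(2 * a * \<bar>y\<bar>) / (a\<^sup>2 * (8 / 9)) = (9 / 4) * \<bar>y\<bar> / a" if "0 < a" for a :: real
      using that by (simp add: power2_eq_square)
    from this[OF u0] show ?thesis by simp
  qed
  also have "\<dots> \<le> (9 / 4) * \<bar>y\<bar> / (3 * \<kappa> / 4)"
    using u kappa by (intro divide_left_mono) auto
  also have "\<dots> = 3 * \<bar>Im z\<bar> / \<kappa>" using kappa y(2) by simp
  finally show "\<bar>Im (Ln (deriv_word \<gamma> w z))\<bar> \<le> 3 * \<bar>Im z\<bar> / \<kappa>" by (simp add: d_def)
qed

lemma abs_Im_phase_le:
  assumes "v \<in> words_ne m" "w \<in> words_ne m" "b \<in> nexts m v" "b \<in> nexts m w" "z \<in> D b" "\<bar>Im z\<bar> \<le> \<kappa> / 4"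
  shows "\<bar>Im (phase \<gamma> v w z)\<bar> \<le> 6 * \<bar>Im z\<bar> / \<kappa>"
  using Ln_deriv_word(2)[OF assms(1,3,5,6)] Ln_deriv_word(2)[OF assms(2,4,5,6)]
  by (simp add: phase_def)

lemma ln_cmod_Re:
  assumes w: "w \<in> words_ne m" and b: "b \<in> nexts m w" and z: "z \<in> D b"
  shows "\<bar>ln (cmod (z - of_real (wpole w))) - ln \<bar>Re z - wpole w\<bar>\<bar> \<le> \<bar>Im z\<bar> / \<kappa>"
proof -
  define u where "u = \<bar>Re z - wpole w\<bar>"
  define r where "r = cmod (z - of_real (wpole w))"
  have rD: "complex_of_real (Re z) \<in> closure (D b)" using Re_in_D[OF nexts_letters[OF b] z] D_closure by blast
  have "\<kappa> \<le> cmod (complex_of_real (Re z) - of_real (wpole w))" using pole_dist(1)[OF words_neD[OF w] b rD] .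
  then have u: "\<kappa> \<le> u" by (simp add: u_def flip: of_real_diff)
  have ur: "u \<le> r" using abs_Re_le_cmod[of "z - of_real (wpole w)"] by (simp add: u_def r_def)
  have ru: "r \<le> u + \<bar>Im z\<bar>" using cmod_le[of "z - of_real (wpole w)"] by (simp add: u_def r_def)
  have "ln r - ln u = ln (r / u)" using u ur kappa by (simp add: ln_div)
  also have "\<dots> \<le> r / u - 1" using u ur kappa by (intro ln_le_minus_one) auto
  also have "\<dots> = (r - u) / u" using u kappa by (simp add: diff_divide_distrib)
  also have "\<dots> \<le> \<bar>Im z\<bar> / \<kappa>" using u ur ru kappa by (intro frac_le) auto
  finally have "ln r - ln u \<le> \<bar>Im z\<bar> / \<kappa>" .
  moreover have "ln u \<le> ln r" using u ur kappa by simp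
  ultimately show ?thesis by (simp add: u_def r_def)
qed

text \<open>Mean value theorem for \<open>F\<close>, whose derivative is \<open>(p\<^sub>v - p\<^sub>w) / ((t - p\<^sub>v) (t - p\<^sub>w))\<close>.\<close>
lemma log_ratio_expands:
  assumes v: "v \<in> words_ne m" "b \<in> nexts m v" and w: "w \<in> words_ne m" "b \<in> nexts m w"
    and x: "complex_of_real x \<in> D b" and y: "complex_of_real y \<in> D b" and xy: "x < y"
  defines "F \<equiv> \<lambda>t. ln \<bar>t - wpole v\<bar> - ln \<bar>t - wpole w\<bar>"
  shows "\<bar>wpole v - wpole w\<bar> * (y - x) \<le> K\<^sup>2 * \<bar>F y - F x\<bar>"
proof -
  have tD: "complex_of_real t \<in> D b" if "x \<le> t" "t \<le> y" for t
  proof -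
    obtain c r where D: "D b = ball (complex_of_real c) r" using disk nexts_letters[OF v(2)] by blast
    have "\<bar>c - x\<bar> < r" "\<bar>c - y\<bar> < r" using x y D by (auto simp: dist_norm simp flip: of_real_diff)
    then have "\<bar>c - t\<bar> < r" using that by linarith
    then show ?thesis using D by (auto simp: dist_norm simp flip: of_real_diff)
  qed
  have pd: "\<kappa> \<le> \<bar>t - wpole u\<bar> \<and> \<bar>t - wpole u\<bar> \<le> K"
    if "u \<in> words_ne m" "b \<in> nexts m u" "x \<le> t" "t \<le> y" for u t
    using pole_dist[OF words_neD[OF that(1)] that(2) D_closure[OF tD[OF that(3,4)]]]
    by (simp flip: of_real_diff)
  have der: "((\<lambda>t. ln \<bar>t - wpole u\<bar>) has_real_derivative 1 / (t - wpole u)) (at t)"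
    if "t \<noteq> wpole u" for u t
  proof -
    have "((\<lambda>t. ln ((t - wpole u)\<^sup>2) / 2) has_real_derivative 1 / (t - wpole u)) (at t)"
    proof -
      have pos: "0 < (t - wpole u)\<^sup>2" using that by simp
      have "((\<lambda>t. (t - wpole u)\<^sup>2) has_real_derivative 2 * (t - wpole u)) (at t)"
        by (auto intro!: derivative_eq_intros)
      from DERIV_cdivide[OF DERIV_chain2[OF DERIV_ln_divide[OF pos] this], of 2]
      have D: "((\<lambda>t. ln ((t - wpole u)\<^sup>2) / 2) has_real_derivative
          1 / (t - wpole u)\<^sup>2 * (2 * (t - wpole u)) / 2) (at t)" .
      have cancel: "1 / x\<^sup>2 * (2 * x) / 2 = 1 / x" if "x \<noteq> 0" for x :: real
        using that by (simp add: power2_eq_square)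
      have nz: "t - wpole u \<noteq> 0" using that by simp
      show ?thesis using D by (simp only: cancel[OF nz])
    qed
    moreover have "(\<lambda>t. ln ((t - wpole u)\<^sup>2) / 2) = (\<lambda>t. ln \<bar>t - wpole u\<bar>)"
    proof
      fix t show "ln ((t - wpole u)\<^sup>2) / 2 = ln \<bar>t - wpole u\<bar>"
      proof (cases "t = wpole u")
        case False
        have "ln (\<bar>t - wpole u\<bar>\<^sup>2) = 2 * ln \<bar>t - wpole u\<bar>"
          using ln_realpow[of "\<bar>t - wpole u\<bar>" 2] False by simp
        then show ?thesis by simp
      qed simp
    qed
    ultimately show ?thesis by simp
  qed
  have "\<exists>t>x. t < y \<and> F y - F x = (y - x) * (1 / (t - wpole v) - 1 / (t - wpole w))"
    unfolding F_def
  proof (rule MVT2[OF xy])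
    fix t assume t: "x \<le> t" "t \<le> y"
    have "t \<noteq> wpole v" "t \<noteq> wpole w" using pd[OF v t] pd[OF w t] kappa by auto
    then show "((\<lambda>t. ln \<bar>t - wpole v\<bar> - ln \<bar>t - wpole w\<bar>) has_real_derivative
        1 / (t - wpole v) - 1 / (t - wpole w)) (at t)"
      by (intro DERIV_diff der)
  qed
  then obtain t where t: "x \<le> t" "t \<le> y" "F y - F x = (y - x) * (1 / (t - wpole v) - 1 / (t - wpole w))"
    by (meson less_imp_le)
  define a where "a = t - wpole v"
  define c where "c = t - wpole w"
  have ac: "\<kappa> \<le> \<bar>a\<bar>" "\<bar>a\<bar> \<le> K" "\<kappa> \<le> \<bar>c\<bar>" "\<bar>c\<bar> \<le> K"
    using pd[OF v t(1,2)] pd[OF w t(1,2)] by (auto simp: a_def c_def)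
  then have nz: "a \<noteq> 0" "c \<noteq> 0" using kappa by auto
  have "F y - F x = (y - x) * ((wpole v - wpole w) / (a * c))"
    using t(3) nz by (simp add: a_def c_def diff_frac_eq)
  then have "\<bar>F y - F x\<bar> * (\<bar>a\<bar> * \<bar>c\<bar>) = (y - x) * \<bar>wpole v - wpole w\<bar>"
    using nz xy by (simp add: abs_mult)
  moreover have "\<bar>F y - F x\<bar> * (\<bar>a\<bar> * \<bar>c\<bar>) \<le> \<bar>F y - F x\<bar> * (K * K)"
    using ac by (intro mult_left_mono mult_mono) auto
  ultimately show ?thesis by (simp add: power2_eq_square mult_ac)
qed

text \<open>On the real axis this is \<open>log_ratio_expands\<close>. Moving from \<open>y\<close> and \<open>z\<close> to the real axis changes each
  logarithm by at most \<open>e / \<kappa>\<close>.\<close>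
lemma phase_separates:
  assumes v: "v \<in> words_ne m" "b \<in> nexts m v" and w: "w \<in> words_ne m" "b \<in> nexts m w"
    and y: "y \<in> D b" "\<bar>Im y\<bar> \<le> e" and z: "z \<in> D b" "\<bar>Im z\<bar> \<le> e"
  shows "\<bar>wpole v - wpole w\<bar> * \<bar>Re y - Re z\<bar>
    \<le> K\<^sup>2 * (\<bar>Re (phase \<gamma> v w y)\<bar> + \<bar>Re (phase \<gamma> v w z)\<bar> + 4 * e / \<kappa>)"
proof -
  define F where "F t = ln \<bar>t - wpole v\<bar> - ln \<bar>t - wpole w\<bar>" for t
  define G where "G z = ln (cmod (z - of_real (wpole v))) - ln (cmod (z - of_real (wpole w)))" for z
  have ph: "Re (phase \<gamma> v w x) = 2 * ln \<bar>lower v\<bar> - 2 * ln \<bar>lower w\<bar> + 2 * G x" if "x \<in> D b" for x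
    using Ln_deriv_word(1)[OF v that] Ln_deriv_word(1)[OF w that] by (simp add: phase_def G_def)
  have GF: "\<bar>G x - F (Re x)\<bar> \<le> 2 * e / \<kappa>" if x: "x \<in> D b" "\<bar>Im x\<bar> \<le> e" for x
  proof -
    have "\<bar>Im x\<bar> / \<kappa> \<le> e / \<kappa>" using x(2) kappa by (simp add: divide_right_mono)
    then have "\<bar>G x - F (Re x)\<bar> \<le> e / \<kappa> + e / \<kappa>"
      using ln_cmod_Re[OF v x(1)] ln_cmod_Re[OF w x(1)] unfolding G_def F_def by linarith
    then show ?thesis by simp
  qed
  have "\<bar>F (Re y) - F (Re z)\<bar> \<le> \<bar>G y - G z\<bar> + 2 * e / \<kappa> + 2 * e / \<kappa>"
    using GF[OF y] GF[OF z] by linarith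
  also have "\<bar>G y - G z\<bar> \<le> \<bar>Re (phase \<gamma> v w y)\<bar> + \<bar>Re (phase \<gamma> v w z)\<bar>"
    using ph[OF y(1)] ph[OF z(1)] by linarith
  finally have F: "\<bar>F (Re y) - F (Re z)\<bar> \<le> \<bar>Re (phase \<gamma> v w y)\<bar> + \<bar>Re (phase \<gamma> v w z)\<bar> + 4 * e / \<kappa>"
    by simp
  have "\<bar>wpole v - wpole w\<bar> * \<bar>Re y - Re z\<bar> \<le> K\<^sup>2 * \<bar>F (Re y) - F (Re z)\<bar>"
  proof -
    note b = nexts_letters[OF v(2)]
    note yD = Re_in_D[OF b y(1)] and zD = Re_in_D[OF b z(1)]
    consider "Re y < Re z" | "Re y = Re z" | "Re z < Re y" by linarith
    then show ?thesis
    proof cases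
      case 1
      then show ?thesis using log_ratio_expands[OF v w yD zD 1] by (simp add: F_def abs_minus_commute)
    next
      case 3
      then show ?thesis using log_ratio_expands[OF v w zD yD 3] by (simp add: F_def)
    qed simp
  qed
  also have "\<dots> \<le> K\<^sup>2 * (\<bar>Re (phase \<gamma> v w y)\<bar> + \<bar>Re (phase \<gamma> v w z)\<bar> + 4 * e / \<kappa>)"
    using F by (intro mult_left_mono) auto
  finally show ?thesis .
qed

text \<open>The lower left entry of \<open>\<gamma>\<^sub>v \<gamma>\<^sub>w\<^sup>-\<^sup>1\<close> is \<open>c\<^sub>v c\<^sub>w (p\<^sub>v - p\<^sub>w)\<close>, and each derivative at a base point is
  \<open>1 / (c t)\<^sup>2\<close> with \<open>t\<close> between \<open>\<kappa>\<close> and \<open>K\<close>.\<close>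
lemma word_dist_poles:
  assumes ch: "base_choices m D p nx pe" and v: "v \<in> words_ne m" and w: "w \<in> words_ne m" and vw: "v \<noteq> w"
  shows "0 < word_dist m \<gamma> p nx pe v w" "word_dist m \<gamma> p nx pe v w \<le> K / \<kappa>\<^sup>2 * \<bar>wpole v - wpole w\<bar>"
proof -
  have U: "\<exists>t. \<kappa> \<le> t \<and> t \<le> K \<and> Upsilon \<gamma> p nx pe u = 1 / (lower u * t)\<^sup>2" if u: "u \<in> words_ne m" for u
  proof -
    have nb: "nx u \<in> nexts m u" "complex_of_real (p (nx u)) \<in> D (nx u)"
      using ch u by (auto simp: base_choices_def nexts_def)
    define t where "t = \<bar>p (nx u) - wpole u\<bar>"
    have "deriv_word \<gamma> u (of_real (p (nx u))) = of_real (1 / (lower u * (p (nx u) - wpole u))\<^sup>2)"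
      using deriv_word_eq(1)[OF u nb] by simp
    then have "Upsilon \<gamma> p nx pe u = 1 / (lower u * (p (nx u) - wpole u))\<^sup>2"
      using words_neD(2)[OF u] by (simp add: Upsilon_def base_pt_def)
    moreover have "\<kappa> \<le> t" "t \<le> K"
      using pole_dist[OF words_neD[OF u] nb(1) D_closure[OF nb(2)]] by (simp_all add: t_def flip: of_real_diff)
    ultimately show ?thesis by (intro exI[of _ t]) (simp add: t_def power_mult_distrib)
  qed
  define u where "u = red m (v @ bar_word m w)"
  have lw: "set (v @ bar_word m w) \<subseteq> letters m"
    using words_neD v w words_letters bar_word_words by (metis set_append Un_least)
  have u: "u \<in> words_ne m"
    using red_in_words[OF lw] red_append_bar_word_neq_Nil[OF words_neD(1)[OF v] words_neD(1)[OF w] vw]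
    by (simp add: u_def words_ne_def)
  obtain r s t where r: "\<kappa> \<le> r" "r \<le> K" "Upsilon \<gamma> p nx pe v = 1 / (lower v * r)\<^sup>2"
    and s: "\<kappa> \<le> s" "s \<le> K" "Upsilon \<gamma> p nx pe w = 1 / (lower w * s)\<^sup>2"
    and t: "\<kappa> \<le> t" "t \<le> K" "Upsilon \<gamma> p nx pe u = 1 / (lower u * t)\<^sup>2"
    using U[OF v] U[OF w] U[OF u] by blast
  have c: "lower v \<noteq> 0" "lower w \<noteq> 0" "lower u \<noteq> 0"
    using word_pole(1) words_neD v w u by auto
  have "word_mat \<gamma> u = word_mat \<gamma> v ** word_mat \<gamma> (bar_word m w)"
    unfolding u_def using word_mat_red[OF lw] by (simp add: word_mat_append)
  then have "lower u = lower v * word_mat \<gamma> w$2$2 - word_mat \<gamma> v$2$2 * lower w"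
    using left_inverse_entries[OF word_mat_bar_word[OF words_letters[OF words_neD(1)[OF w]]]
        det_word[OF words_letters[OF words_neD(1)[OF w]]]]
    by (simp add: matrix_mult_2)
  also have "\<dots> = lower v * lower w * (wpole v - wpole w)"
    using c by (simp add: pole_def field_simps)
  finally have lu: "lower u = lower v * lower w * (wpole v - wpole w)" .
  have "Upsilon \<gamma> p nx pe v * Upsilon \<gamma> p nx pe w / Upsilon \<gamma> p nx pe u = ((wpole v - wpole w) * t / (r * s))\<^sup>2"
  proof -
    define P where "P = wpole v - wpole w"
    have "r \<noteq> 0" "s \<noteq> 0" using r(1) s(1) kappa by auto
    then show ?thesis unfolding r(3) s(3) t(3) lu P_def[symmetric] using c
      by (simp add: power_mult_distrib power_divide)
  qed
  then have wd: "word_dist m \<gamma> p nx pe v w = \<bar>wpole v - wpole w\<bar> * t / (r * s)"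
    using r(1) s(1) t(1) kappa by (simp add: word_dist_def u_def[symmetric] abs_mult)
  have "wpole v \<noteq> wpole w" using lu c by auto
  then show "0 < word_dist m \<gamma> p nx pe v w" using r(1) s(1) t(1) kappa by (simp add: wd)
  have "\<bar>wpole v - wpole w\<bar> * t / (r * s) \<le> \<bar>wpole v - wpole w\<bar> * K / (\<kappa> * \<kappa>)"
    using r(1) s(1) t kappa by (intro frac_le mult_mono mult_left_mono) auto
  then show "word_dist m \<gamma> p nx pe v w \<le> K / \<kappa>\<^sup>2 * \<bar>wpole v - wpole w\<bar>"
    by (simp add: wd power2_eq_square mult_ac)
qed

lemma abs_wpole_diff_le:
  assumes "v \<in> words_ne m" "w \<in> words_ne m"
  shows "\<bar>wpole v - wpole w\<bar> \<le> K"
proof -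
  have "complex_of_real (wpole u) \<in> closure (D (bar m (last u))) \<and> bar m (last u) \<in> letters m" if "u \<in> words_ne m" for u
    using word_pole(2)[OF words_neD[OF that]] D_closure bar_letters words_letters words_neD[OF that]
    by (meson last_in_set subsetD)
  then have "cmod (complex_of_real (wpole v) - complex_of_real (wpole w)) \<le> K"
    using bounded_D assms by blast
  then show ?thesis by (simp flip: of_real_diff)
qed

end

section \<open>The oscillatory integral\<close>

text \<open>The covering sets dominate \<open>cmod \<circ> g\<close> by a countable sum of multiples of indicators; the factors
  \<open>(1/2) ^ Suc j\<close> sum to 1. The integral of a function that is not integrable is 0 by convention.\<close>
lemma norm_integral_le_dyadic_cover:
  fixes g :: "complex \<Rightarrow> complex"
  assumes \<Omega>: "open \<Omega>" and A: "\<And>j. A j \<in> sets lborel"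
    and cover: "\<And>z. z \<in> \<Omega> \<Longrightarrow> \<exists>j::nat. z \<in> A j \<and> cmod (g z) \<le> B j"
    and le: "\<And>j. ennreal (B j) * emeasure lborel (A j) \<le> ennreal (X * (1/2) ^ Suc j)" and X: "0 \<le> X"
  shows "cmod (\<integral>z. g z \<partial>(lebesgue_on \<Omega>)) \<le> X"
proof (cases "integrable (lebesgue_on \<Omega>) g")
  case False
  then show ?thesis using X by (simp add: not_integrable_integral_eq)
next
  case True
  have \<Omega>m: "\<Omega> \<in> sets lebesgue" using \<Omega> by (intro sets_completionI_sets) simp
  have Am: "A j \<in> sets lebesgue" for j using A by (intro sets_completionI_sets)
  have "ennreal (cmod (\<integral>z. g z \<partial>(lebesgue_on \<Omega>))) \<le> (\<integral>\<^sup>+z. ennreal (cmod (g z)) \<partial>(lebesgue_on \<Omega>))"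
    using integral_norm_bound_ennreal[OF True] by simp
  also have "\<dots> = (\<integral>\<^sup>+z. ennreal (cmod (g z)) * indicator \<Omega> z \<partial>lebesgue)"
    using \<Omega>m by (simp add: nn_integral_restrict_space)
  also have "\<dots> \<le> (\<integral>\<^sup>+z. (\<Sum>j. ennreal (B j) * indicator (A j) z) \<partial>lebesgue)"
  proof (rule nn_integral_mono)
    fix z
    show "ennreal (cmod (g z)) * indicator \<Omega> z \<le> (\<Sum>j. ennreal (B j) * indicator (A j) z)"
    proof (cases "z \<in> \<Omega>")
      case True
      then obtain j where j: "z \<in> A j" "cmod (g z) \<le> B j" using cover by blast
      have "ennreal (cmod (g z)) * indicator \<Omega> z \<le> (\<Sum>i\<in>{j}. ennreal (B i) * indicator (A i) z)"
        using True j by (simp add: ennreal_leI)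
      also have "\<dots> \<le> (\<Sum>j. ennreal (B j) * indicator (A j) z)"
        by (rule sum_le_suminf) auto
      finally show ?thesis .
    qed simp
  qed
  also have "\<dots> = (\<Sum>j. \<integral>\<^sup>+z. ennreal (B j) * indicator (A j) z \<partial>lebesgue)"
    using Am by (intro nn_integral_suminf) auto
  also have "\<dots> = (\<Sum>j. ennreal (B j) * emeasure lborel (A j))"
    using Am A by (simp add: nn_integral_cmult_indicator)
  also have "\<dots> \<le> (\<Sum>j. ennreal (X * (1/2) ^ Suc j))"
    by (intro suminf_le le) auto
  also have "\<dots> = ennreal (X * 1)"
  proof -
    have "(\<lambda>j. X * (1/2) ^ Suc j) sums (X * 1)" by (intro sums_mult power_half_series)
    then show ?thesis using X by (intro suminf_ennreal_eq) auto
  qed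
  finally show ?thesis using X by simp
qed

context schottky_geometry
begin

text \<open>For large \<open>T\<close> the domain lies so close to the real axis that \<open>T \<bar>Im \<Phi>\<bar>\<close> is bounded, and so is \<open>\<bar>Im (H \<Phi>)\<bar>\<close>
  because \<open>H \<le> T\<close>.\<close>
lemma fourier_phase_bound:
  assumes "smooth \<phi>" "\<And>t. 2 < \<bar>t\<bar> \<Longrightarrow> \<phi> t = 0"
  shows "\<exists>T\<^sub>0\<ge>1. \<exists>E>0. \<forall>T\<ge>T\<^sub>0. \<forall>H. 1 \<le> H \<longrightarrow> H \<le> T \<longrightarrow>
    (\<forall>v\<in>words_ne m. \<forall>w\<in>words_ne m. \<forall>b\<in>nexts m v \<inter> nexts m w. \<forall>z\<in>Omega_at m D \<gamma> b (1 / T).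
      \<bar>Im z\<bar> \<le> (1 + K^3 / \<kappa>^3) / T \<and> \<bar>Im z\<bar> \<le> \<kappa> / 4 \<and>
      cmod (fourier (cutoff \<phi> T H) (phase \<gamma> v w z)) \<le> E \<and>
      (H * \<bar>Re (phase \<gamma> v w z)\<bar>) ^ 3 * cmod (fourier (cutoff \<phi> T H) (phase \<gamma> v w z)) \<le> E)"
proof -
  define B where "B = 1 + K^3 / \<kappa>^3"
  have B: "1 \<le> B" using K kappa by (simp add: B_def)
  define c where "c = 6 * B / \<kappa>"
  have c: "0 \<le> c" using B kappa by (simp add: c_def)
  obtain F where F: "0 < F" "\<And>\<zeta>. \<bar>Im \<zeta>\<bar> \<le> c \<Longrightarrow> cmod (fourier \<phi> \<zeta>) \<le> F"
    "\<And>\<zeta>. \<bar>Im \<zeta>\<bar> \<le> c \<Longrightarrow> cmod \<zeta> ^ 3 * cmod (fourier \<phi> \<zeta>) \<le> F"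
    using fourier_decay[OF assms c] by blast
  show ?thesis
  \<comment> \<open>For these \<open>T\<close> the bound \<open>B / T\<close> for imaginary parts is at most \<open>\<kappa> / 4\<close>, as \<open>Ln_deriv_word\<close> requires.\<close>
  proof (rule exI[of _ "max 1 (4 * B / \<kappa>)"], rule conjI, simp, rule exI[of _ "exp c * F"],
      intro conjI allI impI ballI)
    show "0 < exp c * F" using F(1) by simp
    fix T H v w b z
    assume T: "max 1 (4 * B / \<kappa>) \<le> T" and H: "1 \<le> (H::real)" "H \<le> T"
      and v: "v \<in> words_ne m" and w: "w \<in> words_ne m" and b: "b \<in> nexts m v \<inter> nexts m w"
      and z: "z \<in> Omega_at m D \<gamma> b (1 / T)"
    have T0: "0 < T" "1 \<le> T" using T by auto
    show Imz: "\<bar>Im z\<bar> \<le> (1 + K^3 / \<kappa>^3) / T" using Omega_near_limset(1)[OF _ z] T0 by simp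
    have "4 * B / \<kappa> \<le> T" using T by simp
    then have "B / T \<le> \<kappa> / 4" using T0 kappa by (simp add: field_simps)
    then show Imk: "\<bar>Im z\<bar> \<le> \<kappa> / 4" using Imz unfolding B_def by (rule order_trans[rotated])
    define \<xi> where "\<xi> = phase \<gamma> v w z"
    have zD: "z \<in> D b" using z by (simp add: Omega_at_def)
    have "\<bar>Im \<xi>\<bar> \<le> 6 * \<bar>Im z\<bar> / \<kappa>"
      unfolding \<xi>_def using abs_Im_phase_le[OF v w _ _ zD Imk] b by simp
    also have "\<dots> \<le> 6 * (B / T) / \<kappa>" using Imz[folded B_def] kappa by (intro divide_right_mono mult_left_mono) auto
    finally have "\<bar>Im \<xi>\<bar> \<le> c / T" by (simp add: c_def mult_ac)
    then have TI: "T * \<bar>Im \<xi>\<bar> \<le> c" using T0 by (simp add: pos_le_divide_eq mult.commute)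
    have "T * Im \<xi> \<le> T * \<bar>Im \<xi>\<bar>" using T0 by (intro mult_left_mono) auto
    then have e1: "exp (T * Im \<xi>) \<le> exp c" using TI by simp
    have "\<bar>Im (of_real H * \<xi>)\<bar> = H * \<bar>Im \<xi>\<bar>" using H by (simp add: abs_mult)
    also have "\<dots> \<le> T * \<bar>Im \<xi>\<bar>" using H by (intro mult_right_mono) auto
    finally have HI: "\<bar>Im (of_real H * \<xi>)\<bar> \<le> c" using TI by linarith
    have eq: "cmod (fourier (cutoff \<phi> T H) \<xi>) = exp (T * Im \<xi>) * cmod (fourier \<phi> (of_real H * \<xi>))"
      using cmod_fourier_cutoff H by simp
    show "cmod (fourier (cutoff \<phi> T H) (phase \<gamma> v w z)) \<le> exp c * F"
      unfolding \<xi>_def[symmetric] eq using e1 F(2)[OF HI] by (intro mult_mono) auto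
    have "H * \<bar>Re \<xi>\<bar> \<le> cmod (of_real H * \<xi>)" using H abs_Re_le_cmod[of \<xi>] by (simp add: norm_mult)
    then have "(H * \<bar>Re \<xi>\<bar>) ^ 3 * cmod (fourier \<phi> (of_real H * \<xi>)) \<le> cmod (of_real H * \<xi>) ^ 3 * cmod (fourier \<phi> (of_real H * \<xi>))"
      using H by (intro mult_right_mono power_mono) auto
    also have "\<dots> \<le> F" by (rule F(3)[OF HI])
    finally have "exp (T * Im \<xi>) * ((H * \<bar>Re \<xi>\<bar>) ^ 3 * cmod (fourier \<phi> (of_real H * \<xi>))) \<le> exp c * F"
      using e1 H by (intro mult_mono) auto
    then show "(H * \<bar>Re (phase \<gamma> v w z)\<bar>) ^ 3 * cmod (fourier (cutoff \<phi> T H) (phase \<gamma> v w z)) \<le> exp c * F"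
      unfolding \<xi>_def[symmetric] eq by (simp add: mult_ac)
  qed
qed

text \<open>For \<open>v \<noteq> w\<close> the domain is decomposed according to the size of \<open>H \<bar>Re \<Phi>\<bar>\<close>. On the \<open>j\<close>-th piece the integrand is
  \<open>O(8 ^ - j)\<close> and the area is \<open>O(2 powr (j d)) \<le> O(4 ^ j)\<close> times the bound for \<open>j = 0\<close>, so the
  contributions decrease like \<open>2 ^ - j\<close>.\<close>
lemma oscillatory_integral_bound:
  assumes ch: "base_choices m D p nx pe"
    and \<phi>: "smooth \<phi>" "\<forall>t. 2 < \<bar>t\<bar> \<longrightarrow> \<phi> t = 0"
  defines "d \<equiv> hausdorff_dim limset"
  shows "\<exists>T\<^sub>0\<ge>1. \<exists>C>0. \<forall>T\<ge>T\<^sub>0. \<forall>H. 1 \<le> H \<longrightarrow> H \<le> T \<longrightarrow>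
    (\<forall>v\<in>words_ne m. \<forall>w\<in>words_ne m. \<forall>b\<in>nexts m v \<inter> nexts m w. \<forall>f N.
      (\<forall>z\<in>Omega_at m D \<gamma> b (1 / T). cmod (f z) \<le> N) \<longrightarrow> 0 \<le> N \<longrightarrow>
      cmod (\<integral>z. fourier (cutoff \<phi> T H) (phase \<gamma> v w z) * f z \<partial>(lebesgue_on (Omega_at m D \<gamma> b (1 / T))))
      \<le> C * ((1 / T) powr (- d + 2) * (if v = w then 1 else word_dist m \<gamma> p nx pe v w powr (- d) * H powr (- d)) * N))"
proof -
  define B where "B = 1 + K^3 / \<kappa>^3"
  have B: "1 \<le> B" using K kappa by (simp add: B_def)
  obtain T\<^sub>0 E where T\<^sub>0: "1 \<le> T\<^sub>0" and E: "0 < E" and FP: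
    "\<And>T H v w b z. T\<^sub>0 \<le> T \<Longrightarrow> 1 \<le> H \<Longrightarrow> H \<le> T \<Longrightarrow> v \<in> words_ne m \<Longrightarrow> w \<in> words_ne m \<Longrightarrow>
      b \<in> nexts m v \<inter> nexts m w \<Longrightarrow> z \<in> Omega_at m D \<gamma> b (1 / T) \<Longrightarrow>
      \<bar>Im z\<bar> \<le> B / T \<and> \<bar>Im z\<bar> \<le> \<kappa> / 4 \<and>
      cmod (fourier (cutoff \<phi> T H) (phase \<gamma> v w z)) \<le> E \<and>
      (H * \<bar>Re (phase \<gamma> v w z)\<bar>) ^ 3 * cmod (fourier (cutoff \<phi> T H) (phase \<gamma> v w z)) \<le> E"
    using fourier_phase_bound[OF \<phi>(1) \<phi>(2)[rule_format]] unfolding B_def by metis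
  obtain C where C: "0 < C" and area: "\<And>h \<rho> b Y. 0 < h \<Longrightarrow> h \<le> \<rho> \<Longrightarrow> Y \<subseteq> Omega_at m D \<gamma> b h \<Longrightarrow>
      (\<forall>y\<in>Y. \<forall>z\<in>Y. \<bar>Re y - Re z\<bar> \<le> \<rho>) \<Longrightarrow>
      \<exists>A\<in>sets lborel. Y \<subseteq> A \<and> emeasure lborel A \<le> ennreal (C * h\<^sup>2 * (\<rho> / h) powr d)"
    using area_bound unfolding d_def by metis
  have d: "0 \<le> d" "d \<le> 2"
    using hausdorff_dim_bounds[OF compact_imp_bounded[OF compact_limset]] by (auto simp: d_def)
  define Q where "Q = K\<^sup>2 * (2 + 4 * B / \<kappa>) * (K / \<kappa>\<^sup>2)"
  have Q: "0 < Q" using K kappa B by (simp add: Q_def add_pos_nonneg)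
  define C1 where "C1 = 2 * E * C * K powr d"
  define C2 where "C2 = 16 * E * C * Q powr d"
  have C12: "0 < C1" "0 < C2" using E C K Q by (auto simp: C1_def C2_def)
  show ?thesis
  proof (rule exI[of _ T\<^sub>0], rule conjI, rule T\<^sub>0, rule exI[of _ "max C1 C2"],
      intro conjI allI impI ballI)
    show "0 < max C1 C2" using C12 by simp
    fix T H v w b f N
    assume T: "T\<^sub>0 \<le> T" and H: "1 \<le> H" "H \<le> T" and v: "v \<in> words_ne m" and w: "w \<in> words_ne m"
      and b: "b \<in> nexts m v \<inter> nexts m w" and f: "\<forall>z\<in>Omega_at m D \<gamma> b (1 / T). cmod (f z) \<le> N" and N: "0 \<le> N"
    define h where "h = 1 / T"
    have h: "0 < h" "h \<le> 1" "h \<le> 1 / H" using T T\<^sub>0 H by (auto simp: h_def frac_le)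
    define \<Omega> where "\<Omega> = Omega_at m D \<gamma> b h"
    define g where "g z = fourier (cutoff \<phi> T H) (phase \<gamma> v w z) * f z" for z
    have bl: "b \<in> letters m" using b nexts_letters by blast
    have op: "open \<Omega>" unfolding \<Omega>_def by (rule open_Omega_at[OF bl])
    have \<Omega>D: "z \<in> D b" if "z \<in> \<Omega>" for z using that by (simp add: \<Omega>_def Omega_at_def)
    have FP': "\<bar>Im z\<bar> \<le> B * h" "cmod (fourier (cutoff \<phi> T H) (phase \<gamma> v w z)) \<le> E"
      "(H * \<bar>Re (phase \<gamma> v w z)\<bar>) ^ 3 * cmod (fourier (cutoff \<phi> T H) (phase \<gamma> v w z)) \<le> E"
      "cmod (f z) \<le> N" if "z \<in> \<Omega>" for z
      using FP[OF T H v w b, of z] f that by (auto simp: \<Omega>_def h_def)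
    have hd: "h\<^sup>2 * (\<rho> / h) powr d = h powr (- d + 2) * \<rho> powr d" if "0 < \<rho>" for \<rho>
    proof -
      have "h powr (- d + 2) = h\<^sup>2 / h powr d"
        using h powr_add[of h "- d" 2] by (simp only: powr_minus powr_numeral less_imp_le) (simp add: divide_simps)
      then show ?thesis using powr_divide[of \<rho> h d] by simp
    qed
    have "cmod (\<integral>z. g z \<partial>(lebesgue_on \<Omega>)) \<le> max C1 C2 *
        (h powr (- d + 2) * (if v = w then 1 else word_dist m \<gamma> p nx pe v w powr (- d) * H powr (- d)) * N)"
    proof (cases "v = w")
      case True
      have "\<forall>y\<in>\<Omega>. \<forall>z\<in>\<Omega>. \<bar>Re y - Re z\<bar> \<le> K"
      proof (intro ballI)
        fix y z assume "y \<in> \<Omega>" "z \<in> \<Omega>"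
        then have "cmod (y - z) \<le> K" using bounded_D[OF bl bl] \<Omega>D D_closure by blast
        then show "\<bar>Re y - Re z\<bar> \<le> K" using abs_Re_le_cmod[of "y - z"] by simp
      qed
      then obtain A where A: "A \<in> sets lborel" "\<Omega> \<subseteq> A" "emeasure lborel A \<le> ennreal (C * h\<^sup>2 * (K / h) powr d)"
        using area[OF h(1), of K \<Omega> b] h(2) K by (auto simp: \<Omega>_def)
      define X where "X = C1 * (h powr (- d + 2) * N)"
      have X0: "0 \<le> X" using C12 N by (simp add: X_def)
      have "cmod (\<integral>z. g z \<partial>(lebesgue_on \<Omega>)) \<le> X"
      proof (rule norm_integral_le_dyadic_cover[where A = "\<lambda>j. if j = 0 then A else {}" and B = "\<lambda>j. E * N", OF op])
        show "\<exists>j::nat. z \<in> (if j = 0 then A else {}) \<and> cmod (g z) \<le> E * N" if z: "z \<in> \<Omega>" for z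
        proof (intro exI[of _ 0] conjI)
          show "z \<in> (if (0::nat) = 0 then A else {})" using z A(2) by auto
          show "cmod (g z) \<le> E * N"
            unfolding g_def norm_mult using FP'(2,4)[OF z] E by (intro mult_mono) auto
        qed
        show "ennreal (E * N) * emeasure lborel (if j = 0 then A else {}) \<le> ennreal (X * (1/2) ^ Suc j)" for j :: nat
        proof (cases "j = 0")
          case True
          have "ennreal (E * N) * emeasure lborel A \<le> ennreal (E * N) * ennreal (C * h\<^sup>2 * (K / h) powr d)"
            using A(3) by (rule mult_left_mono) simp
          also have "\<dots> = ennreal (E * N * (C * h\<^sup>2 * (K / h) powr d))"
            using E N C by (simp add: ennreal_mult)
          also have "E * N * (C * h\<^sup>2 * (K / h) powr d) = E * N * C * (h\<^sup>2 * (K / h) powr d)" by simp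
          also have "\<dots> = X / 2" using hd[of K] K by (simp add: X_def C1_def mult_ac)
          finally show ?thesis using True by simp
        qed simp
      qed (use A X0 in auto)
      also have "\<dots> \<le> max C1 C2 * (h powr (- d + 2) * N)"
        unfolding X_def using N by (intro mult_right_mono) auto
      finally show ?thesis using True by simp
    next
      case False
      define r where "r = word_dist m \<gamma> p nx pe v w"
      define P where "P = \<bar>wpole v - wpole w\<bar>"
      have r: "0 < r" "r \<le> K / \<kappa>\<^sup>2 * P" using word_dist_poles[OF ch v w False] by (auto simp: r_def P_def)
      have PK: "P \<le> K" using abs_wpole_diff_le[OF v w] by (simp add: P_def)
      have P0: "0 < P"
      proof (rule ccontr)
        assume "\<not> 0 < P"
        then have "P = 0" by (simp add: P_def)
        then show False using r by simp
      qed
      \<comment> \<open>The diameter bound from \<open>phase_separates\<close>, with \<open>\<bar>p\<^sub>v - p\<^sub>w\<bar>\<close> replaced by the distance \<open>r\<close> of the words.\<close>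
      define \<rho> where "\<rho> j = Q * 2 ^ j / (H * r)" for j :: nat
      have \<rho>0: "0 < \<rho> j" for j using Q H r by (simp add: \<rho>_def)
      define Y where "Y j = {z \<in> \<Omega>. H * \<bar>Re (phase \<gamma> v w z)\<bar> \<le> 2 ^ j}" for j :: nat
      have h\<rho>: "h \<le> \<rho> j" for j
      proof -
        have "0 \<le> K / \<kappa>\<^sup>2" using K by simp
        then have "r \<le> K / \<kappa>\<^sup>2 * K" using r(2) mult_left_mono[OF PK] order_trans by blast
        also have "\<dots> = 1 * K * (K / \<kappa>\<^sup>2)" by simp
        also have "\<dots> \<le> (2 + 4 * B / \<kappa>) * K\<^sup>2 * (K / \<kappa>\<^sup>2)"
        proof (intro mult_right_mono mult_mono)
          show "K \<le> K\<^sup>2" using K by (simp add: power2_eq_square)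
        qed (use K kappa B in auto)
        also have "\<dots> = Q" by (simp add: Q_def mult_ac)
        finally have "r \<le> Q" .
        moreover have "Q * 1 \<le> Q * 2 ^ j" using Q by (intro mult_left_mono) auto
        ultimately have "r \<le> Q * 2 ^ j" by linarith
        then have "1 / H \<le> \<rho> j" using H r by (simp add: \<rho>_def divide_simps)
        then show ?thesis using h(3) by linarith
      qed
      have diam: "\<forall>y\<in>Y j. \<forall>z\<in>Y j. \<bar>Re y - Re z\<bar> \<le> \<rho> j" for j
      proof (intro ballI)
        fix y z assume y: "y \<in> Y j" and z: "z \<in> Y j"
        then have yz: "y \<in> \<Omega>" "z \<in> \<Omega>" by (auto simp: Y_def)
        have "P * \<bar>Re y - Re z\<bar> \<le> K\<^sup>2 * (\<bar>Re (phase \<gamma> v w y)\<bar> + \<bar>Re (phase \<gamma> v w z)\<bar> + 4 * (B * h) / \<kappa>)"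
          unfolding P_def using phase_separates[OF v _ w _ \<Omega>D[OF yz(1)] FP'(1)[OF yz(1)] \<Omega>D[OF yz(2)] FP'(1)[OF yz(2)]] b
          by blast
        also have "\<dots> \<le> K\<^sup>2 * (2 ^ j / H + 2 ^ j / H + (4 * B / \<kappa>) * (2 ^ j / H))"
        proof (intro mult_left_mono add_mono)
          show "\<bar>Re (phase \<gamma> v w y)\<bar> \<le> 2 ^ j / H" "\<bar>Re (phase \<gamma> v w z)\<bar> \<le> 2 ^ j / H"
            using y z H by (auto simp: Y_def pos_le_divide_eq mult.commute)
          have "1 / H \<le> 2 ^ j / H" using H by (intro divide_right_mono) auto
          then have "(4 * B / \<kappa>) * h \<le> (4 * B / \<kappa>) * (2 ^ j / H)"
            using h(3) B kappa by (intro mult_left_mono) auto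
          then show "4 * (B * h) / \<kappa> \<le> (4 * B / \<kappa>) * (2 ^ j / H)" by (simp add: mult.assoc)
        qed simp
        also have "\<dots> = K\<^sup>2 * (2 + 4 * B / \<kappa>) * (2 ^ j / H)" by (simp add: algebra_simps)
        finally have 1: "P * \<bar>Re y - Re z\<bar> \<le> K\<^sup>2 * (2 + 4 * B / \<kappa>) * (2 ^ j / H)" .
        have "r * \<bar>Re y - Re z\<bar> \<le> (K / \<kappa>\<^sup>2) * (P * \<bar>Re y - Re z\<bar>)"
          using mult_right_mono[OF r(2), of "\<bar>Re y - Re z\<bar>"] by (simp add: mult.assoc)
        also have "\<dots> \<le> (K / \<kappa>\<^sup>2) * (K\<^sup>2 * (2 + 4 * B / \<kappa>) * (2 ^ j / H))"
          using 1 K by (intro mult_left_mono) auto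
        also have "\<dots> = Q * 2 ^ j / H" by (simp add: Q_def mult_ac)
        finally show "\<bar>Re y - Re z\<bar> \<le> \<rho> j" using r H by (simp add: \<rho>_def divide_simps mult_ac)
      qed
      have "\<exists>A\<in>sets lborel. Y j \<subseteq> A \<and> emeasure lborel A \<le> ennreal (C * h\<^sup>2 * (\<rho> j / h) powr d)" for j
        by (rule area[OF h(1) h\<rho> _ diam]) (auto simp: Y_def \<Omega>_def)
      then obtain A where A: "\<And>j. A j \<in> sets lborel" "\<And>j. Y j \<subseteq> A j"
        "\<And>j. emeasure lborel (A j) \<le> ennreal (C * h\<^sup>2 * (\<rho> j / h) powr d)" by metis
      define X where "X = C2 * (h powr (- d + 2) * (r powr (- d) * H powr (- d)) * N)"
      have X0: "0 \<le> X" using C12 N by (simp add: X_def)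
      have "cmod (\<integral>z. g z \<partial>(lebesgue_on \<Omega>)) \<le> X"
      proof (rule norm_integral_le_dyadic_cover[OF op A(1) _ _ X0])
        fix z assume z: "z \<in> \<Omega>"
        define q where "q = H * \<bar>Re (phase \<gamma> v w z)\<bar>"
        define F where "F = cmod (fourier (cutoff \<phi> T H) (phase \<gamma> v w z))"
        obtain n where "q < 2 ^ n" using real_arch_pow[of 2 q] by auto
        then have ex: "\<exists>n. q \<le> 2 ^ n" by (intro exI[of _ n]) simp
        \<comment> \<open>For \<open>j > 0\<close> minimality gives \<open>q > 2 ^ (j - 1)\<close>, whence the decay \<open>E / 8 ^ (j - 1)\<close>.\<close>
        define j where "j = (LEAST n. q \<le> 2 ^ n)"
        have j: "q \<le> 2 ^ j" unfolding j_def by (rule LeastI_ex[OF ex])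
        have FE: "F \<le> 8 * E / 8 ^ j"
        proof (cases j)
          case 0
          then show ?thesis using FP'(2)[OF z] E by (simp add: F_def)
        next
          case (Suc i)
          have "2 ^ i \<le> q" using not_less_Least[of i "\<lambda>n. q \<le> 2 ^ n"] Suc by (simp add: j_def)
          then have "(2 ^ i) ^ 3 \<le> q ^ 3" by (intro power_mono) auto
          moreover have "((2::real) ^ i) ^ 3 = (2 ^ 3) ^ i" by (simp only: power_mult[symmetric] mult.commute)
          ultimately have "8 ^ i \<le> q ^ 3" by simp
          then have "8 ^ i * F \<le> q ^ 3 * F" by (rule mult_right_mono) (simp add: F_def)
          also have "\<dots> \<le> E" using FP'(3)[OF z] by (simp add: q_def F_def)
          finally show ?thesis using Suc by (simp add: field_simps)
        qed
        have "z \<in> A j" using A(2)[of j] z j by (auto simp: Y_def q_def)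
        moreover have "cmod (g z) \<le> 8 * E / 8 ^ j * N"
          unfolding g_def norm_mult F_def[symmetric] using FE FP'(4)[OF z] E by (intro mult_mono) (auto simp: F_def)
        ultimately show "\<exists>j. z \<in> A j \<and> cmod (g z) \<le> 8 * E / 8 ^ j * N" by blast
      next
        fix j :: nat
        have e1: "(\<rho> j / h) powr d = (Q / (H * r) / h) powr d * (2 ^ j) powr d"
          by (simp add: \<rho>_def mult_ac flip: powr_mult)
        have "(2 ^ j) powr d \<le> ((2 ^ j) powr 2 :: real)" using d by (intro powr_mono) auto
        also have "\<dots> = 4 ^ j" by (simp add: powr_numeral power2_eq_square flip: power_mult_distrib)
        finally have e2: "(2 ^ j) powr d \<le> (4 ^ j :: real)" .
        have "ennreal (8 * E / 8 ^ j * N) * emeasure lborel (A j)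
            \<le> ennreal (8 * E / 8 ^ j * N) * ennreal (C * h\<^sup>2 * (\<rho> j / h) powr d)"
          using A(3) by (rule mult_left_mono) simp
        also have "\<dots> = ennreal (8 * E / 8 ^ j * N * (C * h\<^sup>2 * (\<rho> j / h) powr d))"
          by (rule ennreal_mult[symmetric]) (use E N C in auto)
        also have "\<dots> \<le> ennreal (X * (1/2) ^ Suc j)"
        proof (rule ennreal_leI)
          have "8 * E / 8 ^ j * N * (C * h\<^sup>2 * (\<rho> j / h) powr d)
              \<le> 8 * E / 8 ^ j * N * (C * h\<^sup>2 * ((Q / (H * r) / h) powr d * 4 ^ j))"
            unfolding e1 using e2 E N C by (intro mult_left_mono) auto
          also have "\<dots> = 8 * E * C * N * (h\<^sup>2 * (Q / (H * r) / h) powr d) * (4 ^ j / 8 ^ j)"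
            by (simp add: mult_ac)
          also have "(4::real) ^ j / 8 ^ j = (1/2) ^ j" by (simp flip: power_divide)
          also have "h\<^sup>2 * (Q / (H * r) / h) powr d = h powr (- d + 2) * (Q / (H * r)) powr d"
            by (rule hd) (use Q H r in simp)
          also have "(Q / (H * r)) powr d = Q powr d * (r powr (- d) * H powr (- d))"
            using Q H r by (simp add: powr_divide powr_mult powr_minus divide_simps)
          also have "8 * E * C * N * (h powr (- d + 2) * (Q powr d * (r powr (- d) * H powr (- d)))) * (1/2) ^ j
              = X * (1/2) ^ Suc j" by (simp add: X_def C2_def mult_ac)
          finally show "8 * E / 8 ^ j * N * (C * h\<^sup>2 * (\<rho> j / h) powr d) \<le> X * (1/2) ^ Suc j" .
        qed
        finally show "ennreal (8 * E / 8 ^ j * N) * emeasure lborel (A j) \<le> ennreal (X * (1/2) ^ Suc j)" .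
      qed
      also have "\<dots> \<le> max C1 C2 * (h powr (- d + 2) * (r powr (- d) * H powr (- d)) * N)"
        unfolding X_def using N by (intro mult_right_mono) auto
      finally show ?thesis using False by (simp add: r_def)
    qed
    then show "cmod (\<integral>z. fourier (cutoff \<phi> T H) (phase \<gamma> v w z) * f z \<partial>(lebesgue_on (Omega_at m D \<gamma> b (1 / T))))
      \<le> max C1 C2 * ((1 / T) powr (- d + 2) * (if v = w then 1 else word_dist m \<gamma> p nx pe v w powr (- d) * H powr (- d)) * N)"
      unfolding g_def \<Omega>_def h_def .
  qed
qed

end

theorem proposition3p4:
  fixes m :: nat
    and D :: "nat \<Rightarrow> complex set"
    and \<gamma> :: "nat \<Rightarrow> real^2^2"
    and p :: "nat \<Rightarrow> real"
    and nx :: "nat list \<Rightarrow> nat"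
    and pe :: complex
    and \<phi> :: "real \<Rightarrow> real"
    and \<delta> :: real
  assumes schottky: "schottky_data m D \<gamma>"
    and choices: "base_choices m D p nx pe"
    and delta: "\<delta> = hausdorff_dim (limit_set m \<gamma>)"
    and phi_smooth: "smooth \<phi>"
    and phi_nonneg: "\<forall>t. 0 \<le> \<phi> t"
    and phi_supp: "closure {t. \<phi> t \<noteq> 0} = {-2..2}"
    and phi_one: "\<forall>t\<in>{-1..1}. \<phi> t = 1"
  shows "\<exists>T\<^sub>0>0. \<forall>\<eta>>0. \<forall>\<epsilon>>0. \<exists>C>0.
    \<forall>T\<ge>T\<^sub>0. \<forall>H. T powr \<eta> \<le> H \<and> H \<le> T \<longrightarrow>
    (\<forall>b\<in>letters m. \<forall>v\<in>words_ne m. \<forall>w\<in>words_ne m. follows m v [b] \<and> follows m w [b] \<longrightarrow>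
    (\<forall>f \<in> borel_measurable (lebesgue_on (\<Union>a\<in>letters m. D a)).
      let h = 1 / T; \<Omega> = Omega_at m D \<gamma> b h in
      bdd_above ((\<lambda>z. cmod (f z)) ` \<Omega>) \<longrightarrow>
      cmod (\<integral>z. fourier (cutoff \<phi> T H) (phase \<gamma> v w z) * f z \<partial>(lebesgue_on \<Omega>))
        \<le> C * (if v = w
               then h powr (- \<delta> + 2) * (SUP z\<in>\<Omega>. cmod (f z))
               else h powr (- \<delta> + 2) * word_dist m \<gamma> p nx pe v w powr (- \<delta>)
                      * H powr (- \<delta> + \<epsilon>) * (SUP z\<in>\<Omega>. cmod (f z)))))"
proof -
  interpret schottky m D \<gamma> by unfold_locales (rule schottky)
  obtain \<kappa> K M where "schottky_geometry m D \<gamma> \<kappa> K M" using ex_schottky_geometry by blast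
  then interpret schottky_geometry m D \<gamma> \<kappa> K M .
  have supp: "\<forall>t. 2 < \<bar>t\<bar> \<longrightarrow> \<phi> t = 0"
  proof (intro allI impI, rule ccontr)
    fix t assume that: "2 < \<bar>t\<bar>" "\<phi> t \<noteq> 0"
    have "t \<in> closure {t. \<phi> t \<noteq> 0}" using closure_subset[of "{t. \<phi> t \<noteq> 0}"] that(2) by blast
    then show False using phi_supp that(1) by auto
  qed
  have \<delta>: "\<delta> = hausdorff_dim limset" using delta limit_set_eq by simp
  obtain T\<^sub>0 C where T\<^sub>0: "1 \<le> T\<^sub>0" and C: "0 < C" and main:
    "\<forall>T\<ge>T\<^sub>0. \<forall>H. 1 \<le> H \<longrightarrow> H \<le> T \<longrightarrow>
    (\<forall>v\<in>words_ne m. \<forall>w\<in>words_ne m. \<forall>b\<in>nexts m v \<inter> nexts m w. \<forall>f N.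
      (\<forall>z\<in>Omega_at m D \<gamma> b (1 / T). cmod (f z) \<le> N) \<longrightarrow> 0 \<le> N \<longrightarrow>
      cmod (\<integral>z. fourier (cutoff \<phi> T H) (phase \<gamma> v w z) * f z \<partial>(lebesgue_on (Omega_at m D \<gamma> b (1 / T))))
      \<le> C * ((1 / T) powr (- \<delta> + 2) * (if v = w then 1 else word_dist m \<gamma> p nx pe v w powr (- \<delta>) * H powr (- \<delta>)) * N))"
    using oscillatory_integral_bound[OF choices phi_smooth supp] unfolding \<delta>[symmetric]
    by (elim exE conjE) (rule that)
  show ?thesis
    unfolding Let_def
  proof (rule exI[of _ T\<^sub>0], rule conjI, rule less_le_trans[OF zero_less_one T\<^sub>0],
      intro allI impI, rule exI[of _ C], intro conjI C allI impI ballI)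
    fix \<eta> \<epsilon> T H :: real and b v w f
    assume \<eta>: "0 < \<eta>" and \<epsilon>: "0 < \<epsilon>" and T: "T\<^sub>0 \<le> T" and "T powr \<eta> \<le> H \<and> H \<le> T"
      and b: "b \<in> letters m" and v: "v \<in> words_ne m" and w: "w \<in> words_ne m"
      and fol: "follows m v [b] \<and> follows m w [b]"
      and bdd: "bdd_above ((\<lambda>z. cmod (f z)) ` Omega_at m D \<gamma> b (1 / T))"
    then have H: "1 \<le> H" "H \<le> T"
      using T\<^sub>0 ge_one_powr_ge_zero[of T \<eta>] by auto
    let ?\<Omega> = "Omega_at m D \<gamma> b (1 / T)"
    let ?N = "SUP z\<in>?\<Omega>. cmod (f z)"
    have bn: "b \<in> nexts m v \<inter> nexts m w" using b fol by (simp add: nexts_def)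
    have f: "cmod (f z) \<le> ?N" if "z \<in> ?\<Omega>" for z using that by (rule cSUP_upper[OF _ bdd])
    obtain z where "z \<in> ?\<Omega>" using Omega_nonempty[of "1 / T" b] b T T\<^sub>0 by auto
    then have N: "0 \<le> ?N" using f[of z] norm_ge_zero order_trans by blast
    \<comment> \<open>\<open>H \<ge> 1\<close> turns the bound with exponent \<open>- \<delta>\<close> into the one claimed.\<close>
    have "H powr (- \<delta>) \<le> H powr (- \<delta> + \<epsilon>)" using H \<epsilon> by (intro powr_mono) auto
    then have "(1 / T) powr (- \<delta> + 2) * word_dist m \<gamma> p nx pe v w powr (- \<delta>) * H powr (- \<delta>) * ?N
        \<le> (1 / T) powr (- \<delta> + 2) * word_dist m \<gamma> p nx pe v w powr (- \<delta>) * H powr (- \<delta> + \<epsilon>) * ?N"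
      using N by (intro mult_right_mono mult_left_mono) auto
    then have "C * ((1 / T) powr (- \<delta> + 2) * (if v = w then 1 else word_dist m \<gamma> p nx pe v w powr (- \<delta>) * H powr (- \<delta>)) * ?N)
       \<le> C * (if v = w
               then (1 / T) powr (- \<delta> + 2) * ?N
               else (1 / T) powr (- \<delta> + 2) * word_dist m \<gamma> p nx pe v w powr (- \<delta>)
                      * H powr (- \<delta> + \<epsilon>) * ?N)"
      using C by (intro mult_left_mono) (auto simp: mult.assoc)
    moreover have "cmod (\<integral>z. fourier (cutoff \<phi> T H) (phase \<gamma> v w z) * f z \<partial>(lebesgue_on ?\<Omega>))
        \<le> C * ((1 / T) powr (- \<delta> + 2) * (if v = w then 1 else word_dist m \<gamma> p nx pe v w powr (- \<delta>) * H powr (- \<delta>)) * ?N)"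
      by (rule main[rule_format, OF T H v w bn _ N]) (rule f)
    ultimately show "cmod (\<integral>z. fourier (cutoff \<phi> T H) (phase \<gamma> v w z) * f z \<partial>(lebesgue_on ?\<Omega>))
        \<le> C * (if v = w
               then (1 / T) powr (- \<delta> + 2) * ?N
               else (1 / T) powr (- \<delta> + 2) * word_dist m \<gamma> p nx pe v w powr (- \<delta>)
                      * H powr (- \<delta> + \<epsilon>) * ?N)"
      by linarith
  qed
qed

end
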